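(* Let $p$ be a prime, $S$ a finite $p$-group and $\mathcal{F}$ a (not necessarily saturated) fusion system on $S$. Let $R$ be an integral domain such that $\{0\}\neq pR\neq R$ and such that for every isomorphism $\phi\colon P\to Q$ in $\mathcal{F}$ and every prime divisor $q$ of the index $[\mathrm{Aut}_{\mathcal{F}}(P):\mathrm{Aut}_{\mathcal{F}}(P)\cap\mathrm{Aut}_S(Q)^\phi]$ one has $\{0\}\neq qR\neq R$. Then $0$ and $1$ are the only central idempotents of $RB^{\mathcal{F}}(S,S)$. In particular, the center of $B^{\mathcal{F}}(S,S)$ has no idempotents other than $0$ and $1$.
   Context: For a finite group $S$, $B(S,S)$ is the double Burnside ring: the Grothendieck group of finite $(S,S)$-bisets (identified with left $S\times S$-sets via $(g,h)x=gxh^{-1}$) with respect to disjoint union, with multiplication induced by $X\times_S Y$. For subgroups $P,Q\le S$ and an isomorphism $\phi\colon Q\to P$, $\Delta(P,\phi,Q)=\{(\phi(x),x)\mid x\in Q\}\le S\times S$. $B^{\mathcal{F}}(S,S)$ is the $\mathbb{Z}$-span of the elements $[S\times S/\Delta(P,\phi,Q)]$ where $\phi\colon Q\to P$ runs through the isomorphisms in $\mathcal{F}$; it is a subring of $B(S,S)$, and $RB^{\mathcal{F}}(S,S)=R\otimes_{\mathbb{Z}}B^{\mathcal{F}}(S,S)$. $\mathrm{Aut}_{\mathcal{F}}(P)$ denotes the group of $\mathcal{F}$-automorphisms of $P$; $\mathrm{Aut}_S(Q)$ is the image of $N_S(Q)\to\mathrm{Aut}(Q)$, $g\mapsto c_g$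 ($c_g(x)=gxg^{-1}$); and $\mathrm{Aut}_S(Q)^\phi=\phi^{-1}\mathrm{Aut}_S(Q)\phi\le\mathrm{Aut}(P)$. *)

theory Defs
  imports "HOL-Algebra.Coset" "HOL-Computational_Algebra.Primes"
begin

definition conjmap :: "('a,'b) monoid_scheme \<Rightarrow> 'a \<Rightarrow> 'a set \<Rightarrow> 'a \<Rightarrow> 'a" where
  "conjmap G g P = restrict (\<lambda>x. g \<otimes>\<^bsub>G\<^esub> x \<otimes>\<^bsub>G\<^esub> inv\<^bsub>G\<^esub> g) P"

definition fusion_system ::
  "('a,'b) monoid_scheme \<Rightarrow> ('a set \<times> ('a \<Rightarrow> 'a) \<times> 'a set) set \<Rightarrow> bool" where
  "fusion_system G F \<longleftrightarrow>
     (\<forall>(P,\<phi>,Q)\<in>F. subgroup P G \<and> subgroup Q G \<and> \<phi> \<in> extensional P \<and>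
        \<phi> \<in> hom (G\<lparr>carrier := P\<rparr>) (G\<lparr>carrier := Q\<rparr>) \<and> inj_on \<phi> P)
   \<and> (\<forall>P Q g. subgroup P G \<and> subgroup Q G \<and> g \<in> carrier G \<and>
        (\<forall>x\<in>P. g \<otimes>\<^bsub>G\<^esub> x \<otimes>\<^bsub>G\<^esub> inv\<^bsub>G\<^esub> g \<in> Q)
        \<longrightarrow> (P, conjmap G g P, Q) \<in> F)
   \<and> (\<forall>P \<phi> Q \<psi> R. (P,\<phi>,Q) \<in> F \<and> (Q,\<psi>,R) \<in> F \<longrightarrow> (P, restrict (\<psi> \<circ> \<phi>) P, R) \<in> F)
   \<and> (\<forall>(P,\<phi>,Q)\<in>F. (P, \<phi>, \<phi> ` P) \<in> F \<and>
        (\<phi> ` P, restrict (inv_into P \<phi>) (\<phi> ` P), P) \<in> F)"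

definition AutF :: "('a set \<times> ('a \<Rightarrow> 'a) \<times> 'a set) set \<Rightarrow> 'a set \<Rightarrow> ('a \<Rightarrow> 'a) set" where
  "AutF F P = {\<alpha>. (P, \<alpha>, P) \<in> F}"

definition AutS :: "('a,'b) monoid_scheme \<Rightarrow> 'a set \<Rightarrow> ('a \<Rightarrow> 'a) set" where
  "AutS G Q = {conjmap G g Q | g. g \<in> carrier G \<and>
                 (\<lambda>x. g \<otimes>\<^bsub>G\<^esub> x \<otimes>\<^bsub>G\<^esub> inv\<^bsub>G\<^esub> g) ` Q = Q}"

definition AutS_conj :: "('a,'b) monoid_scheme \<Rightarrow> 'a set \<Rightarrow> ('a \<Rightarrow> 'a) \<Rightarrow> 'a set \<Rightarrow> ('a \<Rightarrow> 'a) set" where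
  "AutS_conj G P \<phi> Q = {restrict (inv_into P \<phi> \<circ> c \<circ> \<phi>) P | c. c \<in> AutS G Q}"

definition fusion_index ::
  "('a,'b) monoid_scheme \<Rightarrow> ('a set \<times> ('a \<Rightarrow> 'a) \<times> 'a set) set \<Rightarrow> 'a set \<Rightarrow> ('a \<Rightarrow> 'a) \<Rightarrow> 'a set \<Rightarrow> nat" where
  "fusion_index G F P \<phi> Q = card (AutF F P) div card (AutF F P \<inter> AutS_conj G P \<phi> Q)"

text \<open>Delta(P,phi,Q) = {(phi x, x) | x in Q} \<le> S \<times> S, for phi : Q \<rightarrow> P.\<close>
definition Delta :: "'a set \<Rightarrow> ('a \<Rightarrow> 'a) \<Rightarrow> 'a set \<Rightarrow> ('a \<times> 'a) set" where
  "Delta P \<phi> Q = {(\<phi> x, x) | x. x \<in> Q}"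

definition lact :: "('a,'b) monoid_scheme \<Rightarrow> 'a \<times> 'a \<Rightarrow> ('a \<times> 'a) set \<Rightarrow> ('a \<times> 'a) set" where
  "lact G u C = (\<lambda>c. u \<otimes>\<^bsub>G \<times>\<times> G\<^esub> c) ` C"

text \<open>The transitive (S,S)-biset S\<times>S/L, as the set of left cosets of L in S\<times>S.\<close>
definition cosets2 :: "('a,'b) monoid_scheme \<Rightarrow> ('a \<times> 'a) set \<Rightarrow> ('a \<times> 'a) set set" where
  "cosets2 G L = {u <#\<^bsub>G \<times>\<times> G\<^esub> L | u. u \<in> carrier G \<times> carrier G}"

text \<open>For bisets X, Y (as left S\<times>S-sets, (g,h)x = g x h^-1) we have x\<cdot>s = (1,s^-1)x and
  s\<cdot>y = (s,1)y; the class of (x,y) in X \<times>_S Y is {(x\<cdot>s, s^-1\<cdot>y)} = {((1,s)x, (s,1)y)}.\<close>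
definition tens_class :: "('a,'b) monoid_scheme \<Rightarrow> ('a \<times> 'a) set \<Rightarrow> ('a \<times> 'a) set
    \<Rightarrow> (('a \<times> 'a) set \<times> ('a \<times> 'a) set) set" where
  "tens_class G C D = {(lact G (\<one>\<^bsub>G\<^esub>, s) C, lact G (s, \<one>\<^bsub>G\<^esub>) D) | s. s \<in> carrier G}"

definition tens :: "('a,'b) monoid_scheme \<Rightarrow> ('a \<times> 'a) set \<Rightarrow> ('a \<times> 'a) set
    \<Rightarrow> (('a \<times> 'a) set \<times> ('a \<times> 'a) set) set set" where
  "tens G L M = {tens_class G C D | C D. C \<in> cosets2 G L \<and> D \<in> cosets2 G M}"

text \<open>Action of S\<times>S on X \<times>_S Y: (g,h)[x,y] = [g x, y h^-1] = [(g,1)x, (1,h)y].\<close>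
definition tens_act :: "('a,'b) monoid_scheme \<Rightarrow> 'a \<times> 'a
    \<Rightarrow> (('a \<times> 'a) set \<times> ('a \<times> 'a) set) set \<Rightarrow> (('a \<times> 'a) set \<times> ('a \<times> 'a) set) set" where
  "tens_act G u z = (\<lambda>(C,D). (lact G (fst u, \<one>\<^bsub>G\<^esub>) C, lact G (\<one>\<^bsub>G\<^esub>, snd u) D)) ` z"

definition tens_stab :: "('a,'b) monoid_scheme \<Rightarrow> (('a \<times> 'a) set \<times> ('a \<times> 'a) set) set \<Rightarrow> ('a \<times> 'a) set" where
  "tens_stab G z = {u \<in> carrier G \<times> carrier G. tens_act G u z = z}"

definition tens_orbit :: "('a,'b) monoid_scheme \<Rightarrow> (('a \<times> 'a) set \<times> ('a \<times> 'a) set) set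
    \<Rightarrow> (('a \<times> 'a) set \<times> ('a \<times> 'a) set) set set" where
  "tens_orbit G z = {tens_act G u z | u. u \<in> carrier G \<times> carrier G}"

text \<open>S\<times>S-conjugacy class of a subgroup L of S\<times>S, and the set of all such classes
  (these index the isomorphism classes of transitive bisets, i.e. the Z-basis of B(S,S)).\<close>
definition ccl :: "('a,'b) monoid_scheme \<Rightarrow> ('a \<times> 'a) set \<Rightarrow> ('a \<times> 'a) set set" where
  "ccl G L = {(\<lambda>x. u \<otimes>\<^bsub>G \<times>\<times> G\<^esub> x \<otimes>\<^bsub>G \<times>\<times> G\<^esub> inv\<^bsub>G \<times>\<times> G\<^esub> u) ` L | u. u \<in> carrier G \<times> carrier G}"

definition sclasses :: "('a,'b) monoid_scheme \<Rightarrow> ('a \<times> 'a) set set set" where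
  "sclasses G = {ccl G L | L. subgroup L (G \<times>\<times> G)}"

text \<open>Multiplicity of [S\<times>S/N] (N in the class K) in [S\<times>S/L] \<times>_S [S\<times>S/M]: number of orbits
  whose point stabilizers lie in K.\<close>
definition coef :: "('a,'b) monoid_scheme \<Rightarrow> ('a \<times> 'a) set \<Rightarrow> ('a \<times> 'a) set \<Rightarrow> ('a \<times> 'a) set set \<Rightarrow> nat" where
  "coef G L M K = card {tens_orbit G z | z. z \<in> tens G L M \<and> tens_stab G z \<in> K}"

text \<open>Elements of R B(S,S): finitely supported R-linear combinations of the basis
  elements [S\<times>S/L], encoded as coefficient functions on conjugacy classes.\<close>
definition RB :: "('a,'b) monoid_scheme \<Rightarrow> (('a \<times> 'a) set set \<Rightarrow> 'r::comm_ring_1) set" where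
  "RB G = {a. \<forall>K. K \<notin> sclasses G \<longrightarrow> a K = 0}"

definition bmult :: "('a,'b) monoid_scheme \<Rightarrow> (('a \<times> 'a) set set \<Rightarrow> 'r::comm_ring_1)
    \<Rightarrow> (('a \<times> 'a) set set \<Rightarrow> 'r) \<Rightarrow> (('a \<times> 'a) set set \<Rightarrow> 'r)" where
  "bmult G a b = (\<lambda>K. if K \<in> sclasses G then
      (\<Sum>K1\<in>sclasses G. \<Sum>K2\<in>sclasses G.
          a K1 * b K2 * of_nat (coef G (SOME L. L \<in> K1) (SOME M. M \<in> K2) K))
    else 0)"

definition bone :: "('a,'b) monoid_scheme \<Rightarrow> (('a \<times> 'a) set set \<Rightarrow> 'r::comm_ring_1)" where
  "bone G = (\<lambda>K. if K = ccl G (Delta (carrier G) id (carrier G)) then 1 else 0)"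

definition bzero :: "(('a \<times> 'a) set set \<Rightarrow> 'r::comm_ring_1)" where
  "bzero = (\<lambda>K. 0)"

definition RBF :: "('a,'b) monoid_scheme \<Rightarrow> ('a set \<times> ('a \<Rightarrow> 'a) \<times> 'a set) set
    \<Rightarrow> (('a \<times> 'a) set set \<Rightarrow> 'r::comm_ring_1) set" where
  "RBF G F = {a \<in> RB G. \<forall>K. a K \<noteq> 0 \<longrightarrow>
      (\<exists>P \<phi> Q. (Q, \<phi>, P) \<in> F \<and> \<phi> ` Q = P \<and> K = ccl G (Delta P \<phi> Q))}"

end

(*
Write T(phi,psi) = {(phi q, psi q) | q in Q} for morphisms phi, psi : Q -> S in F. For a in RB^F(S,S)
let E_a be the matrix indexed by Hom_F(Q,S) whose (phi,psi) entry is the mark of a at T(phi,psi).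
Counting fixed points on X x_S Y gives |S| E_{ab} = E_a E_b. The hypothesis on p makes R of
characteristic 0.

Let e be a central idempotent. Commutation with [S x S / Delta(Q)] shows that E_e(phi,psi) = 0
if psi(Q), but not phi(Q), is S-conjugate to Q. On the block of those phi with phi(Q) S-conjugate
to Q, both E_e and J - E_e, where J = E_1, satisfy X^2 = |S| X, hence have trace |S| times a natural
number, and both vanish if that number is 0. As C_S(Q) acts freely on the fixed points of Delta(Q),
E_e(id,id) = |C_S(Q)| m_Q with m_Q in R, so tr E_e = m_Q tr J, and tr J = |S| [Aut_F(Q) : Aut_S(Q)].
The hypothesis on the primes dividing this index leaves only m_Q = 0, E_e = 0, or m_Q = 1, E_e = J.

Summing E_e(phi,id) over all phi expresses m_Q as a combination of the numbers of Q-fixed points on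
the S-sets S/pr_2(L), which modulo p do not depend on Q; as p is not a unit, neither does m_Q.
Marks separate the elements of RB^F(S,S), so e = 0 or e = 1.
*)

theory Submission
  imports Defs
begin

section \<open>Traces of scaled idempotents and images of natural numbers\<close>

text \<open>Over the fraction field of R, E_e / |S| is an idempotent matrix on a block and its trace
  is its rank. Since |S| is not invertible in R unless S is trivial, all identities are kept
  multiplied by |S|, |Q| or |L|. The product formula rests on left freeness: a pair (C, D) whose
  class is fixed by T(phi,psi) determines the middle morphism, and every class of pairs has exactly
  |S| members. On the block, T(alpha,alpha) is the diagonal of an S-conjugate of Q, so the diagonal
  of E_e is constant. Hence d_0 m_Q = d, where d and d_0 are the ranks of E_e and J on the block and
  d_0 is the index of Aut_S(Q) in Aut_F(Q). A denominator of d / d_0 would have a prime factor that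
  is a unit of R; so d_0 divides d, and d <= d_0 leaves m_Q = 0 or 1. The blocks of different Q
  share no entries. They are compared through column sums: modulo the left action of S, the biset S
  x S / L becomes S / pr_2(L), on which the p-group Q has |S / pr_2(L)| fixed points modulo
  p.\<close>

lemma scaled_idempotent_trace:
  fixes X :: "'i \<Rightarrow> 'i \<Rightarrow> 'r::idom"
  assumes fin: "finite B" and "c \<noteq> 0"
    and "\<And>i j. i \<in> B \<Longrightarrow> j \<in> B \<Longrightarrow> (\<Sum>k\<in>B. X i k * X k j) = c * X i j"
  shows "\<exists>d. (\<Sum>i\<in>B. X i i) = c * of_nat d \<and> (d = 0 \<longrightarrow> (\<forall>i\<in>B. \<forall>j\<in>B. X i j = 0))"
  using assms(2-3)
proof (induction "card {i\<in>B. \<exists>j\<in>B. X i j \<noteq> 0}" arbitrary: X c rule: less_induct)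
  case less
  show ?case
  proof (cases "\<exists>i\<in>B. \<exists>j\<in>B. X i j \<noteq> 0")
    case False
    then have "(\<Sum>i\<in>B. X i i) = c * of_nat 0" by auto
    with False show ?thesis by blast
  next
    case True
    then obtain i0 j0 where ij: "i0 \<in> B" "j0 \<in> B" "X i0 j0 \<noteq> 0" by blast
    define t where "t = X i0 j0"
    \<comment> \<open>With the pivot \<open>t\<close> this is \<open>t\<close> times
      \<open>X\<close> minus a rank-one matrix, so nothing is divided. Over the fraction field,
      \<open>Y / (c t)\<close> is \<open>X / c\<close> minus an idempotent of rank one: row
      \<open>i0\<close> becomes zero, zero rows stay zero, and the trace of the scaled matrix drops
      by exactly 1. So \<open>d\<close> is the rank of \<open>X\<close>.\<close>
    define Y where "Y = (\<lambda>i j. t * X i j - X i j0 * X i0 j)"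
    have sq: "(\<Sum>k\<in>B. X i k * X k j) = c * X i j" if "i \<in> B" "j \<in> B" for i j
      using less.prems that by blast
    have "(\<Sum>k\<in>B. Y i k * Y k j) = (c * t) * Y i j" if i: "i \<in> B" and j: "j \<in> B" for i j
    proof -
      have "(\<Sum>k\<in>B. Y i k * Y k j) = (\<Sum>k\<in>B. t * t * (X i k * X k j)
          - t * X i0 j * (X i k * X k j0) - t * X i j0 * (X i0 k * X k j)
          + X i j0 * X i0 j * (X i0 k * X k j0))"
        unfolding Y_def by (intro sum.cong refl) (simp add: algebra_simps)
      also have "\<dots> = t * t * (\<Sum>k\<in>B. X i k * X k j)
          - t * X i0 j * (\<Sum>k\<in>B. X i k * X k j0) - t * X i j0 * (\<Sum>k\<in>B. X i0 k * X k j)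
          + X i j0 * X i0 j * (\<Sum>k\<in>B. X i0 k * X k j0)"
        by (simp add: sum.distrib sum_subtractf sum_distrib_left)
      also have "\<dots> = (c * t) * Y i j"
        unfolding sq[OF i j] sq[OF i ij(2)] sq[OF ij(1) j] sq[OF ij(1,2)] by (simp add: Y_def t_def algebra_simps)
      finally show ?thesis .
    qed
    moreover have "c * t \<noteq> 0" using less.prems(1) ij(3) t_def by simp
    moreover have "card {i\<in>B. \<exists>j\<in>B. Y i j \<noteq> 0} < card {i\<in>B. \<exists>j\<in>B. X i j \<noteq> 0}"
    proof (rule psubset_card_mono)
      show "finite {i\<in>B. \<exists>j\<in>B. X i j \<noteq> 0}" using fin by simp
      have "Y i0 j = 0" for j unfolding Y_def t_def by simp
      moreover have "Y i j = 0" if "\<forall>j\<in>B. X i j = 0" "j \<in> B" for i j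
        unfolding Y_def using that ij(2) by simp
      ultimately show "{i\<in>B. \<exists>j\<in>B. Y i j \<noteq> 0} \<subset> {i\<in>B. \<exists>j\<in>B. X i j \<noteq> 0}"
        using ij by (auto; blast)
    qed
    ultimately obtain d where d: "(\<Sum>i\<in>B. Y i i) = c * t * of_nat d"
      using less.hyps by blast
    have "(\<Sum>i\<in>B. Y i i) = t * (\<Sum>i\<in>B. X i i) - (\<Sum>i\<in>B. X i0 i * X i j0)"
      unfolding Y_def by (simp add: sum_subtractf sum_distrib_left mult.commute)
    then have "t * (\<Sum>i\<in>B. X i i) = t * (c * of_nat (Suc d))"
      using d sq[OF ij(1,2)] by (simp add: t_def algebra_simps)
    then have "(\<Sum>i\<in>B. X i i) = c * of_nat (Suc d)"
      using ij(3) t_def by simp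
    then show ?thesis by blast
  qed
qed

lemma coprime_of_nat_dvd_one:
  assumes "coprime m n" "of_nat n dvd (of_nat m :: 'r::comm_ring_1)"
  shows "of_nat n dvd (1::'r)"
proof -
  obtain u v where uv: "u * int m + v * int n = 1"
    using bezout_int[of "int m" "int n"] assms(1) by (metis coprime_imp_gcd_eq_1 coprime_int_iff)
  have "of_int (u * int m + v * int n) = (1::'r)" unfolding uv by simp
  then have "of_int u * of_nat m + of_int v * of_nat n = (1::'r)" by simp
  then show ?thesis using assms(2) by (metis dvd_add dvd_mult dvd_triv_right)
qed

text \<open>Factors \<open>p\<close> cancel, being nonzero in a domain. If the remaining number,
  prime to \<open>p\<close>, vanished in the ring, then \<open>p\<close> would divide it there and
  Bezout would make \<open>p\<close> a unit.\<close>

lemma of_nat_eq_0_if_nonunit_prime: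
  assumes "prime p" and p: "of_nat p \<noteq> (0::'r::idom)" "\<not> of_nat p dvd (1::'r)"
    and "of_nat n = (0::'r)"
  shows "n = 0"
  using assms(4)
proof (induction n rule: less_induct)
  case (less n)
  show ?case
  proof (cases "p dvd n")
    case True
    then obtain k where k: "n = p * k" by blast
    then have "of_nat k = (0::'r)" using less.prems p(1) by simp
    then show ?thesis using less.IH[of k] k prime_gt_1_nat[OF assms(1)] by (cases "k = 0") auto
  next
    case False
    then have "coprime n p" using assms(1) by (metis coprime_commute prime_imp_coprime)
    moreover have "of_nat p dvd (of_nat n :: 'r)" unfolding less.prems by simp
    ultimately show ?thesis using coprime_of_nat_dvd_one p(2) by blast
  qed
qed

text \<open>In lowest terms, let \<open>d / d0 = a / b\<close>. A prime dividing \<open>b\<close>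
  divides \<open>a\<close> in the ring, although it is coprime to \<open>a\<close> as an integer, so
  it is a unit there. Hence \<open>b = 1\<close>.\<close>

lemma dvd_of_of_nat_quotient:
  fixes m :: "'r::idom"
  assumes char: "\<And>n. of_nat n = (0::'r) \<Longrightarrow> n = 0"
    and eq: "of_nat d0 * m = of_nat d" and d0: "d0 > 0"
    and primes: "\<And>q. prime q \<Longrightarrow> q dvd d0 \<Longrightarrow> \<not> of_nat q dvd (1::'r)"
  shows "d0 dvd d"
proof -
  define g where "g = gcd d d0"
  have g: "g \<noteq> 0" using d0 by (simp add: g_def)
  obtain a b where ab: "d = a * g" "d0 = b * g" "coprime a b"
    using gcd_coprime_exists[OF g[unfolded g_def]] unfolding g_def by blast
  have "of_nat g * (of_nat b * m) = of_nat g * of_nat a" using eq ab by (simp add: mult_ac)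
  moreover have "of_nat g \<noteq> (0::'r)" using char[of g] g by argo
  ultimately have m: "of_nat b * m = of_nat a" by simp
  have "b = 1"
  proof (rule ccontr)
    assume "b \<noteq> 1"
    then obtain q where q: "prime q" "q dvd b" using prime_factor_nat by blast
    have "coprime a q" using ab(3) q(2) by (metis coprime_divisors dvd_refl)
    moreover have "of_nat q dvd (of_nat a :: 'r)"
      unfolding m[symmetric] using q(2) by (auto elim!: dvdE)
    ultimately have "of_nat q dvd (1::'r)" by (rule coprime_of_nat_dvd_one)
    moreover have "q dvd d0" using q(2) ab(2) by simp
    ultimately show False using primes q(1) by blast
  qed
  then show ?thesis using ab by simp
qed

section \<open>Finite group actions and marks\<close>

lemma (in group) subgroup_card_pos:
  assumes "finite (carrier G)" "subgroup L G" shows "finite L" "card L > 0"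
  using assms subgroup.subset[OF assms(2)] subgroup.one_closed[OF assms(2)]
  by (auto simp: card_gt_0_iff intro: finite_subset)

locale finite_action = group +
  fixes Z :: "'z set" and act :: "'a \<Rightarrow> 'z \<Rightarrow> 'z"
  assumes finite_carrier: "finite (carrier G)"
    and act_closed: "\<lbrakk>u \<in> carrier G; z \<in> Z\<rbrakk> \<Longrightarrow> act u z \<in> Z"
    and act_one: "z \<in> Z \<Longrightarrow> act \<one> z = z"
    and act_mult: "\<lbrakk>u \<in> carrier G; v \<in> carrier G; z \<in> Z\<rbrakk> \<Longrightarrow> act (u \<otimes> v) z = act u (act v z)"
begin

definition stab :: "'z \<Rightarrow> 'a set" where
  "stab z = {u \<in> carrier G. act u z = z}"

definition orb :: "'z \<Rightarrow> 'z set" where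
  "orb z = {act u z | u. u \<in> carrier G}"

lemma act_inv: "\<lbrakk>u \<in> carrier G; z \<in> Z\<rbrakk> \<Longrightarrow> act (inv u) (act u z) = z"
  by (metis act_mult act_one inv_closed l_inv)

lemma act_cancel:
  assumes "u \<in> carrier G" "v \<in> carrier G" "z \<in> Z"
  shows "act u z = act v z \<longleftrightarrow> inv v \<otimes> u \<in> stab z"
  using assms unfolding stab_def
  by (auto simp: act_mult act_inv) (metis act_closed act_inv act_mult inv_closed inv_inv)

lemma stab_subgroup: "z \<in> Z \<Longrightarrow> subgroup (stab z) G"
  unfolding stab_def
  by (rule subgroupI) (auto simp: act_mult act_one, metis act_inv)

lemma act_fixed_iff:
  assumes "u \<in> carrier G" "d \<in> carrier G" "z \<in> Z"
  shows "act d (act u z) = act u z \<longleftrightarrow> inv u \<otimes> d \<otimes> u \<in> stab z"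
  using act_cancel[of "d \<otimes> u" u z] assms by (simp add: act_mult m_assoc)

lemma stab_act:
  assumes "u \<in> carrier G" "z \<in> Z"
  shows "stab (act u z) = (\<lambda>x. u \<otimes> x \<otimes> inv u) ` stab z"
proof -
  have "d \<in> (\<lambda>x. u \<otimes> x \<otimes> inv u) ` stab z" if "d \<in> carrier G" "inv u \<otimes> d \<otimes> u \<in> stab z" for d
  proof (rule image_eqI)
    show "d = u \<otimes> (inv u \<otimes> d \<otimes> u) \<otimes> inv u"
      using that assms by (metis inv_closed inv_solve_left inv_solve_right m_assoc m_closed)
  qed (rule that)
  moreover have "inv u \<otimes> (u \<otimes> x \<otimes> inv u) \<otimes> u \<in> stab z" if "x \<in> stab z" for x
  proof -
    have "x \<in> carrier G" using that by (simp add: stab_def)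
    then have "inv u \<otimes> (u \<otimes> x \<otimes> inv u) \<otimes> u = x"
      using assms(1) by (metis inv_closed l_inv m_assoc m_closed r_one l_one)
    with that show ?thesis by simp
  qed
  ultimately show ?thesis
    using act_fixed_iff[OF assms(1) _ assms(2)] assms
    by (auto simp: stab_def[of "act u z"]) (auto simp: stab_def)
qed

lemma orb_subset: "z \<in> Z \<Longrightarrow> orb z \<subseteq> Z"
  by (auto simp: orb_def act_closed)

lemma orb_self: "z \<in> Z \<Longrightarrow> z \<in> orb z"
  unfolding orb_def using act_one[of z] one_closed by (auto intro!: exI[of _ "\<one>"])

lemma finite_orb: "finite (orb z)"
  unfolding orb_def using finite_carrier by auto

lemma orb_eq:
  assumes "z \<in> Z" "y \<in> orb z" shows "orb y = orb z"
proof -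
  obtain u where u: "u \<in> carrier G" "y = act u z" using assms(2) by (auto simp: orb_def)
  have "act v y \<in> orb z" if "v \<in> carrier G" for v
    using that u assms act_mult[of v u z] unfolding orb_def by (auto intro!: exI[of _ "v \<otimes> u"])
  moreover have "act v z \<in> orb y" if "v \<in> carrier G" for v
    using that u assms act_mult[of "v \<otimes> inv u" u z]
    unfolding orb_def by (auto intro!: exI[of _ "v \<otimes> inv u"] simp: m_assoc)
  ultimately show ?thesis by (auto simp: orb_def)
qed

lemma orb_disjoint:
  assumes "y \<in> Z" "z \<in> Z" "orb y \<noteq> orb z" shows "orb y \<inter> orb z = {}"
  using assms orb_eq by blast

text \<open>The elements \<open>u\<close> are grouped by \<open>act u z\<close>, and each fibre is a
  left coset of the stabilizer. With the orbit for \<open>X\<close> this is the orbit-stabilizer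
  theorem; with a set of fixed points it turns their number into a count of conjugating
  elements.\<close>

lemma card_transporter:
  assumes z: "z \<in> Z"
  shows "card {u \<in> carrier G. act u z \<in> X} = card (X \<inter> orb z) * card (stab z)"
proof -
  let ?A = "{u \<in> carrier G. act u z \<in> X}"
  have "card {u \<in> ?A. act u z = y} = card (stab z)" if y: "y \<in> X \<inter> orb z" for y
  proof -
    obtain v where v: "v \<in> carrier G" "y = act v z" using y by (auto simp: orb_def)
    have "{u \<in> ?A. act u z = y} = (\<lambda>x. v \<otimes> x) ` stab z"
    proof (intro equalityI subsetI)
      fix u assume "u \<in> {u \<in> ?A. act u z = y}"
      then have u: "u \<in> carrier G" "act u z = act v z" using v(2) by auto
      then have "inv v \<otimes> u \<in> stab z" using act_cancel[OF u(1) v(1) z] by simp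
      moreover have "u = v \<otimes> (inv v \<otimes> u)" using u(1) v(1) by (simp add: m_assoc[symmetric])
      ultimately show "u \<in> (\<lambda>x. v \<otimes> x) ` stab z" by blast
    next
      fix u assume "u \<in> (\<lambda>x. v \<otimes> x) ` stab z"
      then obtain x where x: "u = v \<otimes> x" "x \<in> carrier G" "act x z = z" by (auto simp: stab_def)
      then have "act u z = y" using v act_mult[OF v(1) x(2) z] by simp
      then show "u \<in> {u \<in> ?A. act u z = y}" using v(1) x y by simp
    qed
    moreover have "inj_on (\<lambda>x. v \<otimes> x) (stab z)"
      using v by (auto simp: inj_on_def stab_def)
    ultimately show ?thesis by (simp add: card_image)
  qed
  moreover have "card ?A = (\<Sum>y\<in>X \<inter> orb z. card {u \<in> ?A. act u z = y})"
  proof -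
    have "finite ?A" "finite (X \<inter> orb z)" "(\<lambda>u. act u z) ` ?A \<subseteq> X \<inter> orb z"
      using finite_carrier finite_orb[of z] unfolding orb_def by auto
    from sum.group[OF this, of "\<lambda>_. 1::nat"] show ?thesis by simp
  qed
  ultimately show ?thesis by simp
qed

lemma orbit_stabilizer: "z \<in> Z \<Longrightarrow> card (orb z) * card (stab z) = card (carrier G)"
proof -
  assume z: "z \<in> Z"
  have "{u \<in> carrier G. act u z \<in> orb z} = carrier G" by (auto simp: orb_def)
  then show ?thesis using card_transporter[OF z, of "orb z"] by simp
qed

lemma card_fixed_orb:
  assumes z: "z \<in> Z" and D: "D \<subseteq> carrier G"
  shows "card {y \<in> orb z. \<forall>d\<in>D. act d y = y} * card (stab z)
       = card {u \<in> carrier G. \<forall>d\<in>D. inv u \<otimes> d \<otimes> u \<in> stab z}"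
proof -
  let ?X = "{y. \<forall>d\<in>D. act d y = y}"
  have "{u \<in> carrier G. act u z \<in> ?X} = {u \<in> carrier G. \<forall>d\<in>D. inv u \<otimes> d \<otimes> u \<in> stab z}"
    using D z act_fixed_iff[OF _ _ z] by blast
  moreover have "?X \<inter> orb z = {y \<in> orb z. \<forall>d\<in>D. act d y = y}" by blast
  ultimately show ?thesis using card_transporter[OF z, of ?X] by simp
qed

lemma card_eq_sum_orbits:
  assumes "finite Z" "X \<subseteq> Z"
  shows "card X = (\<Sum>V\<in>orb ` Z. card (X \<inter> V))"
proof -
  have "X = (\<Union>V\<in>orb ` Z. X \<inter> V)" using assms orb_self by blast
  moreover have "card (\<Union>V\<in>orb ` Z. X \<inter> V) = (\<Sum>V\<in>orb ` Z. card (X \<inter> V))"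
    using assms orb_disjoint by (intro card_UN_disjoint) (auto intro: finite_subset)
  ultimately show ?thesis by simp
qed

text \<open>Orbits have \<open>p\<close>-power size, and those of size 1 are the fixed points. The
  congruence is written with a natural number \<open>k\<close> so that it can be mapped into any
  ring.\<close>

lemma card_fixed_cong:
  assumes fin: "finite Z" and p: "prime p" and pow: "card (carrier G) = p ^ n"
  shows "\<exists>k. card Z = card {z \<in> Z. \<forall>u\<in>carrier G. act u z = z} + p * k"
proof -
  let ?X = "{z \<in> Z. \<forall>u\<in>carrier G. act u z = z}"
  have "\<exists>k. card V = card (?X \<inter> V) + p * k" if V: "V \<in> orb ` Z" for V
  proof -
    obtain z where z: "z \<in> Z" "V = orb z" using V by blast
    have "card V dvd p ^ n" using orbit_stabilizer[OF z(1)] pow z(2) by (metis dvd_triv_left)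
    then obtain i where i: "card V = p ^ i" using p by (auto simp: divides_primepow_nat)
    show ?thesis
    proof (cases "i = 0")
      case True
      then have "card V = 1" using i by simp
      then have "V = {z}" using z orb_self[OF z(1)] by (auto simp: card_1_singleton_iff)
      moreover have "z \<in> ?X"
      proof -
        have "act u z \<in> V" if "u \<in> carrier G" for u unfolding z(2) orb_def using that by blast
        then show ?thesis using \<open>V = {z}\<close> z(1) by simp
      qed
      ultimately have "?X \<inter> V = {z}" by blast
      then show ?thesis using \<open>card V = 1\<close> by simp
    next
      case False
      have "?X \<inter> V = {}"
      proof (rule ccontr)
        assume "?X \<inter> V \<noteq> {}"
        then obtain y where y: "y \<in> ?X" "y \<in> V" by blast
        then have "V = orb y" using orb_eq z by blast
        moreover have "orb y \<subseteq> {y}" using y(1) unfolding orb_def by blast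
        ultimately have "card V \<le> 1" using card_mono[of "{y}" V] by simp
        moreover have "p ^ i > 1"
          using False prime_gt_1_nat[OF p] one_less_power[of p i] by simp
        ultimately show False using i by simp
      qed
      then have "card V = card (?X \<inter> V) + p * p ^ (i - 1)" using i False by (cases i) simp_all
      then show ?thesis by blast
    qed
  qed
  then have "\<forall>V\<in>orb ` Z. \<exists>k. card V = card (?X \<inter> V) + p * k" by blast
  from bchoice[OF this] obtain k
    where k: "\<And>V. V \<in> orb ` Z \<Longrightarrow> card V = card (?X \<inter> V) + p * k V" by blast
  have "card Z = (\<Sum>V\<in>orb ` Z. card (Z \<inter> V))" using card_eq_sum_orbits fin by blast
  also have "\<dots> = (\<Sum>V\<in>orb ` Z. card (?X \<inter> V) + p * k V)"
  proof (intro sum.cong refl)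
    fix V assume V: "V \<in> orb ` Z"
    then have "Z \<inter> V = V" using orb_subset by blast
    then show "card (Z \<inter> V) = card (?X \<inter> V) + p * k V" using k[OF V] by simp
  qed
  also have "\<dots> = card ?X + p * (\<Sum>V\<in>orb ` Z. k V)"
    using card_eq_sum_orbits[OF fin, of ?X] by (simp add: sum.distrib sum_distrib_left)
  finally show ?thesis by blast
qed

lemma subgroup_action:
  assumes "subgroup U G" shows "finite_action (G\<lparr>carrier := U\<rparr>) Z act"
proof -
  interpret U: group "G\<lparr>carrier := U\<rparr>" using assms subgroup_imp_group by blast
  show ?thesis
    using subgroup.subset[OF assms] finite_carrier
    by unfold_locales (auto simp: act_closed act_one act_mult subsetD intro: finite_subset)
qed

lemma card_dvd_free:
  assumes "finite Z" and "\<And>z. z \<in> Z \<Longrightarrow> stab z = {\<one>}"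
  shows "card (carrier G) dvd card Z"
proof -
  have "card (Z \<inter> V) = card (carrier G)" if V: "V \<in> orb ` Z" for V
  proof -
    obtain z where z: "z \<in> Z" "V = orb z" using V by blast
    then show ?thesis
      using orbit_stabilizer[OF z(1)] assms(2)[OF z(1)] orb_subset[OF z(1)] by (simp add: Int_absorb1)
  qed
  then show ?thesis using card_eq_sum_orbits[OF assms(1) order_refl] by simp
qed

end

section \<open>Coset spaces and their marks\<close>

locale finite_group = group +
  assumes finite_carrier: "finite (carrier G)"
begin

definition lcos :: "'a set \<Rightarrow> 'a set set" where
  "lcos L = {u <# L | u. u \<in> carrier G}"

definition transl :: "'a \<Rightarrow> 'a set \<Rightarrow> 'a set" where
  "transl u C = (\<lambda>c. u \<otimes> c) ` C"

text \<open>The entry |(G/L)^D| of Burnside's table of marks, with an arbitrary set \<open>D\<close>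
  of elements in place of a subgroup.\<close>

definition mark :: "'a set \<Rightarrow> 'a set \<Rightarrow> nat" where
  "mark D L = card {C \<in> lcos L. \<forall>d\<in>D. transl d C = C}"

lemma l_coset_eq_transl: "u <# L = transl u L"
  by (auto simp: l_coset_def transl_def)

lemma transl_mult:
  assumes "u \<in> carrier G" "v \<in> carrier G" "C \<subseteq> carrier G"
  shows "transl (u \<otimes> v) C = transl u (transl v C)"
  using assms unfolding transl_def image_image
  by (intro image_cong refl) (auto simp: m_assoc subsetD)

lemma transl_one: "C \<subseteq> carrier G \<Longrightarrow> transl \<one> C = C"
  by (force simp: transl_def subsetD)

lemma lcos_subset: "\<lbrakk>subgroup L G; C \<in> lcos L\<rbrakk> \<Longrightarrow> C \<subseteq> carrier G"
  using subgroup.subset by (fastforce simp: lcos_def l_coset_def)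

lemma finite_lcos: "finite (lcos L)"
  unfolding lcos_def using finite_carrier by simp

lemma coset_action:
  assumes L: "subgroup L G" shows "finite_action G (lcos L) transl"
proof unfold_locales
  fix u z assume "u \<in> carrier G" "z \<in> lcos L"
  then show "transl u z \<in> lcos L"
    using subgroup.subset[OF L] by (force simp: lcos_def l_coset_eq_transl simp flip: transl_mult)
qed (use lcos_subset[OF L] finite_carrier in \<open>auto simp: transl_mult transl_one\<close>)

lemma base_coset: assumes L: "subgroup L G" shows "L \<in> lcos L"
  using transl_one[OF subgroup.subset[OF L]] unfolding lcos_def l_coset_eq_transl by force

lemma stab_base:
  assumes L: "subgroup L G" shows "finite_action.stab G transl L = L"
proof -
  interpret finite_action G "lcos L" transl by (rule coset_action[OF L])
  have "transl u L = L \<longleftrightarrow> u \<in> L" if "u \<in> carrier G" for u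
  proof
    assume "transl u L = L"
    moreover have "u \<otimes> \<one> \<in> transl u L"
      unfolding transl_def using subgroup.one_closed[OF L] by blast
    ultimately show "u \<in> L" using that by simp
  next
    assume "u \<in> L"
    then show "transl u L = L" using coset_join3[OF that L] by (simp add: l_coset_eq_transl)
  qed
  then show ?thesis using subgroup.subset[OF L] by (auto simp: stab_def)
qed

lemma orb_base:
  assumes L: "subgroup L G" shows "finite_action.orb G transl L = lcos L"
proof -
  interpret finite_action G "lcos L" transl by (rule coset_action[OF L])
  show ?thesis by (auto simp: orb_def lcos_def l_coset_eq_transl)
qed

lemma card_lcos: "subgroup L G \<Longrightarrow> card (lcos L) * card L = card (carrier G)"
  using finite_action.orbit_stabilizer[OF coset_action base_coset] stab_base orb_base by simp

text \<open>The coset space is the orbit of the coset \<open>L\<close>, whose stabilizer is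
  \<open>L\<close>. Most later computations of marks go through this count of elements conjugating
  \<open>D\<close> into \<open>L\<close>; the factor \<open>card L\<close> on the left avoids
  division of naturals.\<close>

lemma mark_card:
  assumes L: "subgroup L G" and D: "D \<subseteq> carrier G"
  shows "mark D L * card L = card {u \<in> carrier G. \<forall>d\<in>D. inv u \<otimes> d \<otimes> u \<in> L}"
  using finite_action.card_fixed_orb[OF coset_action[OF L] base_coset[OF L] D]
  unfolding stab_base[OF L] orb_base[OF L] mark_def .

lemma stab_coset:
  assumes L: "subgroup L G" and u: "u \<in> carrier G"
  shows "finite_action.stab G transl (u <# L) = (\<lambda>x. u \<otimes> x \<otimes> inv u) ` L"
  using finite_action.stab_act[OF coset_action[OF L] u base_coset[OF L]]
  by (simp add: stab_base[OF L] l_coset_eq_transl)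

lemma conj_subgroup:
  assumes L: "subgroup L G" and u: "u \<in> carrier G"
  shows "subgroup ((\<lambda>x. u \<otimes> x \<otimes> inv u) ` L) G"
proof -
  have "u <# L \<in> lcos L" using u by (auto simp: lcos_def)
  then show ?thesis
    using finite_action.stab_subgroup[OF coset_action[OF L]] stab_coset[OF L u] by metis
qed

lemma inj_on_conj:
  assumes "u \<in> carrier G" "L \<subseteq> carrier G" shows "inj_on (\<lambda>x. u \<otimes> x \<otimes> inv u) L"
  using assms by (auto simp: inj_on_def subsetD)

lemma conj_cancel:
  assumes "u \<in> carrier G" "x \<in> carrier G"
  shows "inv u \<otimes> (u \<otimes> x \<otimes> inv u) \<otimes> u = x" "u \<otimes> (inv u \<otimes> x \<otimes> u) \<otimes> inv u = x"
  using assms by (metis inv_closed l_inv m_assoc m_closed r_one l_one,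
      metis inv_closed r_inv m_assoc m_closed r_one l_one)

lemma conj_mem_iff:
  assumes "u \<in> carrier G" "L \<subseteq> carrier G" "x \<in> carrier G"
  shows "x \<in> (\<lambda>x. u \<otimes> x \<otimes> inv u) ` L \<longleftrightarrow> inv u \<otimes> x \<otimes> u \<in> L"
proof
  assume "x \<in> (\<lambda>x. u \<otimes> x \<otimes> inv u) ` L"
  then show "inv u \<otimes> x \<otimes> u \<in> L" using assms conj_cancel(1)[OF assms(1)] by auto
next
  assume "inv u \<otimes> x \<otimes> u \<in> L"
  then show "x \<in> (\<lambda>x. u \<otimes> x \<otimes> inv u) ` L"
    using conj_cancel(2)[OF assms(1,3)] by (intro image_eqI) auto
qed

text \<open>Right multiplication by \<open>u\<close> carries the elements counted in
  \<open>mark_card\<close> for the conjugate to those counted for \<open>L\<close>. So a mark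
  depends only on the class of \<open>L\<close>, and the choice of representatives in the basis is
  harmless.\<close>

lemma mark_conj_right:
  assumes L: "subgroup L G" and D: "D \<subseteq> carrier G" and u: "u \<in> carrier G"
  shows "mark D ((\<lambda>x. u \<otimes> x \<otimes> inv u) ` L) = mark D L"
proof -
  let ?M = "(\<lambda>x. u \<otimes> x \<otimes> inv u) ` L"
  have M: "subgroup ?M G" using conj_subgroup L u .
  have "inv (w \<otimes> u) \<otimes> d \<otimes> (w \<otimes> u) = inv u \<otimes> (inv w \<otimes> d \<otimes> w) \<otimes> u"
    if "w \<in> carrier G" "d \<in> carrier G" for w d
    using that u by (simp add: inv_mult_group m_assoc)
  then have iff: "(\<forall>d\<in>D. inv w \<otimes> d \<otimes> w \<in> ?M) \<longleftrightarrow> (\<forall>d\<in>D. inv (w \<otimes> u) \<otimes> d \<otimes> (w \<otimes> u) \<in> L)"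
    if "w \<in> carrier G" for w
    using that D conj_mem_iff[OF u subgroup.subset[OF L]] u by (auto simp: subsetD)
  have bij: "bij_betw (\<lambda>w. w \<otimes> u) {w \<in> carrier G. \<forall>d\<in>D. inv w \<otimes> d \<otimes> w \<in> ?M}
      {w \<in> carrier G. \<forall>d\<in>D. inv w \<otimes> d \<otimes> w \<in> L}"
  proof (rule bij_betw_byWitness[where f' = "\<lambda>w. w \<otimes> inv u"])
    show "(\<lambda>w. w \<otimes> u) ` {w \<in> carrier G. \<forall>d\<in>D. inv w \<otimes> d \<otimes> w \<in> ?M}
        \<subseteq> {w \<in> carrier G. \<forall>d\<in>D. inv w \<otimes> d \<otimes> w \<in> L}"
      using iff u by blast
    have "w \<otimes> inv u \<in> carrier G \<and> (\<forall>d\<in>D. inv (w \<otimes> inv u) \<otimes> d \<otimes> (w \<otimes> inv u) \<in> ?M)"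
      if "w \<in> carrier G" "\<forall>d\<in>D. inv w \<otimes> d \<otimes> w \<in> L" for w
      using iff[of "w \<otimes> inv u"] that u by (simp add: m_assoc)
    then show "(\<lambda>w. w \<otimes> inv u) ` {w \<in> carrier G. \<forall>d\<in>D. inv w \<otimes> d \<otimes> w \<in> L}
        \<subseteq> {w \<in> carrier G. \<forall>d\<in>D. inv w \<otimes> d \<otimes> w \<in> ?M}"
      by blast
  qed (use u in \<open>auto simp: m_assoc\<close>)
  then have "mark D ?M * card ?M = mark D L * card L"
    using mark_card[OF M D] mark_card[OF L D] bij_betw_same_card[OF bij] by (simp only:)
  moreover have "card ?M = card L"
    using inj_on_conj[OF u subgroup.subset[OF L]] card_image by blast
  ultimately show ?thesis using subgroup_card_pos[OF finite_carrier L] by auto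
qed

lemma mark_conj_left:
  assumes L: "subgroup L G" and D: "D \<subseteq> carrier G" and u: "u \<in> carrier G"
  shows "mark ((\<lambda>x. u \<otimes> x \<otimes> inv u) ` D) L = mark D L"
proof -
  let ?M = "(\<lambda>x. u \<otimes> x \<otimes> inv u) ` D"
  have M: "?M \<subseteq> carrier G" using D u by auto
  have eq: "inv w \<otimes> (u \<otimes> d \<otimes> inv u) \<otimes> w = inv (inv u \<otimes> w) \<otimes> d \<otimes> (inv u \<otimes> w)"
    if "w \<in> carrier G" "d \<in> carrier G" for w d
    using that u by (simp add: inv_mult_group m_assoc)
  have iff: "(\<forall>d\<in>?M. inv w \<otimes> d \<otimes> w \<in> L)
      \<longleftrightarrow> (\<forall>d\<in>D. inv (inv u \<otimes> w) \<otimes> d \<otimes> (inv u \<otimes> w) \<in> L)"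
    if w: "w \<in> carrier G" for w
  proof -
    have "(\<forall>d\<in>?M. inv w \<otimes> d \<otimes> w \<in> L) \<longleftrightarrow> (\<forall>d\<in>D. inv w \<otimes> (u \<otimes> d \<otimes> inv u) \<otimes> w \<in> L)" by simp
    also have "\<dots> \<longleftrightarrow> (\<forall>d\<in>D. inv (inv u \<otimes> w) \<otimes> d \<otimes> (inv u \<otimes> w) \<in> L)"
      using D eq[OF w] by (metis subsetD)
    finally show ?thesis .
  qed
  have bij: "bij_betw (\<lambda>w. inv u \<otimes> w) {w \<in> carrier G. \<forall>d\<in>?M. inv w \<otimes> d \<otimes> w \<in> L}
      {w \<in> carrier G. \<forall>d\<in>D. inv w \<otimes> d \<otimes> w \<in> L}"
  proof (rule bij_betw_byWitness[where f' = "\<lambda>w. u \<otimes> w"])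
    show "(\<otimes>) (inv u) ` {w \<in> carrier G. \<forall>d\<in>?M. inv w \<otimes> d \<otimes> w \<in> L}
        \<subseteq> {w \<in> carrier G. \<forall>d\<in>D. inv w \<otimes> d \<otimes> w \<in> L}"
      using iff u by blast
    have "u \<otimes> w \<in> carrier G \<and> (\<forall>d\<in>?M. inv (u \<otimes> w) \<otimes> d \<otimes> (u \<otimes> w) \<in> L)"
      if "w \<in> carrier G" "\<forall>d\<in>D. inv w \<otimes> d \<otimes> w \<in> L" for w
      using iff[of "u \<otimes> w"] that u by (simp add: m_assoc[symmetric])
    then show "(\<otimes>) u ` {w \<in> carrier G. \<forall>d\<in>D. inv w \<otimes> d \<otimes> w \<in> L}
        \<subseteq> {w \<in> carrier G. \<forall>d\<in>?M. inv w \<otimes> d \<otimes> w \<in> L}"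
      by blast
  qed (use u in \<open>auto simp: m_assoc[symmetric]\<close>)
  then have "mark ?M L * card L = mark D L * card L"
    using mark_card[OF L M] mark_card[OF L D] bij_betw_same_card[OF bij] by (simp only:)
  then show ?thesis using subgroup_card_pos[OF finite_carrier L] by auto
qed

text \<open>The coset space is regarded as a \<open>U\<close>-set. What matters is that the
  left-hand side does not involve \<open>U\<close>.\<close>

lemma mark_cong_prime:
  assumes L: "subgroup L G" and U: "subgroup U G" and p: "prime p" "card U = p ^ n"
  shows "\<exists>k. card (lcos L) = mark U L + p * k"
  using finite_action.card_fixed_cong[OF finite_action.subgroup_action[OF coset_action[OF L] U]
    finite_lcos p(1), of n] p(2)
  by (simp add: mark_def)

end

section \<open>Tensor products of bisets\<close>

locale biset = fin: finite_group G for G (structure)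

sublocale biset \<subseteq> SS: finite_group "G \<times>\<times> G"
proof -
  interpret group "G \<times>\<times> G" by (rule DirProd_group) unfold_locales
  show "finite_group (G \<times>\<times> G)" using fin.finite_carrier by unfold_locales simp
qed

context biset
begin

lemma cosets2_eq: "cosets2 G = SS.lcos"
  by (auto simp: fun_eq_iff cosets2_def SS.lcos_def)

lemma lact_eq: "lact G = SS.transl"
  by (auto simp: fun_eq_iff lact_def SS.transl_def)

lemma inv_pair: "\<lbrakk>a \<in> carrier G; b \<in> carrier G\<rbrakk> \<Longrightarrow> inv\<^bsub>G \<times>\<times> G\<^esub> (a, b) = (inv a, inv b)"
  by (rule inv_DirProd) (unfold_locales)

lemma lact_lact:
  assumes "a \<in> carrier G" "b \<in> carrier G" "c \<in> carrier G" "d \<in> carrier G"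
    "C \<subseteq> carrier G \<times> carrier G"
  shows "lact G (a, b) (lact G (c, d) C) = lact G (a \<otimes> c, b \<otimes> d) C"
  using SS.transl_mult[of "(a, b)" "(c, d)" C] assms by (simp add: lact_eq)

lemma lact_one: "C \<subseteq> carrier G \<times> carrier G \<Longrightarrow> lact G (\<one>, \<one>) C = C"
  using SS.transl_one[of C] by (simp add: lact_eq)

lemma lact_subset:
  "\<lbrakk>a \<in> carrier G; b \<in> carrier G; C \<subseteq> carrier G \<times> carrier G\<rbrakk>
    \<Longrightarrow> lact G (a, b) C \<subseteq> carrier G \<times> carrier G"
  by (auto simp: lact_def mult_DirProd')

lemma cosets2_subset:
  "\<lbrakk>subgroup L (G \<times>\<times> G); C \<in> cosets2 G L\<rbrakk> \<Longrightarrow> C \<subseteq> carrier G \<times> carrier G"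
  using SS.lcos_subset[of L C] by (simp add: cosets2_eq)

lemma cosets2_closed:
  assumes "subgroup L (G \<times>\<times> G)" "C \<in> cosets2 G L" "a \<in> carrier G" "b \<in> carrier G"
  shows "lact G (a, b) C \<in> cosets2 G L"
  using finite_action.act_closed[OF SS.coset_action[OF assms(1)], of "(a, b)" C] assms
  by (simp add: cosets2_eq lact_eq)

lemma tens_class_alt:
  "tens_class G C D = (\<lambda>s. (lact G (\<one>, s) C, lact G (s, \<one>) D)) ` carrier G"
  by (auto simp: tens_class_def)

lemma tens_act_class:
  assumes "C \<subseteq> carrier G \<times> carrier G" "D \<subseteq> carrier G \<times> carrier G"
    and "a \<in> carrier G" "b \<in> carrier G"
  shows "tens_act G (a, b) (tens_class G C D)
    = tens_class G (lact G (a, \<one>) C) (lact G (\<one>, b) D)"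
  unfolding tens_class_alt tens_act_def image_image
  using assms by (intro image_cong refl) (simp add: lact_lact)

lemma tens_class_lact:
  assumes "C \<subseteq> carrier G \<times> carrier G" "D \<subseteq> carrier G \<times> carrier G" and s: "s \<in> carrier G"
  shows "tens_class G (lact G (\<one>, s) C) (lact G (s, \<one>) D) = tens_class G C D"
proof -
  have "(\<lambda>t. t \<otimes> s) ` carrier G = carrier G"
  proof (intro equalityI subsetI)
    fix x assume "x \<in> carrier G"
    then show "x \<in> (\<lambda>t. t \<otimes> s) ` carrier G"
      using s by (intro image_eqI[of _ _ "x \<otimes> inv s"]) (auto simp: fin.m_assoc)
  qed (use s in auto)
  then have "tens_class G C D
      = (\<lambda>s. (lact G (\<one>, s) C, lact G (s, \<one>) D)) ` (\<lambda>t. t \<otimes> s) ` carrier G"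
    by (simp only: tens_class_alt)
  also have "\<dots> = (\<lambda>t. (lact G (\<one>, t \<otimes> s) C, lact G (t \<otimes> s, \<one>) D)) ` carrier G"
    by (simp only: image_image)
  also have "\<dots> = tens_class G (lact G (\<one>, s) C) (lact G (s, \<one>) D)"
    unfolding tens_class_alt using assms by (intro image_cong refl) (simp add: lact_lact)
  finally show ?thesis by simp
qed

lemma tens_class_self:
  assumes "C \<subseteq> carrier G \<times> carrier G" "D \<subseteq> carrier G \<times> carrier G"
  shows "(C, D) \<in> tens_class G C D"
  unfolding tens_class_alt
  using assms by (intro image_eqI[of _ _ \<one>]) (simp_all add: lact_one)

lemma tens_class_eq_iff:
  assumes "C \<subseteq> carrier G \<times> carrier G" "D \<subseteq> carrier G \<times> carrier G"
    and "C' \<subseteq> carrier G \<times> carrier G" "D' \<subseteq> carrier G \<times> carrier G"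
  shows "tens_class G C' D' = tens_class G C D
    \<longleftrightarrow> (\<exists>s\<in>carrier G. C' = lact G (\<one>, s) C \<and> D' = lact G (s, \<one>) D)"
proof
  assume "tens_class G C' D' = tens_class G C D"
  then have "(C', D') \<in> tens_class G C D" using tens_class_self assms by metis
  then show "\<exists>s\<in>carrier G. C' = lact G (\<one>, s) C \<and> D' = lact G (s, \<one>) D"
    by (auto simp: tens_class_alt)
qed (use assms tens_class_lact in auto)

lemma tens_obtain:
  assumes L: "subgroup L (G \<times>\<times> G)" and M: "subgroup M (G \<times>\<times> G)" and z: "z \<in> tens G L M"
  obtains C D where "z = tens_class G C D" "C \<in> cosets2 G L" "D \<in> cosets2 G M"
    "C \<subseteq> carrier G \<times> carrier G" "D \<subseteq> carrier G \<times> carrier G"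
  using z cosets2_subset[OF L] cosets2_subset[OF M] unfolding tens_def by blast

lemma tens_action:
  assumes L: "subgroup L (G \<times>\<times> G)" and M: "subgroup M (G \<times>\<times> G)"
  shows "finite_action (G \<times>\<times> G) (tens G L M) (tens_act G)"
proof unfold_locales
  show "finite (carrier (G \<times>\<times> G))" by (rule SS.finite_carrier)
next
  fix u z assume u: "u \<in> carrier (G \<times>\<times> G)" and z: "z \<in> tens G L M"
  obtain a b where ab: "u = (a, b)" "a \<in> carrier G" "b \<in> carrier G" using u by auto
  from z obtain C D where CD: "z = tens_class G C D" "C \<in> cosets2 G L" "D \<in> cosets2 G M"
    "C \<subseteq> carrier G \<times> carrier G" "D \<subseteq> carrier G \<times> carrier G" by (rule tens_obtain[OF L M])
  show "tens_act G u z \<in> tens G L M"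
    unfolding ab CD(1) tens_act_class[OF CD(4,5) ab(2,3)] tens_def
    using cosets2_closed[OF L CD(2) ab(2), of \<one>] cosets2_closed[OF M CD(3) _ ab(3), of \<one>] by auto
next
  fix z assume z: "z \<in> tens G L M"
  then obtain C D where CD: "z = tens_class G C D"
    "C \<subseteq> carrier G \<times> carrier G" "D \<subseteq> carrier G \<times> carrier G" by (rule tens_obtain[OF L M])
  show "tens_act G \<one>\<^bsub>G \<times>\<times> G\<^esub> z = z"
    using CD by (simp add: tens_act_class lact_one)
next
  fix u v z assume u: "u \<in> carrier (G \<times>\<times> G)" and v: "v \<in> carrier (G \<times>\<times> G)" and z: "z \<in> tens G L M"
  obtain a b where ab: "u = (a, b)" "a \<in> carrier G" "b \<in> carrier G" using u by auto
  obtain c d where cd: "v = (c, d)" "c \<in> carrier G" "d \<in> carrier G" using v by auto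
  from z obtain C D where CD: "z = tens_class G C D"
    "C \<subseteq> carrier G \<times> carrier G" "D \<subseteq> carrier G \<times> carrier G" by (rule tens_obtain[OF L M])
  show "tens_act G (u \<otimes>\<^bsub>G \<times>\<times> G\<^esub> v) z = tens_act G u (tens_act G v z)"
    using ab cd CD by (simp add: tens_act_class lact_lact lact_subset)
qed

lemma finite_tens: "finite (tens G L M)"
proof -
  have "tens G L M \<subseteq> (\<lambda>(C, D). tens_class G C D) ` (cosets2 G L \<times> cosets2 G M)"
    by (auto simp: tens_def)
  then show ?thesis using SS.finite_lcos by (auto simp: cosets2_eq intro: finite_subset)
qed

section \<open>Conjugacy classes, representatives and structure constants\<close>

lemma ccl_self:
  assumes "subgroup L (G \<times>\<times> G)" shows "L \<in> ccl G L"
proof -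
  have "L = (\<lambda>x. \<one>\<^bsub>G \<times>\<times> G\<^esub> \<otimes>\<^bsub>G \<times>\<times> G\<^esub> x \<otimes>\<^bsub>G \<times>\<times> G\<^esub> inv\<^bsub>G \<times>\<times> G\<^esub> \<one>\<^bsub>G \<times>\<times> G\<^esub>) ` L"
    by (rule finite_action.stab_act[OF SS.coset_action[OF assms] SS.one_closed SS.base_coset[OF assms],
          unfolded SS.transl_one[OF subgroup.subset[OF assms]] SS.stab_base[OF assms]])
  then show ?thesis unfolding ccl_def by (intro CollectI exI conjI) (assumption, simp)
qed

lemma ccl_conj:
  assumes L: "subgroup L (G \<times>\<times> G)" and u: "u \<in> carrier (G \<times>\<times> G)"
  shows "ccl G ((\<lambda>x. u \<otimes>\<^bsub>G \<times>\<times> G\<^esub> x \<otimes>\<^bsub>G \<times>\<times> G\<^esub> inv\<^bsub>G \<times>\<times> G\<^esub> u) ` L) = ccl G L"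
proof -
  have eq: "(\<lambda>x. v \<otimes>\<^bsub>G \<times>\<times> G\<^esub> x \<otimes>\<^bsub>G \<times>\<times> G\<^esub> inv\<^bsub>G \<times>\<times> G\<^esub> v) `
      (\<lambda>x. u \<otimes>\<^bsub>G \<times>\<times> G\<^esub> x \<otimes>\<^bsub>G \<times>\<times> G\<^esub> inv\<^bsub>G \<times>\<times> G\<^esub> u) ` L
    = (\<lambda>x. (v \<otimes>\<^bsub>G \<times>\<times> G\<^esub> u) \<otimes>\<^bsub>G \<times>\<times> G\<^esub> x \<otimes>\<^bsub>G \<times>\<times> G\<^esub> inv\<^bsub>G \<times>\<times> G\<^esub> (v \<otimes>\<^bsub>G \<times>\<times> G\<^esub> u)) ` L"
    if "v \<in> carrier (G \<times>\<times> G)" for v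
    unfolding image_image using that u subgroup.subset[OF L]
    by (intro image_cong refl) (simp add: SS.m_assoc SS.inv_mult_group subsetD del: carrier_DirProd)
  have "(\<lambda>v. v \<otimes>\<^bsub>G \<times>\<times> G\<^esub> u) ` carrier (G \<times>\<times> G) = carrier (G \<times>\<times> G)"
  proof (intro equalityI subsetI)
    fix x assume "x \<in> carrier (G \<times>\<times> G)"
    then show "x \<in> (\<lambda>v. v \<otimes>\<^bsub>G \<times>\<times> G\<^esub> u) ` carrier (G \<times>\<times> G)"
      using u by (intro image_eqI[of _ _ "x \<otimes>\<^bsub>G \<times>\<times> G\<^esub> inv\<^bsub>G \<times>\<times> G\<^esub> u"])
        (simp_all add: SS.m_assoc del: carrier_DirProd one_DirProd)
  qed (use u SS.m_closed in blast)
  note surj = this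
  have ccl_alt: "ccl G N = (\<lambda>v. (\<lambda>x. v \<otimes>\<^bsub>G \<times>\<times> G\<^esub> x \<otimes>\<^bsub>G \<times>\<times> G\<^esub> inv\<^bsub>G \<times>\<times> G\<^esub> v) ` N)
      ` carrier (G \<times>\<times> G)" for N
    by (auto simp: ccl_def)
  have "ccl G L = (\<lambda>v. (\<lambda>x. v \<otimes>\<^bsub>G \<times>\<times> G\<^esub> x \<otimes>\<^bsub>G \<times>\<times> G\<^esub> inv\<^bsub>G \<times>\<times> G\<^esub> v) ` L)
      ` (\<lambda>v. v \<otimes>\<^bsub>G \<times>\<times> G\<^esub> u) ` carrier (G \<times>\<times> G)"
    unfolding surj ccl_alt ..
  also have "\<dots> = (\<lambda>v. (\<lambda>x. v \<otimes>\<^bsub>G \<times>\<times> G\<^esub> x \<otimes>\<^bsub>G \<times>\<times> G\<^esub> inv\<^bsub>G \<times>\<times> G\<^esub> v) `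
      (\<lambda>x. u \<otimes>\<^bsub>G \<times>\<times> G\<^esub> x \<otimes>\<^bsub>G \<times>\<times> G\<^esub> inv\<^bsub>G \<times>\<times> G\<^esub> u) ` L) ` carrier (G \<times>\<times> G)"
    unfolding image_image[of _ "\<lambda>v. v \<otimes>\<^bsub>G \<times>\<times> G\<^esub> u"] by (rule image_cong[OF refl eq[symmetric]])
  finally show ?thesis unfolding ccl_alt[of "_ ` L"] by simp
qed

text \<open>The same choice as in \<open>bmult\<close>, so that unfolding the product gives
  \<open>coef\<close> at these representatives.\<close>

definition rep :: "('a \<times> 'a) set set \<Rightarrow> ('a \<times> 'a) set" where
  "rep K = (SOME L. L \<in> K)"

lemma ccl_obtain:
  assumes "N \<in> ccl G L"
  obtains u where "u \<in> carrier (G \<times>\<times> G)"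
    "N = (\<lambda>x. u \<otimes>\<^bsub>G \<times>\<times> G\<^esub> x \<otimes>\<^bsub>G \<times>\<times> G\<^esub> inv\<^bsub>G \<times>\<times> G\<^esub> u) ` L"
  using assms unfolding ccl_def by auto

lemma ccl_mem:
  assumes L: "subgroup L (G \<times>\<times> G)" and N: "N \<in> ccl G L"
  shows "subgroup N (G \<times>\<times> G)" "ccl G N = ccl G L" "card N = card L"
    "D \<subseteq> carrier (G \<times>\<times> G) \<Longrightarrow> SS.mark D N = SS.mark D L"
proof -
  obtain u where u: "u \<in> carrier (G \<times>\<times> G)"
    "N = (\<lambda>x. u \<otimes>\<^bsub>G \<times>\<times> G\<^esub> x \<otimes>\<^bsub>G \<times>\<times> G\<^esub> inv\<^bsub>G \<times>\<times> G\<^esub> u) ` L"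
    by (rule ccl_obtain[OF N])
  show "subgroup N (G \<times>\<times> G)" unfolding u(2) by (rule SS.conj_subgroup[OF L u(1)])
  show "ccl G N = ccl G L" unfolding u(2) by (rule ccl_conj[OF L u(1)])
  show "card N = card L"
    unfolding u(2) by (rule card_image[OF SS.inj_on_conj[OF u(1) subgroup.subset[OF L]]])
  show "SS.mark D N = SS.mark D L" if "D \<subseteq> carrier (G \<times>\<times> G)"
    unfolding u(2) by (rule SS.mark_conj_right[OF L that u(1)])
qed

lemma rep_ccl: "subgroup L (G \<times>\<times> G) \<Longrightarrow> rep (ccl G L) \<in> ccl G L"
  unfolding rep_def using ccl_self by (metis someI_ex)

lemma rep_sclasses:
  assumes "K \<in> sclasses G" shows "subgroup (rep K) (G \<times>\<times> G)" "ccl G (rep K) = K"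
proof -
  obtain L where L: "subgroup L (G \<times>\<times> G)" "K = ccl G L" using assms by (auto simp: sclasses_def)
  show "subgroup (rep K) (G \<times>\<times> G)" "ccl G (rep K) = K"
    unfolding L(2) using ccl_mem[OF L(1) rep_ccl[OF L(1)]] by simp_all
qed

lemma mark_rep:
  "\<lbrakk>subgroup L (G \<times>\<times> G); D \<subseteq> carrier (G \<times>\<times> G)\<rbrakk> \<Longrightarrow> SS.mark D (rep (ccl G L)) = SS.mark D L"
  using ccl_mem(4) rep_ccl by blast

lemma finite_sclasses: "finite (sclasses G)"
proof -
  have "sclasses G \<subseteq> ccl G ` Pow (carrier (G \<times>\<times> G))"
    using subgroup.subset unfolding sclasses_def by blast
  moreover have "finite (ccl G ` Pow (carrier (G \<times>\<times> G)))" using SS.finite_carrier by blast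
  ultimately show ?thesis by (rule finite_subset)
qed

text \<open>An orbit of the tensor product is isomorphic to the coset space of a stabilizer, and
  \<open>coef\<close> counts orbits by the class of that stabilizer. Marks of a product are thus
  numbers of fixed points, and no structure constant has to be determined.\<close>

lemma sum_coef_mark:
  assumes L: "subgroup L (G \<times>\<times> G)" and M: "subgroup M (G \<times>\<times> G)" and D: "D \<subseteq> carrier (G \<times>\<times> G)"
  shows "(\<Sum>K\<in>sclasses G. coef G L M K * SS.mark D (rep K))
    = card {z \<in> tens G L M. \<forall>d\<in>D. tens_act G d z = z}"
proof -
  interpret T: finite_action "G \<times>\<times> G" "tens G L M" "tens_act G" by (rule tens_action[OF L M])
  let ?X = "{z \<in> tens G L M. \<forall>d\<in>D. tens_act G d z = z}"
  let ?Os = "T.orb ` tens G L M"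
  have stab: "tens_stab G = T.stab" by (simp add: fun_eq_iff tens_stab_def T.stab_def)
  have orb: "tens_orbit G = T.orb" by (simp add: fun_eq_iff tens_orbit_def T.orb_def)
  \<comment> \<open>The class of the point stabilizers of the orbit \<open>V\<close>; by
    \<open>stab_cls\<close> the chosen point does not matter.\<close>
  define \<kappa> where "\<kappa> V = ccl G (T.stab (SOME z. z \<in> tens G L M \<and> T.orb z = V))" for V
  have stab_cls: "ccl G (T.stab y) = ccl G (T.stab z)"
    if "y \<in> tens G L M" "z \<in> tens G L M" "T.orb y = T.orb z" for y z
  proof -
    have "y \<in> T.orb z" using T.orb_self that by metis
    then obtain u where u: "u \<in> carrier (G \<times>\<times> G)" "y = tens_act G u z" unfolding T.orb_def by blast
    show ?thesis
      unfolding u(2) T.stab_act[OF u(1) that(2)] by (rule ccl_conj[OF T.stab_subgroup[OF that(2)] u(1)])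
  qed
  have \<kappa>: "\<kappa> (T.orb z) = ccl G (T.stab z)" if "z \<in> tens G L M" for z
    unfolding \<kappa>_def using that
    by (intro stab_cls) (metis (mono_tags, lifting) someI_ex)+
  have coef: "coef G L M K = card {V \<in> ?Os. \<kappa> V = K}" if K: "K \<in> sclasses G" for K
  proof -
    have "T.stab z \<in> K \<longleftrightarrow> \<kappa> (T.orb z) = K" if z: "z \<in> tens G L M" for z
      using K ccl_mem(2) ccl_self[OF T.stab_subgroup[OF z]] unfolding \<kappa>[OF z] sclasses_def by blast
    then have "{T.orb z | z. z \<in> tens G L M \<and> T.stab z \<in> K} = {V \<in> ?Os. \<kappa> V = K}" by blast
    then show ?thesis unfolding coef_def stab orb by simp
  qed
  have "card (?X \<inter> V) = SS.mark D (rep (\<kappa> V))" if V: "V \<in> ?Os" for V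
  proof -
    obtain z where z: "z \<in> tens G L M" "V = T.orb z" using V by blast
    have N: "subgroup (T.stab z) (G \<times>\<times> G)" by (rule T.stab_subgroup[OF z(1)])
    have "?X \<inter> V = {y \<in> T.orb z. \<forall>d\<in>D. tens_act G d y = y}"
      using T.orb_subset[OF z(1)] z(2) by blast
    then have "card (?X \<inter> V) * card (T.stab z) = SS.mark D (T.stab z) * card (T.stab z)"
      using T.card_fixed_orb[OF z(1) D] SS.mark_card[OF N D] by simp
    then have "card (?X \<inter> V) = SS.mark D (T.stab z)"
      using SS.subgroup_card_pos[OF SS.finite_carrier N] by auto
    then show ?thesis unfolding z(2) \<kappa>[OF z(1)] mark_rep[OF N D] .
  qed
  moreover have "card ?X = (\<Sum>V\<in>?Os. card (?X \<inter> V))"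
    by (rule T.card_eq_sum_orbits[OF finite_tens]) blast
  ultimately have "card ?X = (\<Sum>V\<in>?Os. SS.mark D (rep (\<kappa> V)))" by simp
  also have "\<dots> = (\<Sum>K\<in>sclasses G. \<Sum>V\<in>{V \<in> ?Os. \<kappa> V = K}. SS.mark D (rep (\<kappa> V)))"
  proof (rule sum.group[symmetric])
    show "\<kappa> ` ?Os \<subseteq> sclasses G"
      using \<kappa> T.stab_subgroup unfolding sclasses_def by force
  qed (use finite_tens finite_sclasses in auto)
  also have "\<dots> = (\<Sum>K\<in>sclasses G. coef G L M K * SS.mark D (rep K))"
    by (intro sum.cong refl) (simp add: coef)
  finally show ?thesis by simp
qed

text \<open>Two maps on a common domain, rather than one isomorphism, allow the factors of a product
  to be matched at a middle map. The maps are arbitrary because that middle map is at first only a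
  function.\<close>

definition twisted :: "'a set \<Rightarrow> ('a \<Rightarrow> 'a) \<Rightarrow> ('a \<Rightarrow> 'a) \<Rightarrow> ('a \<times> 'a) set" where
  "twisted Q \<phi> \<psi> = (\<lambda>q. (\<phi> q, \<psi> q)) ` Q"

lemma twisted_subset:
  "\<lbrakk>\<phi> \<in> Q \<rightarrow> carrier G; \<psi> \<in> Q \<rightarrow> carrier G\<rbrakk> \<Longrightarrow> twisted Q \<phi> \<psi> \<subseteq> carrier (G \<times>\<times> G)"
  by (auto simp: twisted_def)

lemma coset_stab_conj:
  assumes L: "subgroup L (G \<times>\<times> G)" and C: "C \<in> cosets2 G L"
  obtains u where "u \<in> carrier (G \<times>\<times> G)"
    "\<And>x. x \<in> carrier (G \<times>\<times> G) \<Longrightarrow>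
      lact G x C = C \<longleftrightarrow> inv\<^bsub>G \<times>\<times> G\<^esub> u \<otimes>\<^bsub>G \<times>\<times> G\<^esub> x \<otimes>\<^bsub>G \<times>\<times> G\<^esub> u \<in> L"
proof -
  obtain u where u: "u \<in> carrier (G \<times>\<times> G)" "C = SS.transl u L"
    using C by (auto simp: cosets2_def SS.l_coset_eq_transl)
  show ?thesis
  proof (rule that[OF u(1)])
    fix x assume "x \<in> carrier (G \<times>\<times> G)"
    from finite_action.act_fixed_iff[OF SS.coset_action[OF L] u(1) this SS.base_coset[OF L]]
    show "lact G x C = C \<longleftrightarrow> inv\<^bsub>G \<times>\<times> G\<^esub> u \<otimes>\<^bsub>G \<times>\<times> G\<^esub> x \<otimes>\<^bsub>G \<times>\<times> G\<^esub> u \<in> L"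
      unfolding u(2) lact_eq SS.stab_base[OF L] .
  qed
qed

text \<open>The stabilizer of a coset is a conjugate of \<open>M\<close>, and conjugation preserves
  the property that the second coordinate determines the first.\<close>

lemma coset_left_free:
  assumes M: "subgroup M (G \<times>\<times> G)" and free: "\<And>a a' b. (a, b) \<in> M \<Longrightarrow> (a', b) \<in> M \<Longrightarrow> a = a'"
    and D: "D \<in> cosets2 G M" and ab: "a \<in> carrier G" "a' \<in> carrier G" "b \<in> carrier G"
    and fix1: "lact G (a, b) D = D" and fix2: "lact G (a', b) D = D"
  shows "a = a'"
proof -
  obtain u where u: "u \<in> carrier (G \<times>\<times> G)"
    "\<And>x. x \<in> carrier (G \<times>\<times> G) \<Longrightarrow>
      lact G x D = D \<longleftrightarrow> inv\<^bsub>G \<times>\<times> G\<^esub> u \<otimes>\<^bsub>G \<times>\<times> G\<^esub> x \<otimes>\<^bsub>G \<times>\<times> G\<^esub> u \<in> M"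
    using coset_stab_conj[OF M D] by blast
  obtain g h where gh: "u = (g, h)" "g \<in> carrier G" "h \<in> carrier G" using u(1) by auto
  have "(inv g \<otimes> a \<otimes> g, inv h \<otimes> b \<otimes> h) \<in> M" "(inv g \<otimes> a' \<otimes> g, inv h \<otimes> b \<otimes> h) \<in> M"
    using u(2)[of "(a, b)"] u(2)[of "(a', b)"] fix1 fix2 ab gh by (simp_all add: inv_pair)
  then have "inv g \<otimes> a \<otimes> g = inv g \<otimes> a' \<otimes> g" by (rule free)
  then show ?thesis using gh ab by simp
qed

text \<open>The balancing action of S on pairs is free because it is already free on the second
  component. This is the origin of the factor |S| in \<open>E_bmult\<close>.\<close>

lemma card_tens_class:
  assumes M: "subgroup M (G \<times>\<times> G)" and free: "\<And>a a' b. (a, b) \<in> M \<Longrightarrow> (a', b) \<in> M \<Longrightarrow> a = a'"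
    and D: "D \<in> cosets2 G M"
  shows "card (tens_class G C D) = card (carrier G)"
proof -
  have "inj_on (\<lambda>s. (lact G (\<one>, s) C, lact G (s, \<one>) D)) (carrier G)"
  proof (rule inj_onI)
    fix s t assume st: "s \<in> carrier G" "t \<in> carrier G"
      "(lact G (\<one>, s) C, lact G (s, \<one>) D) = (lact G (\<one>, t) C, lact G (t, \<one>) D)"
    have sub: "D \<subseteq> carrier G \<times> carrier G" by (rule cosets2_subset[OF M D])
    have "lact G (inv t, \<one>) (lact G (s, \<one>) D) = lact G (inv t, \<one>) (lact G (t, \<one>) D)"
      using st by simp
    then have "lact G (inv t \<otimes> s, \<one>) D = D"
      using st sub by (simp add: lact_lact lact_one)
    then have "inv t \<otimes> s = \<one>"
      using st lact_one[OF sub] by (intro coset_left_free[OF M free D]) auto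
    then have "t \<otimes> (inv t \<otimes> s) = t" using st by simp
    then show "s = t" using st by (simp add: fin.m_assoc[symmetric])
  qed
  then show ?thesis unfolding tens_class_alt by (rule card_image)
qed

text \<open>A pair \<open>(C, D)\<close> has a class fixed by \<open>twisted Q \<phi> \<psi>\<close> iff for every \<open>q\<close> some \<open>t\<close> satisfies
  \<open>(\<phi> q, t) C = C\<close> and \<open>(t, \<psi> q) D = D\<close>; left freeness makes \<open>t\<close> a function of \<open>q\<close>.\<close>

lemma card_fixed_tens:
  assumes L: "subgroup L (G \<times>\<times> G)" and M: "subgroup M (G \<times>\<times> G)"
    and free: "\<And>a a' b. (a, b) \<in> M \<Longrightarrow> (a', b) \<in> M \<Longrightarrow> a = a'"
    and \<phi>: "\<phi> \<in> Q \<rightarrow> carrier G" and \<psi>: "\<psi> \<in> Q \<rightarrow> carrier G"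
    and A: "finite A" "A \<subseteq> Q \<rightarrow>\<^sub>E carrier G"
    and closed: "\<And>\<alpha> u. \<alpha> \<in> Q \<rightarrow>\<^sub>E carrier G \<Longrightarrow> u \<in> carrier (G \<times>\<times> G) \<Longrightarrow>
        (\<And>q. q \<in> Q \<Longrightarrow> inv\<^bsub>G \<times>\<times> G\<^esub> u \<otimes>\<^bsub>G \<times>\<times> G\<^esub> (\<alpha> q, \<psi> q) \<otimes>\<^bsub>G \<times>\<times> G\<^esub> u \<in> M) \<Longrightarrow> \<alpha> \<in> A"
  shows "card (carrier G) * card {z \<in> tens G L M. \<forall>d\<in>twisted Q \<phi> \<psi>. tens_act G d z = z}
    = (\<Sum>\<alpha>\<in>A. SS.mark (twisted Q \<phi> \<alpha>) L * SS.mark (twisted Q \<alpha> \<psi>) M)"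
proof -
  let ?T = "\<lambda>x. tens_class G (fst x) (snd x)"
  let ?Z = "{z \<in> tens G L M. \<forall>d\<in>twisted Q \<phi> \<psi>. tens_act G d z = z}"
  \<comment> \<open>The pairs lying over fixed classes are counted twice: by classes, each with |S|
    members, and by middle maps, as the disjoint union of the products
    \<open>FL \<alpha> \<times> FM \<alpha>\<close>.\<close>
  define P where "P = {x \<in> cosets2 G L \<times> cosets2 G M. ?T x \<in> ?Z}"
  define FL where "FL \<alpha> = {C \<in> cosets2 G L. \<forall>q\<in>Q. lact G (\<phi> q, \<alpha> q) C = C}" for \<alpha>
  define FM where "FM \<alpha> = {D \<in> cosets2 G M. \<forall>q\<in>Q. lact G (\<alpha> q, \<psi> q) D = D}" for \<alpha>
  have finL: "finite (cosets2 G L)" and finM: "finite (cosets2 G M)"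
    using SS.finite_lcos by (simp_all add: cosets2_eq)
  have "card {x \<in> P. ?T x = z} = card (carrier G)" if z: "z \<in> ?Z" for z
  proof -
    obtain C D where CD: "z = tens_class G C D" "C \<in> cosets2 G L" "D \<in> cosets2 G M"
      "C \<subseteq> carrier G \<times> carrier G" "D \<subseteq> carrier G \<times> carrier G"
      using tens_obtain[OF L M] z by blast
    have "{x \<in> P. ?T x = z} = tens_class G C D"
    proof (intro equalityI subsetI)
      fix x assume "x \<in> {x \<in> P. ?T x = z}"
      then have x: "x \<in> cosets2 G L \<times> cosets2 G M" "?T x = tens_class G C D"
        using CD(1) by (auto simp: P_def)
      obtain C' D' where x': "x = (C', D')" by (cases x)
      have "C' \<subseteq> carrier G \<times> carrier G" "D' \<subseteq> carrier G \<times> carrier G"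
        using x x' cosets2_subset[OF L] cosets2_subset[OF M] by auto
      from tens_class_self[OF this] show "x \<in> tens_class G C D" using x x' by simp
    next
      fix x assume "x \<in> tens_class G C D"
      then obtain s where s: "s \<in> carrier G" "x = (lact G (\<one>, s) C, lact G (s, \<one>) D)"
        by (auto simp: tens_class_alt)
      then have "?T x = z" using tens_class_lact[OF CD(4,5)] CD(1) by simp
      then show "x \<in> {x \<in> P. ?T x = z}"
        using z s cosets2_closed[OF L CD(2)] cosets2_closed[OF M CD(3)] by (simp add: P_def)
    qed
    then show ?thesis using card_tens_class[OF M free CD(3)] by simp
  qed
  moreover have "card P = (\<Sum>z\<in>?Z. card {x \<in> P. ?T x = z})"
  proof -
    have "finite P" "finite ?Z" "?T ` P \<subseteq> ?Z"
      using finL finM finite_tens unfolding P_def by auto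
    from sum.group[OF this, of "\<lambda>_. 1::nat"] show ?thesis by simp
  qed
  ultimately have P_card: "card P = card (carrier G) * card ?Z" by simp

  \<comment> \<open>Here \<open>t\<close> is the inverse of the balancing element \<open>s\<close>:
    \<open>(a, 1) C = (1, s) C\<close> says \<open>(a, t) C = C\<close>, and
    \<open>(1, b) D = (s, 1) D\<close> says \<open>(t, b) D = D\<close>.\<close>
  have step: "tens_act G (a, b) (tens_class G C D) = tens_class G C D
      \<longleftrightarrow> (\<exists>t\<in>carrier G. lact G (a, t) C = C \<and> lact G (t, b) D = D)"
    if C: "C \<in> cosets2 G L" and D: "D \<in> cosets2 G M" and a: "a \<in> carrier G" and b: "b \<in> carrier G"
    for C D a b
  proof -
    note sub = cosets2_subset[OF L C] cosets2_subset[OF M D]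
    have "tens_act G (a, b) (tens_class G C D) = tens_class G C D \<longleftrightarrow>
      (\<exists>s\<in>carrier G. lact G (a, \<one>) C = lact G (\<one>, s) C \<and> lact G (\<one>, b) D = lact G (s, \<one>) D)"
      using sub a b by (simp add: tens_act_class tens_class_eq_iff lact_subset)
    also have "\<dots> \<longleftrightarrow> (\<exists>t\<in>carrier G. lact G (a, t) C = C \<and> lact G (t, b) D = D)"
    proof
      assume "\<exists>s\<in>carrier G. lact G (a, \<one>) C = lact G (\<one>, s) C \<and> lact G (\<one>, b) D = lact G (s, \<one>) D"
      then obtain s where s: "s \<in> carrier G" "lact G (a, \<one>) C = lact G (\<one>, s) C"
        "lact G (\<one>, b) D = lact G (s, \<one>) D" by blast
      have "lact G (\<one>, inv s) (lact G (a, \<one>) C) = lact G (\<one>, inv s) (lact G (\<one>, s) C)"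
        "lact G (inv s, \<one>) (lact G (\<one>, b) D) = lact G (inv s, \<one>) (lact G (s, \<one>) D)"
        using s by simp_all
      then have "lact G (a, inv s) C = C \<and> lact G (inv s, b) D = D"
        using s(1) a b sub by (simp add: lact_lact lact_one)
      then show "\<exists>t\<in>carrier G. lact G (a, t) C = C \<and> lact G (t, b) D = D"
        using s(1) fin.inv_closed by blast
    next
      assume "\<exists>t\<in>carrier G. lact G (a, t) C = C \<and> lact G (t, b) D = D"
      then obtain t where t: "t \<in> carrier G" "lact G (a, t) C = C" "lact G (t, b) D = D" by blast
      have "lact G (\<one>, inv t) (lact G (a, t) C) = lact G (\<one>, inv t) C"
        "lact G (inv t, \<one>) (lact G (t, b) D) = lact G (inv t, \<one>) D"
        using t by simp_all
      then have "lact G (a, \<one>) C = lact G (\<one>, inv t) C \<and> lact G (\<one>, b) D = lact G (inv t, \<one>) D"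
        using t(1) a b sub by (simp add: lact_lact)
      then show "\<exists>s\<in>carrier G. lact G (a, \<one>) C = lact G (\<one>, s) C \<and> lact G (\<one>, b) D = lact G (s, \<one>) D"
        using t(1) fin.inv_closed by blast
    qed
    finally show ?thesis .
  qed
  have P_iff: "(C, D) \<in> P \<longleftrightarrow>
      (\<forall>q\<in>Q. \<exists>t\<in>carrier G. lact G (\<phi> q, t) C = C \<and> lact G (t, \<psi> q) D = D)"
    if C: "C \<in> cosets2 G L" and D: "D \<in> cosets2 G M" for C D
  proof -
    have "tens_class G C D \<in> tens G L M" using C D by (auto simp: tens_def)
    then have "(C, D) \<in> P \<longleftrightarrow>
      (\<forall>q\<in>Q. tens_act G (\<phi> q, \<psi> q) (tens_class G C D) = tens_class G C D)"
      using C D by (simp add: P_def twisted_def)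
    also have "\<dots> \<longleftrightarrow> (\<forall>q\<in>Q. \<exists>t\<in>carrier G. lact G (\<phi> q, t) C = C \<and> lact G (t, \<psi> q) D = D)"
      by (intro ball_cong refl step[OF C D]) (use \<phi> \<psi> in auto)
    finally show ?thesis .
  qed
  have P_eq: "P = (\<Union>\<alpha>\<in>A. FL \<alpha> \<times> FM \<alpha>)"
  proof (intro equalityI subsetI)
    fix x assume x: "x \<in> P"
    obtain C D where CD: "x = (C, D)" "C \<in> cosets2 G L" "D \<in> cosets2 G M"
      using x by (cases x) (auto simp: P_def)
    have "\<forall>q\<in>Q. \<exists>t. t \<in> carrier G \<and> lact G (\<phi> q, t) C = C \<and> lact G (t, \<psi> q) D = D"
      using P_iff[OF CD(2,3)] x CD(1) by blast
    from bchoice[OF this] obtain f where f: "\<And>q. q \<in> Q \<Longrightarrow> f q \<in> carrier G"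
      "\<And>q. q \<in> Q \<Longrightarrow> lact G (\<phi> q, f q) C = C" "\<And>q. q \<in> Q \<Longrightarrow> lact G (f q, \<psi> q) D = D" by blast
    obtain u where u: "u \<in> carrier (G \<times>\<times> G)"
      "\<And>x. x \<in> carrier (G \<times>\<times> G) \<Longrightarrow>
        lact G x D = D \<longleftrightarrow> inv\<^bsub>G \<times>\<times> G\<^esub> u \<otimes>\<^bsub>G \<times>\<times> G\<^esub> x \<otimes>\<^bsub>G \<times>\<times> G\<^esub> u \<in> M"
      using coset_stab_conj[OF M CD(3)] by blast
    have "restrict f Q \<in> A"
    proof (rule closed[OF _ u(1)])
      show "restrict f Q \<in> Q \<rightarrow>\<^sub>E carrier G" using f(1) by auto
      fix q assume q: "q \<in> Q"
      have "(f q, \<psi> q) \<in> carrier (G \<times>\<times> G)" using f(1)[OF q] \<psi> q by auto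
      from u(2)[OF this] f(3)[OF q] q
      show "inv\<^bsub>G \<times>\<times> G\<^esub> u \<otimes>\<^bsub>G \<times>\<times> G\<^esub> (restrict f Q q, \<psi> q) \<otimes>\<^bsub>G \<times>\<times> G\<^esub> u \<in> M" by simp
    qed
    moreover have "x \<in> FL (restrict f Q) \<times> FM (restrict f Q)"
      using CD f(2,3) by (simp add: FL_def FM_def)
    ultimately show "x \<in> (\<Union>\<alpha>\<in>A. FL \<alpha> \<times> FM \<alpha>)" by blast
  next
    fix x assume "x \<in> (\<Union>\<alpha>\<in>A. FL \<alpha> \<times> FM \<alpha>)"
    then obtain \<alpha> where \<alpha>: "\<alpha> \<in> A" "x \<in> FL \<alpha> \<times> FM \<alpha>" by blast
    obtain C D where CD: "x = (C, D)" by (cases x)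
    have cos: "C \<in> cosets2 G L" "D \<in> cosets2 G M"
      using \<alpha> CD by (auto simp: FL_def FM_def)
    have "\<exists>t\<in>carrier G. lact G (\<phi> q, t) C = C \<and> lact G (t, \<psi> q) D = D" if q: "q \<in> Q" for q
    proof (rule bexI[of _ "\<alpha> q"])
      show "\<alpha> q \<in> carrier G" using \<alpha>(1) A(2) q by auto
      show "lact G (\<phi> q, \<alpha> q) C = C \<and> lact G (\<alpha> q, \<psi> q) D = D"
        using \<alpha>(2) CD q by (auto simp: FL_def FM_def)
    qed
    then show "x \<in> P" using P_iff[OF cos] CD by simp
  qed
  have disj: "(FL \<alpha> \<times> FM \<alpha>) \<inter> (FL \<beta> \<times> FM \<beta>) = {}" if "\<alpha> \<in> A" "\<beta> \<in> A" "\<alpha> \<noteq> \<beta>" for \<alpha> \<beta>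
  proof (rule ccontr)
    assume "(FL \<alpha> \<times> FM \<alpha>) \<inter> (FL \<beta> \<times> FM \<beta>) \<noteq> {}"
    then obtain D where D: "D \<in> FM \<alpha>" "D \<in> FM \<beta>" by blast
    then have cos: "D \<in> cosets2 G M" by (simp add: FM_def)
    have "\<alpha> = \<beta>"
    proof (rule PiE_ext)
      show "\<alpha> \<in> Q \<rightarrow>\<^sub>E carrier G" "\<beta> \<in> Q \<rightarrow>\<^sub>E carrier G" using that A(2) by blast+
      then show "\<alpha> q = \<beta> q" if q: "q \<in> Q" for q
        by (intro coset_left_free[OF M free cos, where b = "\<psi> q"])
          (use D q \<psi> in \<open>auto simp: FM_def\<close>)
    qed
    with that show False by blast
  qed
  have "card P = (\<Sum>\<alpha>\<in>A. card (FL \<alpha> \<times> FM \<alpha>))"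
    unfolding P_eq using A(1) disj finL finM
    by (intro card_UN_disjoint) (auto simp: FL_def FM_def)
  also have "\<dots> = (\<Sum>\<alpha>\<in>A. SS.mark (twisted Q \<phi> \<alpha>) L * SS.mark (twisted Q \<alpha> \<psi>) M)"
    by (simp add: card_cartesian_product FL_def FM_def SS.mark_def twisted_def cosets2_eq lact_eq)
  finally show ?thesis using P_card by simp
qed

end

section \<open>Fusion systems and the matrix of marks\<close>

locale fusion = biset G for G (structure) +
  fixes F :: "('a set \<times> ('a \<Rightarrow> 'a) \<times> 'a set) set"
  assumes fusion: "fusion_system G F"
begin

text \<open>The set Hom_F(Q,S). Fixing the codomain S identifies morphisms that differ only in their
  codomain; \<open>mor_F\<close> recovers the smaller codomains.\<close>

definition mor :: "'a set \<Rightarrow> ('a \<Rightarrow> 'a) set" where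
  "mor Q = {\<alpha>. (Q, \<alpha>, carrier G) \<in> F}"

lemma F_props:
  assumes "(P, \<phi>, Q) \<in> F"
  shows "subgroup P G" "subgroup Q G" "\<phi> \<in> P \<rightarrow>\<^sub>E Q" "inj_on \<phi> P"
    "\<lbrakk>x \<in> P; y \<in> P\<rbrakk> \<Longrightarrow> \<phi> (x \<otimes> y) = \<phi> x \<otimes> \<phi> y"
proof -
  have *: "subgroup P G \<and> subgroup Q G \<and> \<phi> \<in> extensional P \<and>
        \<phi> \<in> hom (G\<lparr>carrier := P\<rparr>) (G\<lparr>carrier := Q\<rparr>) \<and> inj_on \<phi> P"
    using fusion[unfolded fusion_system_def, THEN conjunct1, rule_format, OF assms] by simp
  then show "subgroup P G" "subgroup Q G" "inj_on \<phi> P" by blast+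
  from * show "\<phi> \<in> P \<rightarrow>\<^sub>E Q" by (auto simp: hom_def PiE_def)
  show "\<phi> (x \<otimes> y) = \<phi> x \<otimes> \<phi> y" if "x \<in> P" "y \<in> P"
    using * that by (auto simp: hom_def)
qed

lemma F_conj:
  assumes "subgroup P G" "subgroup Q G" "g \<in> carrier G" "\<And>x. x \<in> P \<Longrightarrow> g \<otimes> x \<otimes> inv g \<in> Q"
  shows "(P, conjmap G g P, Q) \<in> F"
  using fusion assms unfolding fusion_system_def by blast

lemma F_comp: "\<lbrakk>(P, \<phi>, Q) \<in> F; (Q, \<psi>, R) \<in> F\<rbrakk> \<Longrightarrow> (P, restrict (\<psi> \<circ> \<phi>) P, R) \<in> F"
  using fusion unfolding fusion_system_def by blast

lemma F_image: "(P, \<phi>, Q) \<in> F \<Longrightarrow> (P, \<phi>, \<phi> ` P) \<in> F"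
  using fusion unfolding fusion_system_def by blast

lemma F_inv: "(P, \<phi>, Q) \<in> F \<Longrightarrow> (\<phi> ` P, restrict (inv_into P \<phi>) (\<phi> ` P), P) \<in> F"
  using fusion unfolding fusion_system_def by blast

lemma conjmap_one:
  assumes "Q \<subseteq> carrier G" shows "conjmap G \<one> Q = (\<lambda>x\<in>Q. x)"
  using assms unfolding conjmap_def by (intro restrict_ext) (simp add: subsetD)

lemma F_incl:
  assumes "subgroup P G" "subgroup Q G" "P \<subseteq> Q" shows "(P, \<lambda>x\<in>P. x, Q) \<in> F"
proof -
  have "(P, conjmap G \<one> P, Q) \<in> F"
    using assms subgroup.subset[OF assms(1)] by (intro F_conj) (auto simp: subsetD)
  then show ?thesis using conjmap_one[OF subgroup.subset[OF assms(1)]] by simp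
qed

text \<open>The axioms offer the image as codomain; any other subgroup containing it is reached
  through an inclusion, which is conjugation by 1.\<close>

lemma F_codomain:
  assumes \<phi>: "(P, \<phi>, Q) \<in> F" and R: "subgroup R G" "\<phi> ` P \<subseteq> R"
  shows "(P, \<phi>, R) \<in> F"
proof -
  note im = F_image[OF \<phi>]
  have "(P, restrict ((\<lambda>x\<in>\<phi> ` P. x) \<circ> \<phi>) P, R) \<in> F"
    by (rule F_comp[OF im F_incl[OF F_props(2)[OF im] R]])
  moreover have "restrict ((\<lambda>x\<in>\<phi> ` P. x) \<circ> \<phi>) P = \<phi>"
  proof
    fix x show "restrict ((\<lambda>x\<in>\<phi> ` P. x) \<circ> \<phi>) P x = \<phi> x"
      using F_props(3)[OF \<phi>] by (cases "x \<in> P") (auto simp: PiE_def extensional_def)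
  qed
  ultimately show ?thesis by simp
qed

lemma carrier_subgroup: "subgroup (carrier G) G"
  by (rule fin.subgroup_self)

lemma F_mor: "(Q, \<phi>, P) \<in> F \<Longrightarrow> \<phi> \<in> mor Q"
  unfolding mor_def
  using F_codomain[OF _ carrier_subgroup] F_props(2,3) subgroup.subset by fastforce

lemma mor_F: "\<lbrakk>\<alpha> \<in> mor Q; subgroup R G; \<alpha> ` Q \<subseteq> R\<rbrakk> \<Longrightarrow> (Q, \<alpha>, R) \<in> F"
  unfolding mor_def using F_codomain by blast

lemma mor_props:
  assumes "\<alpha> \<in> mor Q"
  shows "subgroup Q G" "subgroup (\<alpha> ` Q) G" "\<alpha> \<in> Q \<rightarrow>\<^sub>E carrier G" "inj_on \<alpha> Q"
    "\<And>x y. \<lbrakk>x \<in> Q; y \<in> Q\<rbrakk> \<Longrightarrow> \<alpha> (x \<otimes> y) = \<alpha> x \<otimes> \<alpha> y"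
  using F_props[of Q \<alpha> "carrier G"] F_props(2)[OF F_image] assms unfolding mor_def by auto

lemma mor_closed: "\<lbrakk>\<alpha> \<in> mor Q; q \<in> Q\<rbrakk> \<Longrightarrow> \<alpha> q \<in> carrier G"
  using mor_props(3) by blast

lemma mor_one: assumes "\<alpha> \<in> mor Q" shows "\<alpha> \<one> = \<one>"
proof -
  have "\<one> \<in> Q" using mor_props(1)[OF assms] by (rule subgroup.one_closed)
  then have "\<alpha> \<one> \<otimes> \<alpha> \<one> = \<alpha> \<one>" "\<alpha> \<one> \<in> carrier G"
    using mor_props(5)[OF assms, of \<one> \<one>] mor_closed[OF assms] by simp_all
  then show ?thesis by (simp add: fin.l_cancel_one)
qed

lemma mor_inverse:
  assumes "\<alpha> \<in> mor Q" "x \<in> Q" shows "\<alpha> (inv x) = inv \<alpha> x"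
proof -
  note Q = mor_props(1)[OF assms(1)]
  have x: "inv x \<in> Q" "x \<in> carrier G" using Q assms(2) by (auto simp: subgroup.m_inv_closed subgroup.mem_carrier)
  then have "\<alpha> (inv x) \<otimes> \<alpha> x = \<one>"
    using mor_props(5)[OF assms(1) x(1) assms(2)] mor_one[OF assms(1)] by simp
  then show ?thesis using mor_closed[OF assms(1)] x assms(2) by (simp add: fin.inv_equality)
qed

lemma mor_id: "subgroup Q G \<Longrightarrow> (\<lambda>x\<in>Q. x) \<in> mor Q"
  unfolding mor_def using F_incl[OF _ carrier_subgroup] subgroup.subset by blast

lemma mor_comp:
  assumes \<alpha>: "\<alpha> \<in> mor Q" and \<beta>: "\<beta> \<in> mor R" and sub: "\<alpha> ` Q \<subseteq> R"
  shows "(\<lambda>q\<in>Q. \<beta> (\<alpha> q)) \<in> mor Q"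
proof -
  have "(R, \<beta>, carrier G) \<in> F" using \<beta> by (simp add: mor_def)
  from F_comp[OF mor_F[OF \<alpha> mor_props(1)[OF \<beta>] sub] this]
  show ?thesis by (simp add: mor_def comp_def)
qed

lemma mor_conj:
  assumes \<alpha>: "\<alpha> \<in> mor Q" and g: "g \<in> carrier G"
  shows "(\<lambda>q\<in>Q. g \<otimes> \<alpha> q \<otimes> inv g) \<in> mor Q"
proof -
  have "conjmap G g (carrier G) \<in> mor (carrier G)"
    unfolding mor_def using g by (auto intro!: F_conj carrier_subgroup)
  moreover have "\<alpha> ` Q \<subseteq> carrier G" using mor_closed[OF \<alpha>] by blast
  ultimately have "(\<lambda>q\<in>Q. conjmap G g (carrier G) (\<alpha> q)) \<in> mor Q" by (rule mor_comp[OF \<alpha>])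
  moreover have "(\<lambda>q\<in>Q. conjmap G g (carrier G) (\<alpha> q)) = (\<lambda>q\<in>Q. g \<otimes> \<alpha> q \<otimes> inv g)"
    by (intro restrict_ext) (simp add: conjmap_def mor_closed[OF \<alpha>])
  ultimately show ?thesis by simp
qed

lemma mor_inv: "\<alpha> \<in> mor Q \<Longrightarrow> (\<lambda>x\<in>\<alpha> ` Q. inv_into Q \<alpha> x) \<in> mor (\<alpha> ` Q)"
  using F_mor[OF F_inv] by (auto simp: mor_def)

lemma mor_ext: "\<lbrakk>\<alpha> \<in> mor Q; \<beta> \<in> mor Q; \<And>q. q \<in> Q \<Longrightarrow> \<alpha> q = \<beta> q\<rbrakk> \<Longrightarrow> \<alpha> = \<beta>"
  using mor_props(3) by (metis PiE_ext)

lemma finite_mor: "finite (mor Q)"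
proof (cases "mor Q = {}")
  case False
  then have "subgroup Q G" using mor_props(1) by blast
  then have "finite Q" using fin.subgroup_card_pos(1)[OF fin.finite_carrier] by blast
  then have "finite (Q \<rightarrow>\<^sub>E carrier G)" using fin.finite_carrier by (intro finite_PiE)
  then show ?thesis using mor_props(3) by (meson finite_subset subsetI)
qed simp

section \<open>Twisted diagonals of the fusion system\<close>

lemma mor_Pi: "\<alpha> \<in> mor Q \<Longrightarrow> \<alpha> \<in> Q \<rightarrow> carrier G"
  using mor_closed by blast

text \<open>The conjugation-closed form of the subgroups \<open>Delta P \<phi> Q\<close>: in the
  representative \<open>rep K\<close> of a basis class neither coordinate need be an
  inclusion.\<close>

definition fdiag :: "('a \<times> 'a) set \<Rightarrow> bool" where
  "fdiag M \<longleftrightarrow> (\<exists>Q. \<exists>\<phi>\<in>mor Q. \<exists>\<psi>\<in>mor Q. M = twisted Q \<phi> \<psi>)"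

lemma twisted_carrier:
  "\<lbrakk>\<phi> \<in> mor Q; \<psi> \<in> mor Q\<rbrakk> \<Longrightarrow> twisted Q \<phi> \<psi> \<subseteq> carrier (G \<times>\<times> G)"
  by (rule twisted_subset) (simp_all add: mor_Pi)

lemma twisted_subgroup:
  assumes \<phi>: "\<phi> \<in> mor Q" and \<psi>: "\<psi> \<in> mor Q"
  shows "subgroup (twisted Q \<phi> \<psi>) (G \<times>\<times> G)"
proof (rule SS.subgroupI)
  note Q = mor_props(1)[OF \<phi>]
  show "twisted Q \<phi> \<psi> \<subseteq> carrier (G \<times>\<times> G)" by (rule twisted_carrier[OF assms])
  show "twisted Q \<phi> \<psi> \<noteq> {}" using subgroup.one_closed[OF Q] by (auto simp: twisted_def)
  show "inv\<^bsub>G \<times>\<times> G\<^esub> a \<in> twisted Q \<phi> \<psi>" if a: "a \<in> twisted Q \<phi> \<psi>" for a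
  proof -
    obtain x where x: "x \<in> Q" "a = (\<phi> x, \<psi> x)" using a by (auto simp: twisted_def)
    then have "inv\<^bsub>G \<times>\<times> G\<^esub> a = (\<phi> (inv x), \<psi> (inv x))"
      using mor_closed[OF \<phi>] mor_closed[OF \<psi>]
      by (simp add: inv_pair mor_inverse[OF \<phi>] mor_inverse[OF \<psi>])
    moreover have "inv x \<in> Q" using subgroup.m_inv_closed[OF Q x(1)] .
    ultimately show ?thesis by (auto simp: twisted_def)
  qed
  fix a b assume "a \<in> twisted Q \<phi> \<psi>" "b \<in> twisted Q \<phi> \<psi>"
  then obtain x y where xy: "x \<in> Q" "y \<in> Q" "a = (\<phi> x, \<psi> x)" "b = (\<phi> y, \<psi> y)"
    by (auto simp: twisted_def)
  then have "a \<otimes>\<^bsub>G \<times>\<times> G\<^esub> b = (\<phi> (x \<otimes> y), \<psi> (x \<otimes> y))"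
    using mor_props(5)[OF \<phi>] mor_props(5)[OF \<psi>] by simp
  moreover have "x \<otimes> y \<in> Q" using subgroup.m_closed[OF Q xy(1,2)] .
  ultimately show "a \<otimes>\<^bsub>G \<times>\<times> G\<^esub> b \<in> twisted Q \<phi> \<psi>" by (auto simp: twisted_def)
qed

lemma fdiag_subgroup: "fdiag M \<Longrightarrow> subgroup M (G \<times>\<times> G)"
  using twisted_subgroup by (auto simp: fdiag_def)

lemma fdiag_free: "\<lbrakk>fdiag M; (a, b) \<in> M; (a', b) \<in> M\<rbrakk> \<Longrightarrow> a = a'"
  unfolding fdiag_def twisted_def using mor_props(4) by (auto dest: inj_onD)

lemma fdiag_conj:
  assumes M: "fdiag M" and u: "u \<in> carrier (G \<times>\<times> G)"
  shows "fdiag ((\<lambda>x. u \<otimes>\<^bsub>G \<times>\<times> G\<^esub> x \<otimes>\<^bsub>G \<times>\<times> G\<^esub> inv\<^bsub>G \<times>\<times> G\<^esub> u) ` M)"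
proof -
  obtain Q \<phi> \<psi> where Q: "\<phi> \<in> mor Q" "\<psi> \<in> mor Q" "M = twisted Q \<phi> \<psi>"
    using M by (auto simp: fdiag_def)
  obtain g h where gh: "u = (g, h)" "g \<in> carrier G" "h \<in> carrier G" using u by auto
  have "(\<lambda>x. u \<otimes>\<^bsub>G \<times>\<times> G\<^esub> x \<otimes>\<^bsub>G \<times>\<times> G\<^esub> inv\<^bsub>G \<times>\<times> G\<^esub> u) ` M
    = twisted Q (\<lambda>q\<in>Q. g \<otimes> \<phi> q \<otimes> inv g) (\<lambda>q\<in>Q. h \<otimes> \<psi> q \<otimes> inv h)"
    unfolding Q(3) twisted_def image_image gh(1)
    by (intro image_cong refl) (simp add: inv_pair gh)
  then show ?thesis unfolding fdiag_def using mor_conj Q gh by metis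
qed

text \<open>With \<open>M = twisted R \<phi>' \<psi>'\<close>, the map \<alpha> is the composite of
  \<psi>, conjugation by \<open>inv h\<close>, the inverse of \<psi>', the map \<phi>' and
  conjugation by \<open>g\<close>. All of these lie in F, so middle maps of a tensor product are
  again morphisms.\<close>

lemma fdiag_closed:
  assumes M: "fdiag M" and \<psi>: "\<psi> \<in> mor Q" and \<alpha>: "\<alpha> \<in> Q \<rightarrow>\<^sub>E carrier G"
    and u: "u \<in> carrier (G \<times>\<times> G)"
    and mem: "\<And>q. q \<in> Q \<Longrightarrow>
      inv\<^bsub>G \<times>\<times> G\<^esub> u \<otimes>\<^bsub>G \<times>\<times> G\<^esub> (\<alpha> q, \<psi> q) \<otimes>\<^bsub>G \<times>\<times> G\<^esub> u \<in> M"
  shows "\<alpha> \<in> mor Q"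
proof -
  obtain R \<phi>' \<psi>' where R: "\<phi>' \<in> mor R" "\<psi>' \<in> mor R" "M = twisted R \<phi>' \<psi>'"
    using M by (auto simp: fdiag_def)
  obtain g h where gh: "u = (g, h)" "g \<in> carrier G" "h \<in> carrier G" using u by auto
  have "\<exists>r\<in>R. \<phi>' r = inv g \<otimes> \<alpha> q \<otimes> g \<and> \<psi>' r = inv h \<otimes> \<psi> q \<otimes> h" if q: "q \<in> Q" for q
    using mem[OF q] unfolding R(3) twisted_def gh(1) by (auto simp: inv_pair gh)
  then have "\<forall>q\<in>Q. \<exists>r. r \<in> R \<and> \<phi>' r = inv g \<otimes> \<alpha> q \<otimes> g \<and> \<psi>' r = inv h \<otimes> \<psi> q \<otimes> h" by blast
  from bchoice[OF this] obtain r where r: "\<And>q. q \<in> Q \<Longrightarrow> r q \<in> R"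
    "\<And>q. q \<in> Q \<Longrightarrow> \<phi>' (r q) = inv g \<otimes> \<alpha> q \<otimes> g"
    "\<And>q. q \<in> Q \<Longrightarrow> \<psi>' (r q) = inv h \<otimes> \<psi> q \<otimes> h" by blast
  define \<beta> where "\<beta> = (\<lambda>q\<in>Q. inv h \<otimes> \<psi> q \<otimes> inv (inv h))"
  have \<beta>: "\<beta> \<in> mor Q" unfolding \<beta>_def using gh by (intro mor_conj[OF \<psi>]) simp
  have \<beta>r: "\<beta> q = \<psi>' (r q)" if "q \<in> Q" for q using that gh r(3) by (simp add: \<beta>_def)
  define \<gamma> where "\<gamma> = (\<lambda>q\<in>Q. (\<lambda>x\<in>\<psi>' ` R. inv_into R \<psi>' x) (\<beta> q))"
  have sub: "\<beta> ` Q \<subseteq> \<psi>' ` R" using \<beta>r r(1) by auto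
  have \<gamma>: "\<gamma> \<in> mor Q" unfolding \<gamma>_def by (rule mor_comp[OF \<beta> mor_inv[OF R(2)] sub])
  have \<gamma>r: "\<gamma> q = r q" if "q \<in> Q" for q
    using that r(1)[OF that] by (simp add: \<gamma>_def \<beta>r inv_into_f_f[OF mor_props(4)[OF R(2)]])
  have "(\<lambda>q\<in>Q. \<phi>' (\<gamma> q)) \<in> mor Q"
    using \<gamma>r r(1) by (intro mor_comp[OF \<gamma> R(1)]) auto
  from mor_conj[OF this gh(2)]
  have *: "(\<lambda>q\<in>Q. g \<otimes> (\<lambda>q\<in>Q. \<phi>' (\<gamma> q)) q \<otimes> inv g) \<in> mor Q" .
  have "\<alpha> = (\<lambda>q\<in>Q. g \<otimes> (\<lambda>q\<in>Q. \<phi>' (\<gamma> q)) q \<otimes> inv g)"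
  proof (rule PiE_ext[OF \<alpha> mor_props(3)[OF *]])
    fix q assume q: "q \<in> Q"
    then have "\<alpha> q \<in> carrier G" using \<alpha> by blast
    then show "\<alpha> q = (\<lambda>q\<in>Q. g \<otimes> (\<lambda>q\<in>Q. \<phi>' (\<gamma> q)) q \<otimes> inv g) q"
      using q gh by (simp add: \<gamma>r r(2) fin.conj_cancel(2))
  qed
  with * show ?thesis by simp
qed

lemma fdiag_ccl: "\<lbrakk>fdiag M; N \<in> ccl G M\<rbrakk> \<Longrightarrow> fdiag N"
  using fdiag_conj by (auto elim!: ccl_obtain)

lemma Delta_twisted: "Delta P \<phi> Q = twisted Q \<phi> (\<lambda>x\<in>Q. x)"
  unfolding Delta_def twisted_def by (auto simp: image_iff)

lemma RBF_support:
  assumes a: "a \<in> RBF G F" and K: "a K \<noteq> 0"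
  obtains Q \<phi> where "subgroup Q G" "\<phi> \<in> mor Q" "K = ccl G (twisted Q \<phi> (\<lambda>x\<in>Q. x))"
proof -
  obtain P \<phi> Q where "(Q, \<phi>, P) \<in> F" "K = ccl G (Delta P \<phi> Q)"
    using assms unfolding RBF_def by blast
  then show ?thesis using that[of Q \<phi>] F_props(1) F_mor by (simp add: Delta_twisted)
qed

lemma RBF_rep:
  assumes a: "a \<in> RBF G F" and K: "a K \<noteq> 0"
  shows "K \<in> sclasses G" "fdiag (rep K)"
proof -
  obtain Q \<phi> where Q: "subgroup Q G" "\<phi> \<in> mor Q" "K = ccl G (twisted Q \<phi> (\<lambda>x\<in>Q. x))"
    by (rule RBF_support[OF assms])
  have fd: "fdiag (twisted Q \<phi> (\<lambda>x\<in>Q. x))" using Q(2) mor_id[OF Q(1)] by (auto simp: fdiag_def)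
  then show "K \<in> sclasses G" using Q(3) fdiag_subgroup by (auto simp: sclasses_def)
  show "fdiag (rep K)"
    unfolding Q(3) by (rule fdiag_ccl[OF fd rep_ccl[OF fdiag_subgroup[OF fd]]])
qed

lemma RBF_basis:
  assumes "\<phi> \<in> mor Q"
  shows "(\<lambda>K. if K = ccl G (twisted Q \<phi> (\<lambda>x\<in>Q. x)) then 1 else 0) \<in> RBF G F"
proof -
  note Q = mor_props(1)[OF assms]
  have "(Q, \<phi>, \<phi> ` Q) \<in> F" by (rule mor_F[OF assms mor_props(2)[OF assms] order_refl])
  moreover have "ccl G (twisted Q \<phi> (\<lambda>x\<in>Q. x)) \<in> sclasses G"
    using twisted_subgroup[OF assms mor_id[OF Q]] by (auto simp: sclasses_def)
  ultimately show ?thesis unfolding RBF_def RB_def Delta_twisted by auto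
qed

text \<open>\<open>E a Q \<phi> \<psi>\<close> is the mark of \<open>a\<close> at \<open>{(\<phi> q, \<psi> q) | q \<in> Q}\<close>. Indexing by pairs of morphisms
  instead of conjugacy classes of twisted diagonals makes multiplication a matrix product.\<close>

definition E :: "(('a \<times> 'a) set set \<Rightarrow> 'r::comm_ring_1) \<Rightarrow> 'a set \<Rightarrow> ('a \<Rightarrow> 'a) \<Rightarrow> ('a \<Rightarrow> 'a) \<Rightarrow> 'r" where
  "E a Q \<phi> \<psi> = (\<Sum>K\<in>sclasses G. a K * of_nat (SS.mark (twisted Q \<phi> \<psi>) (rep K)))"

text \<open>The bilinear extension of \<open>card_fixed_tens\<close>: \<open>sum_coef_mark\<close>
  absorbs the structure constants, and \<open>fdiag_closed\<close> allows \<open>mor Q\<close> as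
  the set of middle maps.\<close>

lemma E_bmult:
  assumes b: "b \<in> RBF G F" and \<phi>: "\<phi> \<in> mor Q" and \<psi>: "\<psi> \<in> mor Q"
  shows "of_nat (card (carrier G)) * E (bmult G a b) Q \<phi> \<psi> = (\<Sum>\<alpha>\<in>mor Q. E a Q \<phi> \<alpha> * E b Q \<alpha> \<psi>)"
proof -
  let ?S = "sclasses G" and ?T = "twisted Q \<phi> \<psi>" and ?n = "card (carrier G)"
  have T: "?T \<subseteq> carrier (G \<times>\<times> G)" by (rule twisted_carrier[OF \<phi> \<psi>])
  have nat: "?n * (\<Sum>K\<in>?S. coef G (rep K1) (rep K2) K * SS.mark ?T (rep K))
      = (\<Sum>\<alpha>\<in>mor Q. SS.mark (twisted Q \<phi> \<alpha>) (rep K1) * SS.mark (twisted Q \<alpha> \<psi>) (rep K2))"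
    if K1: "K1 \<in> ?S" and K2: "K2 \<in> ?S" and fd: "fdiag (rep K2)" for K1 K2
    unfolding sum_coef_mark[OF rep_sclasses(1)[OF K1] rep_sclasses(1)[OF K2] T]
  proof (rule card_fixed_tens[OF rep_sclasses(1)[OF K1] rep_sclasses(1)[OF K2]])
    show "\<And>a a' b. (a, b) \<in> rep K2 \<Longrightarrow> (a', b) \<in> rep K2 \<Longrightarrow> a = a'" by (rule fdiag_free[OF fd])
    show "\<phi> \<in> Q \<rightarrow> carrier G" "\<psi> \<in> Q \<rightarrow> carrier G" using \<phi> \<psi> by (simp_all add: mor_Pi)
    show "finite (mor Q)" by (rule finite_mor)
    show "mor Q \<subseteq> Q \<rightarrow>\<^sub>E carrier G" using mor_props(3) by blast
  qed (rule fdiag_closed[OF fd \<psi>])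
  have "of_nat ?n * E (bmult G a b) Q \<phi> \<psi> = (\<Sum>K\<in>?S. \<Sum>K1\<in>?S. \<Sum>K2\<in>?S.
      a K1 * b K2 * of_nat (?n * (coef G (rep K1) (rep K2) K * SS.mark ?T (rep K))))"
    unfolding E_def bmult_def rep_def[symmetric] sum_distrib_left sum_distrib_right
    by (intro sum.cong refl) (simp add: sum_distrib_left sum_distrib_right mult_ac)
  also have "\<dots> = (\<Sum>K1\<in>?S. \<Sum>K\<in>?S. \<Sum>K2\<in>?S.
      a K1 * b K2 * of_nat (?n * (coef G (rep K1) (rep K2) K * SS.mark ?T (rep K))))"
    by (rule sum.swap)
  also have "\<dots> = (\<Sum>K1\<in>?S. \<Sum>K2\<in>?S. \<Sum>K\<in>?S.
      a K1 * b K2 * of_nat (?n * (coef G (rep K1) (rep K2) K * SS.mark ?T (rep K))))"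
    by (rule sum.cong[OF refl], rule sum.swap)
  also have "\<dots> = (\<Sum>K1\<in>?S. \<Sum>K2\<in>?S. a K1 * b K2 *
      of_nat (?n * (\<Sum>K\<in>?S. coef G (rep K1) (rep K2) K * SS.mark ?T (rep K))))"
    by (simp add: sum_distrib_left)
  also have "\<dots> = (\<Sum>K1\<in>?S. \<Sum>K2\<in>?S. \<Sum>\<alpha>\<in>mor Q.
      (a K1 * of_nat (SS.mark (twisted Q \<phi> \<alpha>) (rep K1))) *
      (b K2 * of_nat (SS.mark (twisted Q \<alpha> \<psi>) (rep K2))))"
  proof (intro sum.cong refl)
    fix K1 K2 assume K: "K1 \<in> ?S" "K2 \<in> ?S"
    show "a K1 * b K2 * of_nat (?n * (\<Sum>K\<in>?S. coef G (rep K1) (rep K2) K * SS.mark ?T (rep K)))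
      = (\<Sum>\<alpha>\<in>mor Q. (a K1 * of_nat (SS.mark (twisted Q \<phi> \<alpha>) (rep K1))) *
          (b K2 * of_nat (SS.mark (twisted Q \<alpha> \<psi>) (rep K2))))"
    \<comment> \<open>Only on the support of \<open>b\<close> is the representative known to be
      \<open>fdiag\<close>; elsewhere both sides vanish with the coefficient.\<close>
    proof (cases "b K2 = 0")
      case False
      show ?thesis
        unfolding nat[OF K RBF_rep(2)[OF b False]]
        unfolding of_nat_sum sum_distrib_left
        by (intro sum.cong refl) (simp add: mult_ac)
    qed simp
  qed
  also have "\<dots> = (\<Sum>K1\<in>?S. \<Sum>\<alpha>\<in>mor Q. \<Sum>K2\<in>?S.
      (a K1 * of_nat (SS.mark (twisted Q \<phi> \<alpha>) (rep K1))) *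
      (b K2 * of_nat (SS.mark (twisted Q \<alpha> \<psi>) (rep K2))))"
    by (rule sum.cong[OF refl], rule sum.swap)
  also have "\<dots> = (\<Sum>\<alpha>\<in>mor Q. E a Q \<phi> \<alpha> * E b Q \<alpha> \<psi>)"
    by (subst sum.swap) (simp add: E_def sum_product)
  finally show ?thesis .
qed

section \<open>Conjugation by S and the marks of the identity\<close>

abbreviation idm :: "'a set \<Rightarrow> 'a \<Rightarrow> 'a" where
  "idm Q \<equiv> (\<lambda>x\<in>Q. x)"

definition cj :: "'a set \<Rightarrow> 'a \<Rightarrow> ('a \<Rightarrow> 'a) \<Rightarrow> ('a \<Rightarrow> 'a)" where
  "cj Q g \<psi> = (\<lambda>q\<in>Q. g \<otimes> \<psi> q \<otimes> inv g)"

text \<open>The matrix of marks of the identity biset, by \<open>E_bone\<close>. The entry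
  \<open>J Q (idm Q) (idm Q)\<close> is the order of the centralizer of \<open>Q\<close>.\<close>

definition J :: "'a set \<Rightarrow> ('a \<Rightarrow> 'a) \<Rightarrow> ('a \<Rightarrow> 'a) \<Rightarrow> nat" where
  "J Q \<phi> \<psi> = card {g \<in> carrier G. cj Q g \<psi> = \<phi>}"

text \<open>The transporter of \<psi>(Q) into \<open>R\<close>: the normalizer of \<open>Q\<close>
  if \<psi> is the identity of \<open>Q\<close> and \<open>R = Q\<close>, and nonempty iff an
  S-conjugate of \<psi>(Q) lies in \<open>R\<close>.\<close>

definition into :: "'a set \<Rightarrow> ('a \<Rightarrow> 'a) \<Rightarrow> 'a set \<Rightarrow> 'a set" where
  "into Q \<psi> R = {h \<in> carrier G. \<forall>q\<in>Q. inv h \<otimes> \<psi> q \<otimes> h \<in> R}"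

lemma cj_mor: "\<lbrakk>\<psi> \<in> mor Q; g \<in> carrier G\<rbrakk> \<Longrightarrow> cj Q g \<psi> \<in> mor Q"
  unfolding cj_def by (rule mor_conj)

lemma cj_eq_iff:
  assumes "\<psi> \<in> mor Q" "\<phi> \<in> mor Q" "g \<in> carrier G"
  shows "cj Q g \<psi> = \<phi> \<longleftrightarrow> (\<forall>q\<in>Q. g \<otimes> \<psi> q \<otimes> inv g = \<phi> q)"
  using mor_ext[OF cj_mor[OF assms(1,3)] assms(2)] by (auto simp: cj_def)

lemma cj_cj:
  assumes "\<psi> \<in> mor Q" "g \<in> carrier G" "h \<in> carrier G"
  shows "cj Q g (cj Q h \<psi>) = cj Q (g \<otimes> h) \<psi>"
  unfolding cj_def using assms mor_closed[OF assms(1)]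
  by (intro restrict_ext) (simp add: fin.inv_mult_group fin.m_assoc)

lemma cj_one:
  assumes "\<psi> \<in> mor Q" shows "cj Q \<one> \<psi> = \<psi>"
  using cj_eq_iff[OF assms assms fin.one_closed] mor_closed[OF assms] by simp

lemma cj_inv:
  assumes "\<psi> \<in> mor Q" "g \<in> carrier G" shows "cj Q (inv g) (cj Q g \<psi>) = \<psi>"
  using cj_cj[OF assms(1) _ assms(2), of "inv g"] assms by (simp add: cj_one)

lemma twisted_cj:
  assumes \<phi>: "\<phi> \<in> mor Q" and \<psi>: "\<psi> \<in> mor Q" and gh: "g \<in> carrier G" "h \<in> carrier G"
  shows "twisted Q (cj Q g \<phi>) (cj Q h \<psi>) =
    (\<lambda>x. (g, h) \<otimes>\<^bsub>G \<times>\<times> G\<^esub> x \<otimes>\<^bsub>G \<times>\<times> G\<^esub> inv\<^bsub>G \<times>\<times> G\<^esub> (g, h)) ` twisted Q \<phi> \<psi>"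
  unfolding twisted_def image_image cj_def
  by (intro image_cong refl) (simp add: inv_pair gh)

lemma E_cj:
  assumes "\<phi> \<in> mor Q" "\<psi> \<in> mor Q" "g \<in> carrier G" "h \<in> carrier G"
  shows "E a Q (cj Q g \<phi>) (cj Q h \<psi>) = E a Q \<phi> \<psi>"
proof -
  have gh: "(g, h) \<in> carrier (G \<times>\<times> G)" using assms by simp
  show ?thesis
    unfolding E_def twisted_cj[OF assms]
    by (intro sum.cong refl)
      (simp only: SS.mark_conj_left[OF rep_sclasses(1) twisted_carrier[OF assms(1,2)] gh])
qed

lemma E_cj_right:
  assumes "\<phi> \<in> mor Q" "\<psi> \<in> mor Q" "h \<in> carrier G"
  shows "E a Q \<phi> (cj Q h \<psi>) = E a Q \<phi> \<psi>"
  using E_cj[OF assms(1,2) fin.one_closed assms(3), of a] cj_one[OF assms(1)] by simp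

lemma E_cj_left:
  assumes "\<phi> \<in> mor Q" "\<psi> \<in> mor Q" "g \<in> carrier G"
  shows "E a Q (cj Q g \<phi>) \<psi> = E a Q \<phi> \<psi>"
  using E_cj[OF assms fin.one_closed, of a] cj_one[OF assms(2)] by simp

text \<open>Column \<psi> of \<open>J\<close> counts the \<open>g\<close> in S by the morphism
  \<open>cj Q g \<psi>\<close>. Multiplying by \<open>J\<close> therefore sums over S-conjugates,
  and on the conjugation-invariant matrices \<open>E\<close> it is the scalar |S|.\<close>

lemma sum_J:
  fixes f :: "('a \<Rightarrow> 'a) \<Rightarrow> 'r::comm_ring_1"
  assumes \<psi>: "\<psi> \<in> mor Q"
  shows "(\<Sum>\<alpha>\<in>mor Q. f \<alpha> * of_nat (J Q \<alpha> \<psi>)) = (\<Sum>g\<in>carrier G. f (cj Q g \<psi>))"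
proof -
  have "(\<lambda>g. cj Q g \<psi>) ` carrier G \<subseteq> mor Q" using cj_mor[OF \<psi>] by blast
  from sum.group[OF fin.finite_carrier finite_mor this, of "\<lambda>g. f (cj Q g \<psi>)"]
  show ?thesis by (simp add: J_def mult.commute)
qed

lemma J_sym:
  assumes "\<phi> \<in> mor Q" "\<psi> \<in> mor Q" shows "J Q \<phi> \<psi> = J Q \<psi> \<phi>"
proof -
  have "bij_betw (\<lambda>g. inv g) {g \<in> carrier G. cj Q g \<psi> = \<phi>} {g \<in> carrier G. cj Q g \<phi> = \<psi>}"
    by (rule bij_betw_byWitness[where f' = "\<lambda>g. inv g"]) (use assms cj_inv in auto)
  then show ?thesis unfolding J_def by (rule bij_betw_same_card)
qed

lemma sum_E_J:
  assumes "\<phi> \<in> mor Q" "\<psi> \<in> mor Q"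
  shows "(\<Sum>\<alpha>\<in>mor Q. E a Q \<phi> \<alpha> * of_nat (J Q \<alpha> \<psi>)) = of_nat (card (carrier G)) * E a Q \<phi> \<psi>"
  unfolding sum_J[OF assms(2)] using assms by (simp add: E_cj_right)

lemma sum_J_E:
  assumes "\<phi> \<in> mor Q" "\<psi> \<in> mor Q"
  shows "(\<Sum>\<alpha>\<in>mor Q. of_nat (J Q \<phi> \<alpha>) * E a Q \<alpha> \<psi>) = of_nat (card (carrier G)) * E a Q \<phi> \<psi>"
proof -
  have "(\<Sum>\<alpha>\<in>mor Q. of_nat (J Q \<phi> \<alpha>) * E a Q \<alpha> \<psi>)
    = (\<Sum>\<alpha>\<in>mor Q. E a Q \<alpha> \<psi> * of_nat (J Q \<alpha> \<phi>))"
    using assms(1) by (intro sum.cong refl) (simp add: J_sym mult.commute)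
  also have "\<dots> = of_nat (card (carrier G)) * E a Q \<phi> \<psi>"
    unfolding sum_J[OF assms(1)] using assms by (simp add: E_cj_left)
  finally show ?thesis .
qed

text \<open>For a pair \<open>(g, h)\<close> the condition is that conjugating \<phi> by
  \<open>inv g\<close> and \<psi> by \<open>inv h\<close> gives the same map, with values in
  \<open>R\<close>. In the coordinates \<open>h\<close> and \<open>g \<otimes> inv h\<close> it
  decouples: the first lies in the transporter, the second conjugates \<psi> to \<phi>.\<close>

lemma mark_diag:
  assumes \<phi>: "\<phi> \<in> mor Q" and \<psi>: "\<psi> \<in> mor Q" and R: "subgroup R G"
  shows "SS.mark (twisted Q \<phi> \<psi>) (twisted R (idm R) (idm R)) * card R = card (into Q \<psi> R) * J Q \<phi> \<psi>"
proof -
  let ?M = "twisted R (idm R) (idm R)"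
  let ?W = "{u \<in> carrier (G \<times>\<times> G). \<forall>d\<in>twisted Q \<phi> \<psi>.
    inv\<^bsub>G \<times>\<times> G\<^esub> u \<otimes>\<^bsub>G \<times>\<times> G\<^esub> d \<otimes>\<^bsub>G \<times>\<times> G\<^esub> u \<in> ?M}"
  let ?A = "{g \<in> carrier G. cj Q g \<psi> = \<phi>}"
  have "card ?M = card R" unfolding twisted_def by (rule card_image) (auto simp: inj_on_def)
  moreover have "card ?W = card (into Q \<psi> R \<times> ?A)"
  proof -
    have M: "(a, b) \<in> ?M \<longleftrightarrow> a = b \<and> b \<in> R" for a b by (auto simp: twisted_def image_iff)
    have W: "(g, h) \<in> ?W \<longleftrightarrow> g \<in> carrier G \<and> h \<in> carrier G \<and>
        (\<forall>q\<in>Q. inv g \<otimes> \<phi> q \<otimes> g = inv h \<otimes> \<psi> q \<otimes> h \<and> inv h \<otimes> \<psi> q \<otimes> h \<in> R)" for g h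
      by (cases "g \<in> carrier G \<and> h \<in> carrier G") (auto simp: twisted_def inv_pair M)
    have key: "inv g \<otimes> \<phi> q \<otimes> g = inv h \<otimes> \<psi> q \<otimes> h
        \<longleftrightarrow> (g \<otimes> inv h) \<otimes> \<psi> q \<otimes> inv (g \<otimes> inv h) = \<phi> q"
      if gh: "g \<in> carrier G" "h \<in> carrier G" and q: "q \<in> Q" for g h q
    proof -
      note c = mor_closed[OF \<phi> q] mor_closed[OF \<psi> q]
      have "inv g \<otimes> \<phi> q \<otimes> g = inv h \<otimes> \<psi> q \<otimes> h
        \<longleftrightarrow> g \<otimes> (inv g \<otimes> \<phi> q \<otimes> g) \<otimes> inv g = g \<otimes> (inv h \<otimes> \<psi> q \<otimes> h) \<otimes> inv g"
        by (rule inj_on_eq_iff[OF fin.inj_on_conj[OF gh(1) order_refl], symmetric]) (use gh c in auto)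
      also have "\<dots> \<longleftrightarrow> \<phi> q = (g \<otimes> inv h) \<otimes> \<psi> q \<otimes> inv (g \<otimes> inv h)"
        unfolding fin.conj_cancel(2)[OF gh(1) c(1)]
        using gh c by (simp add: fin.inv_mult_group fin.m_assoc)
      finally show ?thesis by (simp add: eq_commute)
    qed
    have iff: "(g, h) \<in> ?W \<longleftrightarrow> h \<in> into Q \<psi> R \<and> g \<otimes> inv h \<in> ?A"
      if gh: "g \<in> carrier G" "h \<in> carrier G" for g h
      using gh key[OF gh] cj_eq_iff[OF \<psi> \<phi>, of "g \<otimes> inv h"] unfolding W into_def by auto
    have "bij_betw (\<lambda>(g, h). (h, g \<otimes> inv h)) ?W (into Q \<psi> R \<times> ?A)"
    proof (rule bij_betw_byWitness[where f' = "\<lambda>(h, k). (k \<otimes> h, h)"])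
      show "(\<lambda>(g, h). (h, g \<otimes> inv h)) ` ?W \<subseteq> into Q \<psi> R \<times> ?A"
        using iff by fastforce
      show "(\<lambda>(h, k). (k \<otimes> h, h)) ` (into Q \<psi> R \<times> ?A) \<subseteq> ?W"
      proof
        fix x assume "x \<in> (\<lambda>(h, k). (k \<otimes> h, h)) ` (into Q \<psi> R \<times> ?A)"
        then obtain h k where hk: "x = (k \<otimes> h, h)" "h \<in> into Q \<psi> R" "k \<in> ?A" by auto
        have "h \<in> carrier G" "k \<in> carrier G" using hk by (auto simp: into_def)
        then show "x \<in> ?W" unfolding hk(1) using hk iff[of "k \<otimes> h" h] by (simp add: fin.m_assoc)
      qed
    qed (auto simp: into_def fin.m_assoc)
    then show ?thesis by (rule bij_betw_same_card)
  qed
  ultimately show ?thesis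
    using SS.mark_card[OF twisted_subgroup[OF mor_id[OF R] mor_id[OF R]] twisted_carrier[OF \<phi> \<psi>]]
    by (simp add: card_cartesian_product J_def)
qed

lemma Delta_id: "Delta (carrier G) id (carrier G) = twisted (carrier G) (idm (carrier G)) (idm (carrier G))"
  unfolding Delta_def twisted_def by (auto simp: image_iff)

lemma mark_Delta:
  assumes "\<phi> \<in> mor Q" "\<psi> \<in> mor Q"
  shows "SS.mark (twisted Q \<phi> \<psi>) (Delta (carrier G) id (carrier G)) = J Q \<phi> \<psi>"
proof -
  let ?S = "carrier G"
  have "into Q \<psi> ?S = ?S" using mor_closed[OF assms(2)] by (auto simp: into_def)
  moreover have "card ?S > 0" using fin.finite_carrier fin.one_closed card_gt_0_iff by blast
  ultimately show ?thesis using mark_diag[OF assms carrier_subgroup] by (simp add: Delta_id)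
qed

lemma card_into_cj:
  assumes \<psi>: "\<psi> \<in> mor Q" and g: "g \<in> carrier G"
  shows "card (into Q (cj Q g \<psi>) R) = card (into Q \<psi> R)"
proof -
  have eq: "inv h \<otimes> cj Q g \<psi> q \<otimes> h = inv (inv g \<otimes> h) \<otimes> \<psi> q \<otimes> (inv g \<otimes> h)"
    if "h \<in> carrier G" "q \<in> Q" for h q
    using that g mor_closed[OF \<psi> that(2)] by (simp add: cj_def fin.inv_mult_group fin.m_assoc)
  have iff: "h \<in> into Q (cj Q g \<psi>) R \<longleftrightarrow> inv g \<otimes> h \<in> into Q \<psi> R" if "h \<in> carrier G" for h
    using that g eq[OF that] by (simp add: into_def)
  have "bij_betw (\<lambda>h. inv g \<otimes> h) (into Q (cj Q g \<psi>) R) (into Q \<psi> R)"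
  proof (rule bij_betw_byWitness[where f' = "\<lambda>h. g \<otimes> h"])
    show "(\<lambda>h. inv g \<otimes> h) ` into Q (cj Q g \<psi>) R \<subseteq> into Q \<psi> R"
      using iff by (auto simp: into_def)
    have "g \<otimes> h \<in> into Q (cj Q g \<psi>) R" if h: "h \<in> into Q \<psi> R" for h
    proof -
      have "h \<in> carrier G" using h by (simp add: into_def)
      then show ?thesis using iff[of "g \<otimes> h"] g h by (simp add: fin.m_assoc[symmetric])
    qed
    then show "(\<lambda>h. g \<otimes> h) ` into Q \<psi> R \<subseteq> into Q (cj Q g \<psi>) R" by blast
  qed (use g in \<open>auto simp: into_def fin.m_assoc[symmetric]\<close>)
  then show ?thesis by (rule bij_betw_same_card)
qed

text \<open>A nonzero entry of \<open>J\<close> means that \<phi> and \<psi> are S-conjugate, and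
  then their transporters have equal size. So the transporter factor in \<open>mark_diag\<close> can
  be attached to the row instead of the column.\<close>

lemma into_J:
  assumes "\<phi> \<in> mor Q" "\<psi> \<in> mor Q"
  shows "card (into Q \<psi> R) * J Q \<phi> \<psi> = card (into Q \<phi> R) * J Q \<phi> \<psi>"
proof (cases "{g \<in> carrier G. cj Q g \<psi> = \<phi>} = {}")
  case True
  then have "J Q \<phi> \<psi> = 0" unfolding J_def by (simp only: card.empty)
  then show ?thesis by simp
next
  case False
  then obtain g where "g \<in> carrier G" "cj Q g \<psi> = \<phi>" by blast
  then show ?thesis using card_into_cj[OF assms(2)] by metis
qed

lemma E_basis:
  assumes L: "subgroup L (G \<times>\<times> G)" and "\<phi> \<in> mor Q" "\<psi> \<in> mor Q"
  shows "E (\<lambda>K. if K = ccl G L then 1 else 0) Q \<phi> \<psi>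
    = (of_nat (SS.mark (twisted Q \<phi> \<psi>) L) :: 'r::comm_ring_1)"
proof -
  have K: "ccl G L \<in> sclasses G" using L by (auto simp: sclasses_def)
  have "E (\<lambda>K. if K = ccl G L then 1 else 0) Q \<phi> \<psi>
    = (\<Sum>K\<in>sclasses G. if K = ccl G L then of_nat (SS.mark (twisted Q \<phi> \<psi>) (rep K)) else 0 :: 'r)"
    unfolding E_def by (intro sum.cong refl) simp
  also have "\<dots> = of_nat (SS.mark (twisted Q \<phi> \<psi>) (rep (ccl G L)))"
    using K finite_sclasses by (simp add: sum.delta)
  finally show ?thesis using mark_rep[OF L twisted_carrier[OF assms(2,3)]] by simp
qed

text \<open>Commutation with the basis element of \<open>\<Delta>(Q, id, Q)\<close> forces the matrix of marks of a central
  element to respect the partition of the morphisms by conjugacy of their image to \<open>Q\<close>.\<close>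

lemma central_E_zero:
  fixes e :: "('a \<times> 'a) set set \<Rightarrow> 'r::idom"
  assumes char: "\<And>n. of_nat n = (0::'r) \<Longrightarrow> n = 0"
    and e: "e \<in> RBF G F" and central: "\<forall>x\<in>RBF G F. bmult G e x = bmult G x e"
    and \<phi>: "\<phi> \<in> mor Q" and \<psi>: "\<psi> \<in> mor Q"
    and neq: "into Q \<phi> Q = {}" "into Q \<psi> Q \<noteq> {}"
  shows "E e Q \<phi> \<psi> = 0"
proof -
  note Q = mor_props(1)[OF \<phi>]
  note idQ = mor_id[OF Q]
  let ?L = "twisted Q (idm Q) (idm Q)" and ?n = "of_nat (card (carrier G)) :: 'r"
  define x :: "('a \<times> 'a) set set \<Rightarrow> 'r" where "x = (\<lambda>K. if K = ccl G ?L then 1 else 0)"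
  have x: "x \<in> RBF G F" unfolding x_def by (rule RBF_basis[OF idQ])
  have Ex: "of_nat (card Q) * E x Q \<alpha> \<beta> = of_nat (card (into Q \<beta> Q)) * of_nat (J Q \<alpha> \<beta>)"
    if "\<alpha> \<in> mor Q" "\<beta> \<in> mor Q" for \<alpha> \<beta>
  proof -
    have "of_nat (card Q) * E x Q \<alpha> \<beta> = of_nat (SS.mark (twisted Q \<alpha> \<beta>) ?L * card Q)"
      unfolding x_def E_basis[OF twisted_subgroup[OF idQ idQ] that] by (simp add: mult.commute)
    then show ?thesis unfolding mark_diag[OF that Q] by simp
  qed
  have Ex': "of_nat (card Q) * E x Q \<alpha> \<beta> = of_nat (card (into Q \<alpha> Q)) * of_nat (J Q \<alpha> \<beta>)"
    if "\<alpha> \<in> mor Q" "\<beta> \<in> mor Q" for \<alpha> \<beta>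
    using Ex[OF that] into_J[OF that, of Q] by (metis of_nat_mult)
  have "of_nat (card Q) * (?n * E (bmult G e x) Q \<phi> \<psi>)
    = (\<Sum>\<alpha>\<in>mor Q. E e Q \<phi> \<alpha> * (of_nat (card Q) * E x Q \<alpha> \<psi>))"
    unfolding E_bmult[OF x \<phi> \<psi>] sum_distrib_left by (simp add: mult_ac)
  also have "\<dots> = (\<Sum>\<alpha>\<in>mor Q. of_nat (card (into Q \<psi> Q)) * (E e Q \<phi> \<alpha> * of_nat (J Q \<alpha> \<psi>)))"
    by (intro sum.cong refl) (simp add: Ex \<psi> mult_ac)
  also have "\<dots> = of_nat (card (into Q \<psi> Q)) * (?n * E e Q \<phi> \<psi>)"
    unfolding sum_distrib_left[symmetric] sum_E_J[OF \<phi> \<psi>] ..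
  finally have ex: "of_nat (card Q) * (?n * E (bmult G e x) Q \<phi> \<psi>)
    = of_nat (card (into Q \<psi> Q)) * (?n * E e Q \<phi> \<psi>)" .
  have "of_nat (card Q) * (?n * E (bmult G x e) Q \<phi> \<psi>)
    = (\<Sum>\<alpha>\<in>mor Q. (of_nat (card Q) * E x Q \<phi> \<alpha>) * E e Q \<alpha> \<psi>)"
    unfolding E_bmult[OF e \<phi> \<psi>] sum_distrib_left by (simp add: mult_ac)
  also have "\<dots> = (\<Sum>\<alpha>\<in>mor Q. of_nat (card (into Q \<phi> Q)) * (of_nat (J Q \<phi> \<alpha>) * E e Q \<alpha> \<psi>))"
    by (intro sum.cong refl) (simp add: Ex' \<phi> mult_ac)
  also have "\<dots> = of_nat (card (into Q \<phi> Q)) * (?n * E e Q \<phi> \<psi>)"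
    unfolding sum_distrib_left[symmetric] sum_J_E[OF \<phi> \<psi>] ..
  finally have xe: "of_nat (card Q) * (?n * E (bmult G x e) Q \<phi> \<psi>)
    = of_nat (card (into Q \<phi> Q)) * (?n * E e Q \<phi> \<psi>)" .
  have "bmult G e x = bmult G x e" using central x by blast
  \<comment> \<open>The entry of \<open>e x\<close> carries the transporter factor of \<psi>, that
    of \<open>x e\<close> the factor of \<phi>, which is 0.\<close>
  then have zero: "of_nat (card (into Q \<psi> Q)) * (?n * E e Q \<phi> \<psi>) = 0"
    using ex xe neq(1) by simp
  have "finite (into Q \<psi> Q)" unfolding into_def using fin.finite_carrier by simp
  then have "card (into Q \<psi> Q) \<noteq> 0" using neq(2) by simp
  moreover have "card (carrier G) \<noteq> 0" using fin.finite_carrier fin.one_closed by auto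
  ultimately have "of_nat (card (into Q \<psi> Q)) * ?n \<noteq> 0" using char by (metis mult_eq_0_iff)
  then show ?thesis using zero by simp
qed

lemma centralizer_subgroup:
  assumes Q: "subgroup Q G"
  shows "subgroup {g \<in> carrier G. cj Q g (idm Q) = idm Q} G"
proof (rule fin.subgroupI)
  show "{g \<in> carrier G. cj Q g (idm Q) = idm Q} \<noteq> {}"
    using cj_one[OF mor_id[OF Q]] by blast
  fix a b assume a: "a \<in> {g \<in> carrier G. cj Q g (idm Q) = idm Q}"
  then show "inv a \<in> {g \<in> carrier G. cj Q g (idm Q) = idm Q}"
    using cj_inv[OF mor_id[OF Q], of a] by simp
  assume "b \<in> {g \<in> carrier G. cj Q g (idm Q) = idm Q}"
  with a show "a \<otimes> b \<in> {g \<in> carrier G. cj Q g (idm Q) = idm Q}"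
    using cj_cj[OF mor_id[OF Q], of a b] by simp
qed auto

text \<open>The centralizer of \<open>Q\<close> acts freely on the fixed points of the diagonal of \<open>Q\<close>.\<close>

lemma J_dvd_mark:
  assumes Q: "subgroup Q G" and L: "fdiag L"
  shows "J Q (idm Q) (idm Q) dvd SS.mark (twisted Q (idm Q) (idm Q)) L"
proof -
  define C where "C = {g \<in> carrier G. cj Q g (idm Q) = idm Q}"
  define X where "X = {z \<in> cosets2 G L. \<forall>q\<in>Q. lact G (q, q) z = z}"
  have C: "subgroup C G" unfolding C_def by (rule centralizer_subgroup[OF Q])
  have C_carrier: "c \<in> carrier G" if "c \<in> C" for c using that by (simp add: C_def)
  have Q_carrier: "q \<in> carrier G" if "q \<in> Q" for q using that Q by (simp add: subgroup.mem_carrier)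
  have comm: "q \<otimes> c = c \<otimes> q" if c: "c \<in> C" and q: "q \<in> Q" for c q
  proof -
    have "c \<otimes> q \<otimes> inv c = q"
      using c q cj_eq_iff[OF mor_id[OF Q] mor_id[OF Q], of c] by (simp add: C_def)
    then have "c \<otimes> q \<otimes> inv c \<otimes> c = q \<otimes> c" by simp
    then show ?thesis using C_carrier[OF c] Q_carrier[OF q] by (simp add: fin.m_assoc)
  qed
  have sub: "z \<subseteq> carrier G \<times> carrier G" if "z \<in> X" for z
    using that cosets2_subset[OF fdiag_subgroup[OF L]] by (simp add: X_def)
  interpret Cg: group "G\<lparr>carrier := C\<rparr>" using C fin.subgroup_imp_group by blast
  \<comment> \<open>The element \<open>c\<close> acts through \<open>(c, 1)\<close>. This commutes
    with every \<open>(q, q)\<close> because \<open>c\<close> centralizes \<open>Q\<close>, hence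
    preserves \<open>X\<close>; left freeness of \<open>L\<close> makes the stabilizers
    trivial.\<close>
  interpret A: finite_action "G\<lparr>carrier := C\<rparr>" X "\<lambda>c. lact G (c, \<one>)"
  proof unfold_locales
    show "finite (carrier (G\<lparr>carrier := C\<rparr>))"
      using fin.finite_carrier by (simp add: C_def)
    fix u z assume uz: "u \<in> carrier (G\<lparr>carrier := C\<rparr>)" "z \<in> X"
    then have u: "u \<in> C" by simp
    have "lact G (q, q) (lact G (u, \<one>) z) = lact G (u, \<one>) z" if q: "q \<in> Q" for q
    proof -
      have "lact G (q, q) (lact G (u, \<one>) z) = lact G (u, \<one>) (lact G (q, q) z)"
        using C_carrier[OF u] Q_carrier[OF q] sub[OF uz(2)] by (simp add: lact_lact comm[OF u q])
      then show ?thesis using uz(2) q by (simp add: X_def)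
    qed
    then show "lact G (u, \<one>) z \<in> X"
      using uz(2) cosets2_closed[OF fdiag_subgroup[OF L]] C_carrier[OF u] by (simp add: X_def)
  next
    fix z assume "z \<in> X"
    then show "lact G (\<one>\<^bsub>G\<lparr>carrier := C\<rparr>\<^esub>, \<one>) z = z" using sub lact_one by simp
  next
    fix u v z assume "u \<in> carrier (G\<lparr>carrier := C\<rparr>)" "v \<in> carrier (G\<lparr>carrier := C\<rparr>)" "z \<in> X"
    then show "lact G (u \<otimes>\<^bsub>G\<lparr>carrier := C\<rparr>\<^esub> v, \<one>) z = lact G (u, \<one>) (lact G (v, \<one>) z)"
      using C_carrier sub by (simp add: lact_lact)
  qed
  have "A.stab z = {\<one>\<^bsub>G\<lparr>carrier := C\<rparr>\<^esub>}" if z: "z \<in> X" for z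
  proof (intro equalityI subsetI)
    fix c assume "c \<in> A.stab z"
    then have c: "c \<in> C" "lact G (c, \<one>) z = z" by (auto simp: A.stab_def)
    have "z \<in> cosets2 G L" using z by (simp add: X_def)
    from coset_left_free[OF fdiag_subgroup[OF L] fdiag_free[OF L] this C_carrier[OF c(1)] _ _ c(2)
        lact_one[OF sub[OF z]]]
    show "c \<in> {\<one>\<^bsub>G\<lparr>carrier := C\<rparr>\<^esub>}" by simp
  next
    fix c assume "c \<in> {\<one>\<^bsub>G\<lparr>carrier := C\<rparr>\<^esub>}"
    then show "c \<in> A.stab z"
      using lact_one[OF sub[OF z]] subgroup.one_closed[OF C] by (simp add: A.stab_def)
  qed
  moreover have "finite X" using SS.finite_lcos by (simp add: X_def cosets2_eq)
  ultimately have "card C dvd card X" using A.card_dvd_free by simp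
  moreover have "SS.mark (twisted Q (idm Q) (idm Q)) L = card X"
    unfolding SS.mark_def X_def by (simp add: twisted_def cosets2_eq lact_eq)
  ultimately show ?thesis by (simp add: J_def C_def)
qed

lemma endo_surj:
  assumes "\<alpha> \<in> mor Q" "\<alpha> ` Q \<subseteq> Q" shows "\<alpha> ` Q = Q"
  using endo_inj_surj[OF fin.subgroup_card_pos(1)[OF fin.finite_carrier mor_props(1)[OF assms(1)]]
    assms(2) mor_props(4)[OF assms(1)]] .

lemma E_endo_diag:
  assumes "\<alpha> \<in> mor Q" "\<alpha> ` Q \<subseteq> Q" shows "E a Q \<alpha> \<alpha> = E a Q (idm Q) (idm Q)"
proof -
  have "twisted Q \<alpha> \<alpha> = (\<lambda>x. (x, x)) ` \<alpha> ` Q" by (simp add: twisted_def image_image)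
  also have "\<dots> = twisted Q (idm Q) (idm Q)" unfolding endo_surj[OF assms] by (simp add: twisted_def)
  finally show ?thesis by (simp add: E_def)
qed

lemma into_iff:
  assumes "\<alpha> \<in> mor Q" "h \<in> carrier G"
  shows "h \<in> into Q \<alpha> R \<longleftrightarrow> cj Q (inv h) \<alpha> ` Q \<subseteq> R"
  using assms by (auto simp: into_def cj_def)

text \<open>The subgroup \<open>twisted Q \<alpha> \<alpha>\<close> is the diagonal of \<alpha>(Q),
  and \<alpha>(Q) is S-conjugate to \<open>Q\<close> by the assumption on the transporter. This
  makes the trace on the block a multiple of a single mark.\<close>

lemma E_diag:
  assumes \<alpha>: "\<alpha> \<in> mor Q" and ne: "into Q \<alpha> Q \<noteq> {}"
  shows "E a Q \<alpha> \<alpha> = E a Q (idm Q) (idm Q)"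
proof -
  obtain h where h: "h \<in> into Q \<alpha> Q" using ne by blast
  then have hG: "h \<in> carrier G" by (simp add: into_def)
  have "E a Q (cj Q (inv h) \<alpha>) (cj Q (inv h) \<alpha>) = E a Q \<alpha> \<alpha>"
    using hG by (intro E_cj \<alpha>) simp_all
  moreover have "E a Q (cj Q (inv h) \<alpha>) (cj Q (inv h) \<alpha>) = E a Q (idm Q) (idm Q)"
    using h hG \<alpha> by (intro E_endo_diag cj_mor) (auto simp: into_iff)
  ultimately show ?thesis by simp
qed

lemma E_bone:
  assumes "\<phi> \<in> mor Q" "\<psi> \<in> mor Q"
  shows "E (bone G) Q \<phi> \<psi> = (of_nat (J Q \<phi> \<psi>) :: 'r::comm_ring_1)"
proof -
  have sub: "subgroup (Delta (carrier G) id (carrier G)) (G \<times>\<times> G)"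
    unfolding Delta_id by (intro twisted_subgroup mor_id carrier_subgroup)
  show ?thesis
    unfolding bone_def E_basis[OF sub assms] mark_Delta[OF assms] ..
qed

lemma bone_RBF: "bone G \<in> RBF G F"
  unfolding bone_def Delta_id by (rule RBF_basis[OF mor_id[OF carrier_subgroup]])

lemma J_cj_left:
  assumes "\<phi> \<in> mor Q" "\<psi> \<in> mor Q" "g \<in> carrier G"
  shows "J Q (cj Q g \<phi>) \<psi> = J Q \<phi> \<psi>"
proof -
  \<comment> \<open>Invariance of \<open>J\<close> is read off from that of marks; the integers
    serve because \<open>of_nat\<close> is injective there.\<close>
  have "E (bone G) Q (cj Q g \<phi>) \<psi> = (E (bone G) Q \<phi> \<psi> :: int)" by (rule E_cj_left[OF assms])
  then show ?thesis using assms by (simp add: E_bone cj_mor)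
qed

section \<open>Central idempotents\<close>

text \<open>The index set of the block of \<open>Q\<close>: as all morphisms are injective and
  \<open>Q\<close> is finite, a conjugate of \<alpha>(Q) inside \<open>Q\<close> is all of
  \<open>Q\<close>.\<close>

definition core :: "'a set \<Rightarrow> ('a \<Rightarrow> 'a) set" where
  "core Q = {\<alpha> \<in> mor Q. into Q \<alpha> Q \<noteq> {}}"

lemma AutF_eq: assumes Q: "subgroup Q G" shows "AutF F Q = {\<beta> \<in> mor Q. \<beta> ` Q \<subseteq> Q}"
proof (intro equalityI subsetI)
  fix \<beta> assume "\<beta> \<in> AutF F Q"
  then have "(Q, \<beta>, Q) \<in> F" by (simp add: AutF_def)
  then show "\<beta> \<in> {\<beta> \<in> mor Q. \<beta> ` Q \<subseteq> Q}" using F_mor F_props(3) by blast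
next
  fix \<beta> assume "\<beta> \<in> {\<beta> \<in> mor Q. \<beta> ` Q \<subseteq> Q}"
  then show "\<beta> \<in> AutF F Q" using mor_F[OF _ Q] by (simp add: AutF_def)
qed

lemma card_into_core:
  assumes "\<alpha> \<in> core Q" shows "card (into Q \<alpha> Q) = card (into Q (idm Q) Q)"
proof -
  have \<alpha>: "\<alpha> \<in> mor Q" using assms by (simp add: core_def)
  obtain h where h: "h \<in> into Q \<alpha> Q" using assms by (auto simp: core_def)
  then have hG: "h \<in> carrier G" by (simp add: into_def)
  let ?\<beta> = "cj Q (inv h) \<alpha>"
  have \<beta>: "?\<beta> \<in> mor Q" "?\<beta> ` Q \<subseteq> Q" using \<alpha> hG h by (auto simp: cj_mor into_iff)
  have "into Q ?\<beta> Q = {g \<in> carrier G. \<forall>x\<in>?\<beta> ` Q. inv g \<otimes> x \<otimes> g \<in> Q}"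
    by (auto simp: into_def)
  also have "\<dots> = into Q (idm Q) Q" unfolding endo_surj[OF \<beta>] by (auto simp: into_def)
  finally show ?thesis using card_into_cj[OF \<alpha>, of "inv h" Q] hG by simp
qed

text \<open>Pairs of \<open>g\<close> in S and an F-automorphism \<beta> of \<open>Q\<close> are
  mapped to \<open>cj Q g \<beta>\<close>. Over \<alpha> in the core, \<open>g\<close> determines
  \<beta>, and the admissible \<open>g\<close> form the transporter of \<alpha>(Q) into
  \<open>Q\<close>, which has the size of the normalizer of \<open>Q\<close>.\<close>

lemma card_AutF:
  assumes Q: "subgroup Q G"
  shows "card (carrier G) * card (AutF F Q) = card (core Q) * card (into Q (idm Q) Q)"
proof -
  let ?P = "carrier G \<times> AutF F Q" and ?f = "\<lambda>(g, \<beta>). cj Q g \<beta>"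
  have fin: "finite (AutF F Q)" unfolding AutF_eq[OF Q] using finite_mor by simp
  have fibre: "card {x \<in> ?P. ?f x = \<alpha>} = card (into Q (idm Q) Q)" if \<alpha>: "\<alpha> \<in> core Q" for \<alpha>
  proof -
    have \<alpha>m: "\<alpha> \<in> mor Q" using \<alpha> by (simp add: core_def)
    have "bij_betw (\<lambda>g. (g, cj Q (inv g) \<alpha>)) (into Q \<alpha> Q) {x \<in> ?P. ?f x = \<alpha>}"
    proof (rule bij_betw_byWitness[where f' = fst])
      show "(\<lambda>g. (g, cj Q (inv g) \<alpha>)) ` into Q \<alpha> Q \<subseteq> {x \<in> ?P. ?f x = \<alpha>}"
      proof (rule image_subsetI)
        fix g assume g: "g \<in> into Q \<alpha> Q"
        then have gG: "g \<in> carrier G" by (simp add: into_def)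
        then have "cj Q (inv g) \<alpha> \<in> AutF F Q"
          using g \<alpha>m by (simp add: AutF_eq[OF Q] cj_mor into_iff)
        moreover have "cj Q g (cj Q (inv g) \<alpha>) = \<alpha>"
          using cj_inv[OF \<alpha>m, of "inv g"] gG by simp
        ultimately show "(g, cj Q (inv g) \<alpha>) \<in> {x \<in> ?P. ?f x = \<alpha>}" using gG by simp
      qed
      have *: "cj Q (inv g) \<alpha> = \<beta> \<and> g \<in> into Q \<alpha> Q" if "(g, \<beta>) \<in> {x \<in> ?P. ?f x = \<alpha>}" for g \<beta>
      proof -
        have g: "g \<in> carrier G" "\<beta> \<in> mor Q" "\<beta> ` Q \<subseteq> Q" "cj Q g \<beta> = \<alpha>"
          using that by (auto simp: AutF_eq[OF Q])
        then have "cj Q (inv g) \<alpha> = \<beta>" using cj_inv[OF g(2,1)] by simp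
        with g show ?thesis by (simp add: into_iff[OF \<alpha>m g(1)])
      qed
      show "fst ` {x \<in> ?P. ?f x = \<alpha>} \<subseteq> into Q \<alpha> Q"
      proof (rule image_subsetI)
        fix x assume "x \<in> {x \<in> ?P. ?f x = \<alpha>}"
        with *[of "fst x" "snd x"] show "fst x \<in> into Q \<alpha> Q" by simp
      qed
      show "\<forall>x\<in>{x \<in> ?P. ?f x = \<alpha>}. (fst x, cj Q (inv fst x) \<alpha>) = x"
      proof
        fix x assume "x \<in> {x \<in> ?P. ?f x = \<alpha>}"
        with *[of "fst x" "snd x"] show "(fst x, cj Q (inv fst x) \<alpha>) = x" by simp
      qed
    qed simp
    from bij_betw_same_card[OF this] show ?thesis unfolding card_into_core[OF \<alpha>] by (rule sym)
  qed
  have "?f ` ?P \<subseteq> core Q"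
  proof (rule image_subsetI)
    fix x assume "x \<in> ?P"
    then obtain g \<beta> where x: "x = (g, \<beta>)" "g \<in> carrier G" "\<beta> \<in> mor Q" "\<beta> ` Q \<subseteq> Q"
      by (auto simp: AutF_eq[OF Q])
    then have "g \<in> into Q (cj Q g \<beta>) Q"
      using into_iff[OF cj_mor[OF x(3,2)] x(2)] cj_inv[OF x(3,2)] by simp
    then show "?f x \<in> core Q" using x cj_mor by (auto simp: core_def)
  qed
  moreover have "finite ?P" using fin fin.finite_carrier by simp
  moreover have "finite (core Q)" using finite_mor by (simp add: core_def)
  ultimately have "(\<Sum>\<alpha>\<in>core Q. card {x \<in> ?P. ?f x = \<alpha>}) = card ?P"
    using sum.group[of ?P "core Q" ?f "\<lambda>_. 1::nat"] by simp
  then show ?thesis using fibre by (simp add: card_cartesian_product)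
qed

lemma conjmap_eq_cj: "conjmap G g Q = cj Q g (idm Q)"
  unfolding conjmap_def cj_def by (intro restrict_ext) simp

lemma AutS_eq:
  assumes Q: "subgroup Q G"
  shows "AutS G Q = (\<lambda>h. cj Q (inv h) (idm Q)) ` into Q (idm Q) Q"
proof -
  note idQ = mor_id[OF Q]
  have im: "cj Q g (idm Q) ` Q = (\<lambda>x. g \<otimes> x \<otimes> inv g) ` Q" for g by (auto simp: cj_def)
  show ?thesis
  proof (intro equalityI subsetI)
    fix c assume "c \<in> AutS G Q"
    then obtain g where g: "g \<in> carrier G" "c = cj Q g (idm Q)" "cj Q g (idm Q) ` Q = Q"
      by (auto simp: AutS_def conjmap_eq_cj im)
    then have "inv g \<in> into Q (idm Q) Q" using into_iff[OF idQ, of "inv g" Q] by simp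
    moreover have "c = cj Q (inv (inv g)) (idm Q)" using g by simp
    ultimately show "c \<in> (\<lambda>h. cj Q (inv h) (idm Q)) ` into Q (idm Q) Q" by blast
  next
    fix c assume "c \<in> (\<lambda>h. cj Q (inv h) (idm Q)) ` into Q (idm Q) Q"
    then obtain h where h: "h \<in> into Q (idm Q) Q" "c = cj Q (inv h) (idm Q)" by blast
    then have hG: "inv h \<in> carrier G" "h \<in> carrier G" by (auto simp: into_def)
    have "cj Q (inv h) (idm Q) ` Q = Q"
      using endo_surj[OF cj_mor[OF idQ hG(1)]] h(1) into_iff[OF idQ hG(2)] by simp
    then show "c \<in> AutS G Q" using h(2) hG(1) by (auto simp: AutS_def conjmap_eq_cj im)
  qed
qed

text \<open>The normalizer maps onto Aut_S(Q), and every fibre has the size of the centralizer,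
  which is the diagonal entry of \<open>J\<close>.\<close>

lemma card_AutS:
  assumes Q: "subgroup Q G"
  shows "card (into Q (idm Q) Q) = J Q (idm Q) (idm Q) * card (AutS G Q)"
proof -
  note idQ = mor_id[OF Q]
  let ?N = "into Q (idm Q) Q" and ?f = "\<lambda>h. cj Q (inv h) (idm Q)"
  have finN: "finite ?N" using fin.finite_carrier by (simp add: into_def)
  have fibre: "card {h \<in> ?N. ?f h = \<gamma>} = J Q (idm Q) (idm Q)" if \<gamma>: "\<gamma> \<in> AutS G Q" for \<gamma>
  proof -
    obtain k where k: "k \<in> ?N" "\<gamma> = ?f k" using \<gamma> unfolding AutS_eq[OF Q] by blast
    then have kG: "inv k \<in> carrier G" "k \<in> carrier G" by (auto simp: into_def)
    have "bij_betw (\<lambda>h. inv h) {h \<in> ?N. ?f h = \<gamma>} {g \<in> carrier G. cj Q g (idm Q) = \<gamma>}"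
    proof (rule bij_betw_byWitness[where f' = "\<lambda>h. inv h"])
      have "inv g \<in> ?N" if g: "g \<in> carrier G" "cj Q g (idm Q) = \<gamma>" for g
      proof -
        have "cj Q (inv (inv g)) (idm Q) ` Q \<subseteq> Q"
          unfolding fin.inv_inv[OF g(1)] g(2) k(2) using into_iff[OF idQ kG(2), of Q] k(1) by blast
        then show ?thesis using into_iff[OF idQ, of "inv g" Q] g(1) by simp
      qed
      then show "(\<lambda>h. inv h) ` {g \<in> carrier G. cj Q g (idm Q) = \<gamma>} \<subseteq> {h \<in> ?N. ?f h = \<gamma>}"
        by auto
    qed (auto simp: into_def)
    then have "card {h \<in> ?N. ?f h = \<gamma>} = J Q \<gamma> (idm Q)"
      unfolding J_def by (rule bij_betw_same_card)
    then show ?thesis unfolding k(2) J_cj_left[OF idQ idQ kG(1)] .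
  qed
  have "(\<Sum>\<gamma>\<in>AutS G Q. card {h \<in> ?N. ?f h = \<gamma>}) = card ?N"
    using sum.group[of ?N "AutS G Q" ?f "\<lambda>_. 1::nat"] finN AutS_eq[OF Q] by simp
  then show ?thesis using fibre by (simp add: mult.commute)
qed

text \<open>Conjugation by the identity changes nothing, and Aut_S(Q) lies in Aut_F(Q) because F
  contains the conjugations by S; so the intersection in the index is Aut_S(Q).\<close>

lemma fusion_index_id:
  assumes Q: "subgroup Q G"
  shows "fusion_index G F Q (idm Q) Q = card (AutF F Q) div card (AutS G Q)"
proof -
  note idQ = mor_id[OF Q]
  have S_sub: "c \<in> mor Q \<and> c ` Q \<subseteq> Q" if c: "c \<in> AutS G Q" for c
  proof -
    obtain h where h: "h \<in> into Q (idm Q) Q" "c = cj Q (inv h) (idm Q)"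
      using c unfolding AutS_eq[OF Q] by blast
    then have "h \<in> carrier G" by (simp add: into_def)
    then show ?thesis using h into_iff[OF idQ, of h Q] cj_mor[OF idQ] by simp
  qed
  have "restrict (inv_into Q (idm Q) \<circ> c \<circ> idm Q) Q = c" if c: "c \<in> AutS G Q" for c
  proof -
    have "inv_into Q (idm Q) x = x" if "x \<in> Q" for x
      using inv_into_f_f[of "idm Q" Q x] that by (simp add: inj_on_def)
    then have "restrict (inv_into Q (idm Q) \<circ> c \<circ> idm Q) Q q = c q" if "q \<in> Q" for q
      using that S_sub[OF c] by auto
    moreover have "c \<in> extensional Q" using mor_props(3) S_sub[OF c] by (auto simp: PiE_def)
    ultimately show ?thesis by (intro extensionalityI[of _ Q]) auto
  qed
  then have "(\<lambda>c. restrict (inv_into Q (idm Q) \<circ> c \<circ> idm Q) Q) ` AutS G Q = AutS G Q"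
    by (simp cong: image_cong)
  then have "AutS_conj G Q (idm Q) Q = AutS G Q"
    unfolding AutS_conj_def by (simp add: Setcompr_eq_image)
  moreover have "AutS G Q \<subseteq> AutF F Q" using S_sub by (auto simp: AutF_eq[OF Q])
  ultimately show ?thesis by (simp add: fusion_index_def Int_absorb1)
qed

lemma sum_core:
  assumes "\<And>\<alpha>. \<alpha> \<in> mor Q \<Longrightarrow> into Q \<alpha> Q = {} \<Longrightarrow> f \<alpha> = 0"
  shows "(\<Sum>\<alpha>\<in>core Q. f \<alpha>) = (\<Sum>\<alpha>\<in>mor Q. f \<alpha>)"
  by (rule sum.mono_neutral_left) (use finite_mor assms in \<open>auto simp: core_def\<close>)

lemma J_outside_core:
  assumes \<alpha>: "\<alpha> \<in> mor Q" "into Q \<alpha> Q = {}" and \<psi>: "\<psi> \<in> core Q"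
  shows "J Q \<alpha> \<psi> = 0"
proof -
  have "card (into Q \<psi> Q) \<noteq> 0"
    using \<psi> fin.finite_carrier by (auto simp: core_def into_def)
  moreover have "card (into Q \<psi> Q) * J Q \<alpha> \<psi> = 0"
    using into_J[OF \<alpha>(1), of \<psi> Q] \<alpha>(2) \<psi> by (simp add: core_def)
  ultimately show ?thesis by simp
qed

lemma idm_core: "subgroup Q G \<Longrightarrow> idm Q \<in> core Q"
  using mor_id subgroup.mem_carrier[of Q G] by (auto simp: core_def into_def intro!: exI[of _ "\<one>"])

text \<open>The witness \<open>m\<close> is the factor m_Q. Each mark is divided by the centralizer
  order as a natural number before summing, since that order need not be invertible in the
  ring.\<close>

lemma E_idm_multiple:
  assumes Q: "subgroup Q G" and a: "a \<in> RBF G F"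
  shows "\<exists>m. E a Q (idm Q) (idm Q) = of_nat (J Q (idm Q) (idm Q)) * (m :: 'r::comm_ring_1)"
proof -
  let ?c = "J Q (idm Q) (idm Q)" and ?t = "\<lambda>K. SS.mark (twisted Q (idm Q) (idm Q)) (rep K)"
  have "E a Q (idm Q) (idm Q) = (\<Sum>K\<in>sclasses G. of_nat ?c * (a K * of_nat (?t K div ?c)))"
    unfolding E_def
  proof (intro sum.cong refl)
    fix K assume K: "K \<in> sclasses G"
    show "a K * of_nat (?t K) = of_nat ?c * (a K * of_nat (?t K div ?c))"
    proof (cases "a K = 0")
      case False
      have "?t K = ?c * (?t K div ?c)" using J_dvd_mark[OF Q RBF_rep(2)[OF a False]] by simp
      then have "of_nat (?t K) = (of_nat ?c * of_nat (?t K div ?c) :: 'r)" by (metis of_nat_mult)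
      then show ?thesis by (simp add: mult_ac)
    qed simp
  qed
  then show ?thesis unfolding sum_distrib_left[symmetric] by blast
qed

text \<open>On the core, \<open>E e\<close>, \<open>J\<close> and \<open>J - E e\<close> are idempotent up to the factor \<open>|S|\<close>, so their traces
  are natural multiples of \<open>|S|\<close>. The trace of \<open>E e\<close> is also \<open>m\<close> times that of \<open>J\<close>, which is \<open>|S|\<close>
  times the index of the inner automorphisms; hence the hypothesis on primes gives \<open>m \<in> {0, 1}\<close>.\<close>

lemma E_proportional:
  fixes e :: "('a \<times> 'a) set set \<Rightarrow> 'r::idom"
  assumes char: "\<And>n. of_nat n = (0::'r) \<Longrightarrow> n = 0"
    and e: "e \<in> RBF G F" and idem: "bmult G e e = e"
    and central: "\<forall>x\<in>RBF G F. bmult G e x = bmult G x e"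
    and Q: "subgroup Q G"
    and primes: "\<And>q. prime q \<Longrightarrow> q dvd fusion_index G F Q (idm Q) Q \<Longrightarrow> \<not> of_nat q dvd (1::'r)"
  shows "\<exists>m\<in>{0,1}. \<forall>\<phi>\<in>mor Q. E e Q \<phi> (idm Q) = m * of_nat (J Q \<phi> (idm Q))"
proof -
  note idQ = mor_id[OF Q]
  let ?n = "of_nat (card (carrier G)) :: 'r" and ?c = "J Q (idm Q) (idm Q)" and ?B = "core Q"
  define Y where "Y \<phi> \<psi> = of_nat (J Q \<phi> \<psi>) - E e Q \<phi> \<psi>" for \<phi> \<psi>
  have finB: "finite ?B" using finite_mor by (simp add: core_def)
  have coreD: "\<alpha> \<in> mor Q" "into Q \<alpha> Q \<noteq> {}" if "\<alpha> \<in> ?B" for \<alpha> using that by (auto simp: core_def)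
  have nS: "card (carrier G) \<noteq> 0" using fin.finite_carrier fin.one_closed by auto
  then have n0: "?n \<noteq> 0" using char[of "card (carrier G)"] by argo
  \<comment> \<open>This kills every term whose middle index lies outside the core, so the product
    formulas over \<open>mor Q\<close> restrict to the block.\<close>
  have E0: "E e Q \<alpha> \<psi> = 0" if "\<alpha> \<in> mor Q" "into Q \<alpha> Q = {}" "\<psi> \<in> ?B" for \<alpha> \<psi>
    using central_E_zero[OF char e central that(1) coreD(1)[OF that(3)] that(2) coreD(2)[OF that(3)]] .
  have EE: "(\<Sum>k\<in>?B. E e Q \<phi> k * E e Q k \<psi>) = ?n * E e Q \<phi> \<psi>" if "\<phi> \<in> ?B" "\<psi> \<in> ?B" for \<phi> \<psi>
  proof -
    have "(\<Sum>k\<in>?B. E e Q \<phi> k * E e Q k \<psi>) = (\<Sum>k\<in>mor Q. E e Q \<phi> k * E e Q k \<psi>)"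
      by (rule sum_core) (simp add: E0 that(2))
    also have "\<dots> = ?n * E (bmult G e e) Q \<phi> \<psi>"
      by (rule E_bmult[OF e coreD(1)[OF that(1)] coreD(1)[OF that(2)], symmetric])
    finally show ?thesis unfolding idem .
  qed
  have EJ: "(\<Sum>k\<in>?B. E e Q \<phi> k * of_nat (J Q k \<psi>)) = ?n * E e Q \<phi> \<psi>"
    if "\<phi> \<in> ?B" "\<psi> \<in> ?B" for \<phi> \<psi>
  proof -
    have "(\<Sum>k\<in>?B. E e Q \<phi> k * of_nat (J Q k \<psi>)) = (\<Sum>k\<in>mor Q. E e Q \<phi> k * of_nat (J Q k \<psi>))"
      by (rule sum_core) (simp add: J_outside_core that(2))
    then show ?thesis using that by (simp add: sum_E_J coreD)
  qed
  have JE: "(\<Sum>k\<in>?B. of_nat (J Q \<phi> k) * E e Q k \<psi>) = ?n * E e Q \<phi> \<psi>"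
    if "\<phi> \<in> ?B" "\<psi> \<in> ?B" for \<phi> \<psi>
  proof -
    have "(\<Sum>k\<in>?B. of_nat (J Q \<phi> k) * E e Q k \<psi>) = (\<Sum>k\<in>mor Q. of_nat (J Q \<phi> k) * E e Q k \<psi>)"
      by (rule sum_core) (simp add: E0 that(2))
    then show ?thesis using that by (simp add: sum_J_E coreD)
  qed
  have JJ: "(\<Sum>k\<in>?B. of_nat (J Q \<phi> k) * of_nat (J Q k \<psi>)) = ?n * of_nat (J Q \<phi> \<psi>)"
    if "\<phi> \<in> ?B" "\<psi> \<in> ?B" for \<phi> \<psi>
  proof -
    have "(\<Sum>k\<in>?B. of_nat (J Q \<phi> k) * of_nat (J Q k \<psi>))
      = (\<Sum>k\<in>mor Q. of_nat (J Q \<phi> k) * of_nat (J Q k \<psi>) :: 'r)"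
      by (rule sum_core) (simp add: J_outside_core that(2))
    also have "\<dots> = (\<Sum>k\<in>mor Q. E (bone G) Q \<phi> k * of_nat (J Q k \<psi>) :: 'r)"
      using that by (intro sum.cong refl) (simp add: E_bone coreD)
    also have "\<dots> = ?n * E (bone G) Q \<phi> \<psi>"
      by (rule sum_E_J[OF coreD(1)[OF that(1)] coreD(1)[OF that(2)]])
    also have "\<dots> = ?n * of_nat (J Q \<phi> \<psi>)" using that by (simp add: E_bone coreD)
    finally show ?thesis .
  qed
  have YY: "(\<Sum>k\<in>?B. Y \<phi> k * Y k \<psi>) = ?n * Y \<phi> \<psi>" if "\<phi> \<in> ?B" "\<psi> \<in> ?B" for \<phi> \<psi>
  proof -
    have "(\<Sum>k\<in>?B. Y \<phi> k * Y k \<psi>) = (\<Sum>k\<in>?B. of_nat (J Q \<phi> k) * of_nat (J Q k \<psi>))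
      - (\<Sum>k\<in>?B. of_nat (J Q \<phi> k) * E e Q k \<psi>) - (\<Sum>k\<in>?B. E e Q \<phi> k * of_nat (J Q k \<psi>))
      + (\<Sum>k\<in>?B. E e Q \<phi> k * E e Q k \<psi>)"
      unfolding sum_subtractf[symmetric] sum.distrib[symmetric] Y_def
      by (intro sum.cong refl) (simp add: algebra_simps)
    then show ?thesis
      unfolding EE[OF that] EJ[OF that] JE[OF that] JJ[OF that] Y_def by (simp add: algebra_simps)
  qed
  obtain d where d: "(\<Sum>\<phi>\<in>?B. E e Q \<phi> \<phi>) = ?n * of_nat d"
    "d = 0 \<longrightarrow> (\<forall>\<phi>\<in>?B. \<forall>\<psi>\<in>?B. E e Q \<phi> \<psi> = 0)"
    using scaled_idempotent_trace[of ?B ?n "E e Q"] finB n0 EE by blast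
  obtain d1 where d1: "(\<Sum>\<phi>\<in>?B. Y \<phi> \<phi>) = ?n * of_nat d1"
    "d1 = 0 \<longrightarrow> (\<forall>\<phi>\<in>?B. \<forall>\<psi>\<in>?B. Y \<phi> \<psi> = 0)"
    using scaled_idempotent_trace[of ?B ?n Y] finB n0 YY by blast
  obtain m where m: "E e Q (idm Q) (idm Q) = of_nat ?c * m" using E_idm_multiple[OF Q e] by blast
  have trE: "(\<Sum>\<phi>\<in>?B. E e Q \<phi> \<phi>) = of_nat (card ?B * ?c) * m"
    using m by (simp add: E_diag coreD)
  have "J Q \<phi> \<phi> = ?c" if "\<phi> \<in> ?B" for \<phi>
    using E_diag[OF coreD[OF that], of "bone G :: _ \<Rightarrow> int"] coreD[OF that] idQ by (simp add: E_bone)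
  then have trJ: "(\<Sum>\<phi>\<in>?B. of_nat (J Q \<phi> \<phi>)) = (of_nat (card ?B * ?c) :: 'r)" by simp
  \<comment> \<open>As \<open>J\<close> is the sum of \<open>E e\<close> and \<open>Y\<close>, its
    trace on the core is |S| times \<open>d0\<close>. Comparison with \<open>trJ\<close>,
    \<open>card_AutF\<close> and \<open>card_AutS\<close> identifies \<open>d0\<close> with the
    index of Aut_S(Q) in Aut_F(Q).\<close>
  define d0 where "d0 = d + d1"
  have "(of_nat (card ?B * ?c) :: 'r) = (\<Sum>\<phi>\<in>?B. E e Q \<phi> \<phi>) + (\<Sum>\<phi>\<in>?B. Y \<phi> \<phi>)"
    unfolding trJ[symmetric] sum.distrib[symmetric] Y_def by simp
  then have "(of_nat (card ?B * ?c) :: 'r) = of_nat (card (carrier G) * d0)"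
    unfolding d(1) d1(1) d0_def by (simp add: algebra_simps)
  moreover have inj: "x = y" if "of_nat x = (of_nat y :: 'r)" for x y
    using that char[of "x - y"] char[of "y - x"] by (cases "x \<le> y") (auto simp: of_nat_diff)
  ultimately have Bc: "card ?B * ?c = card (carrier G) * d0" by blast
  have "card (carrier G) * (d0 * card (AutS G Q)) = card (carrier G) * card (AutF F Q)"
    using card_AutF[OF Q] card_AutS[OF Q] Bc by (metis mult.assoc)
  then have idx: "d0 * card (AutS G Q) = card (AutF F Q)" using nS by simp
  have "AutF F Q \<noteq> {}" using idQ by (auto simp: AutF_eq[OF Q])
  moreover have "finite (AutF F Q)" using finite_mor by (simp add: AutF_eq[OF Q])
  ultimately have "card (AutF F Q) > 0" by (simp add: card_gt_0_iff)
  then have d0: "d0 > 0" "card (AutS G Q) > 0" unfolding idx[symmetric] by simp_all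
  then have "fusion_index G F Q (idm Q) Q = d0" unfolding fusion_index_id[OF Q] idx[symmetric] by simp
  then have primes': "\<And>q. prime q \<Longrightarrow> q dvd d0 \<Longrightarrow> \<not> of_nat q dvd (1::'r)" using primes by simp
  \<comment> \<open>Two values of the trace of \<open>E e\<close>: the number of core morphisms
    times the constant diagonal entry, and |S| times the natural number \<open>d\<close>.\<close>
  have "?n * (of_nat d0 * m) = ?n * of_nat d"
    using trans[OF trE[symmetric] d(1)] unfolding Bc of_nat_mult mult.assoc .
  then have md: "of_nat d0 * m = of_nat d" using n0 by simp
  have outside: "E e Q \<phi> (idm Q) = 0 \<and> J Q \<phi> (idm Q) = 0" if "\<phi> \<in> mor Q" "\<phi> \<notin> ?B" for \<phi>
    using that E0[OF that(1) _ idm_core[OF Q]] J_outside_core[OF that(1) _ idm_core[OF Q]]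
    by (simp add: core_def)
  have "d0 dvd d" by (rule dvd_of_of_nat_quotient[OF char md d0(1) primes'])
  \<comment> \<open>A divisor \<open>d0 = d + d1\<close> of \<open>d\<close> is positive and at
    least \<open>d\<close>, so \<open>d\<close> is 0 or \<open>d0\<close>.\<close>
  then have "d = 0 \<or> d1 = 0" using d0_def by (metis add_cancel_right_right dvd_imp_le le_add1 le_antisym not_gr_zero)
  then show ?thesis
  proof
    assume "d = 0"
    then have "\<forall>\<phi>\<in>mor Q. E e Q \<phi> (idm Q) = 0 * of_nat (J Q \<phi> (idm Q))"
      using d(2) outside idm_core[OF Q] by auto
    then show ?thesis by blast
  next
    assume "d1 = 0"
    then have "E e Q \<phi> (idm Q) = of_nat (J Q \<phi> (idm Q))" if "\<phi> \<in> ?B" for \<phi>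
      using d1(2) idm_core[OF Q] that by (auto simp: Y_def)
    then have "\<forall>\<phi>\<in>mor Q. E e Q \<phi> (idm Q) = 1 * of_nat (J Q \<phi> (idm Q))"
      using outside by (metis mult_1 of_nat_0)
    then show ?thesis by blast
  qed
qed

section \<open>Comparison of the factors of different subgroups modulo p\<close>

lemma fdiag_snd_subgroup:
  assumes "fdiag M" shows "subgroup (snd ` M) G"
proof -
  obtain R \<phi> \<psi> where R: "\<phi> \<in> mor R" "\<psi> \<in> mor R" "M = twisted R \<phi> \<psi>"
    using assms by (auto simp: fdiag_def)
  then have "snd ` M = \<psi> ` R" by (simp add: twisted_def image_image)
  then show ?thesis using mor_props(2)[OF R(2)] by simp
qed

text \<open>The biset S x S / M modulo its free left S-action is S / pr_2(M). A point over a
  \<open>Q\<close>-fixed coset has exactly one \<phi> for which all \<open>(\<phi> q, q)\<close> fix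
  it, and there are |S| points over each coset. In the proof the sets \<open>W \<phi>\<close>
  partition \<open>carrier G \<times> V\<close>.\<close>

lemma sum_mark_twisted:
  assumes Q: "subgroup Q G" and M: "fdiag M"
  shows "(\<Sum>\<phi>\<in>mor Q. SS.mark (twisted Q \<phi> (idm Q)) M) = card (carrier G) * fin.mark Q (snd ` M)"
proof -
  note idQ = mor_id[OF Q] and Mg = fdiag_subgroup[OF M]
  note sndM = fdiag_snd_subgroup[OF M]
  have M_carrier: "M \<subseteq> carrier G \<times> carrier G" using subgroup.subset[OF Mg] by simp
  have card_snd: "card (snd ` M) = card M"
    by (rule card_image) (use fdiag_free[OF M] in \<open>auto simp: inj_on_def\<close>)
  define W where "W \<phi> = {u \<in> carrier (G \<times>\<times> G). \<forall>q\<in>Q.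
    inv\<^bsub>G \<times>\<times> G\<^esub> u \<otimes>\<^bsub>G \<times>\<times> G\<^esub> (\<phi> q, q) \<otimes>\<^bsub>G \<times>\<times> G\<^esub> u \<in> M}" for \<phi>
  define V where "V = {h \<in> carrier G. \<forall>q\<in>Q. inv h \<otimes> q \<otimes> h \<in> snd ` M}"
  have W_iff: "(g, h) \<in> W \<phi> \<longleftrightarrow> g \<in> carrier G \<and> h \<in> carrier G \<and>
      (\<forall>q\<in>Q. (inv g \<otimes> \<phi> q \<otimes> g, inv h \<otimes> q \<otimes> h) \<in> M)" for g h \<phi>
  proof (cases "g \<in> carrier G \<and> h \<in> carrier G")
    case True
    then have "inv\<^bsub>G \<times>\<times> G\<^esub> (g, h) = (inv g, inv h)" by (simp add: inv_pair)
    with True show ?thesis by (simp add: W_def)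
  qed (auto simp: W_def)
  have mark_W: "SS.mark (twisted Q \<phi> (idm Q)) M * card M = card (W \<phi>)" if "\<phi> \<in> mor Q" for \<phi>
  proof -
    have "twisted Q \<phi> (idm Q) = (\<lambda>q. (\<phi> q, q)) ` Q" by (simp add: twisted_def)
    then show ?thesis
      using SS.mark_card[OF Mg twisted_carrier[OF that idQ]] by (simp add: W_def)
  qed
  have union: "(\<Union>\<phi>\<in>mor Q. W \<phi>) = carrier G \<times> V"
  proof (intro equalityI subsetI)
    fix u assume "u \<in> (\<Union>\<phi>\<in>mor Q. W \<phi>)"
    then obtain \<phi> g h where u: "u = (g, h)" "(g, h) \<in> W \<phi>" by (metis UN_E prod.collapse)
    then show "u \<in> carrier G \<times> V" unfolding W_iff V_def by force
  next
    fix u assume "u \<in> carrier G \<times> V"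
    then obtain g h where u: "u = (g, h)" "g \<in> carrier G" "h \<in> V" by blast
    have h: "h \<in> carrier G" using u(3) by (simp add: V_def)
    have "\<forall>q\<in>Q. \<exists>r. (r, inv h \<otimes> q \<otimes> h) \<in> M"
    proof
      fix q assume "q \<in> Q"
      then have "inv h \<otimes> q \<otimes> h \<in> snd ` M" using u(3) by (simp add: V_def)
      then show "\<exists>r. (r, inv h \<otimes> q \<otimes> h) \<in> M" by force
    qed
    from bchoice[OF this] obtain r where r: "\<And>q. q \<in> Q \<Longrightarrow> (r q, inv h \<otimes> q \<otimes> h) \<in> M" by blast
    have rc: "r q \<in> carrier G" if "q \<in> Q" for q using r[OF that] M_carrier by blast
    \<comment> \<open>The only possible map, since freeness makes \<open>r q\<close> unique;
      \<open>fdiag_closed\<close> shows that it is a morphism.\<close>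
    define \<phi> where "\<phi> = (\<lambda>q\<in>Q. g \<otimes> r q \<otimes> inv g)"
    have W: "(g, h) \<in> W \<phi>"
      unfolding W_iff using u(2) h r rc by (simp add: \<phi>_def fin.conj_cancel)
    have "\<phi> \<in> mor Q"
    proof (rule fdiag_closed[OF M idQ])
      show "\<phi> \<in> Q \<rightarrow>\<^sub>E carrier G" using rc u(2) by (auto simp: \<phi>_def)
      show "(g, h) \<in> carrier (G \<times>\<times> G)" using u(2) h by simp
      show "inv\<^bsub>G \<times>\<times> G\<^esub> (g, h) \<otimes>\<^bsub>G \<times>\<times> G\<^esub> (\<phi> q, idm Q q) \<otimes>\<^bsub>G \<times>\<times> G\<^esub> (g, h) \<in> M" if "q \<in> Q" for q
        using W that unfolding W_def restrict_apply'[OF that] by blast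
    qed
    then show "u \<in> (\<Union>\<phi>\<in>mor Q. W \<phi>)" using W u(1) by blast
  qed
  have disj: "W \<phi> \<inter> W \<psi> = {}" if "\<phi> \<in> mor Q" "\<psi> \<in> mor Q" "\<phi> \<noteq> \<psi>" for \<phi> \<psi>
  proof (rule ccontr)
    assume "W \<phi> \<inter> W \<psi> \<noteq> {}"
    then obtain g h where gh: "(g, h) \<in> W \<phi>" "(g, h) \<in> W \<psi>" by auto
    then have g: "g \<in> carrier G" by (simp add: W_iff)
    have "\<phi> q = \<psi> q" if q: "q \<in> Q" for q
    proof -
      have eq: "inv g \<otimes> \<phi> q \<otimes> g = inv g \<otimes> \<psi> q \<otimes> g"
        using gh q unfolding W_iff by (blast intro: fdiag_free[OF M])
      have "\<phi> q = g \<otimes> (inv g \<otimes> \<phi> q \<otimes> g) \<otimes> inv g"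
        by (rule fin.conj_cancel(2)[OF g mor_closed[OF \<open>\<phi> \<in> mor Q\<close> q], symmetric])
      also have "\<dots> = g \<otimes> (inv g \<otimes> \<psi> q \<otimes> g) \<otimes> inv g" by (simp only: eq)
      also have "\<dots> = \<psi> q" by (rule fin.conj_cancel(2)[OF g mor_closed[OF \<open>\<psi> \<in> mor Q\<close> q]])
      finally show ?thesis .
    qed
    with mor_ext[OF that(1,2)] that(3) show False by simp
  qed
  have "(\<Sum>\<phi>\<in>mor Q. SS.mark (twisted Q \<phi> (idm Q)) M) * card M = (\<Sum>\<phi>\<in>mor Q. card (W \<phi>))"
    unfolding sum_distrib_right using mark_W by simp
  also have "\<dots> = card (carrier G \<times> V)"
    unfolding union[symmetric] using disj finite_mor SS.finite_carrier
    by (intro card_UN_disjoint[symmetric]) (auto simp: W_def)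
  also have "\<dots> = card (carrier G) * (fin.mark Q (snd ` M) * card M)"
    using fin.mark_card[OF sndM subgroup.subset[OF Q]] card_snd
    by (simp add: card_cartesian_product V_def)
  finally show ?thesis using SS.subgroup_card_pos[OF SS.finite_carrier Mg] by auto
qed

text \<open>Summing the marks over all morphisms turns the proportionality factor into a combination of
  marks of the left \<open>S\<close>-sets \<open>S / pr\<^sub>2(L)\<close>, which for a \<open>p\<close>-subgroup are constant modulo \<open>p\<close>.\<close>

lemma factor_congruence:
  fixes e :: "('a \<times> 'a) set set \<Rightarrow> 'r::idom"
  assumes char: "\<And>n. of_nat n = (0::'r) \<Longrightarrow> n = 0" and e: "e \<in> RBF G F"
    and p: "prime p" "card (carrier G) = p ^ n" and Q: "subgroup Q G"
    and fac: "\<forall>\<phi>\<in>mor Q. E e Q \<phi> (idm Q) = m * of_nat (J Q \<phi> (idm Q))"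
  shows "of_nat p dvd (\<Sum>K\<in>sclasses G. e K * of_nat (card (fin.lcos (snd ` rep K)))) - m"
proof -
  note idQ = mor_id[OF Q]
  let ?n = "of_nat (card (carrier G)) :: 'r"
  have "card (carrier G) \<noteq> 0" using fin.finite_carrier fin.one_closed by auto
  then have n0: "?n \<noteq> 0" using char[of "card (carrier G)"] by argo
  \<comment> \<open>By \<open>sum_J\<close> for the constant function 1, the column of
    \<open>J\<close> at the identity sums to |S|; the column of \<open>E e\<close> therefore sums to
    |S| times \<open>m\<close>.\<close>
  have "?n * m = m * (\<Sum>g\<in>carrier G. 1)" by simp
  also have "\<dots> = (\<Sum>\<phi>\<in>mor Q. m * of_nat (J Q \<phi> (idm Q)))"
    using sum_J[OF idQ, of "\<lambda>_. 1::'r"] by (simp add: sum_distrib_left[symmetric])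
  also have "\<dots> = (\<Sum>\<phi>\<in>mor Q. E e Q \<phi> (idm Q))" using fac by simp
  also have "\<dots> = (\<Sum>K\<in>sclasses G. e K * of_nat (\<Sum>\<phi>\<in>mor Q. SS.mark (twisted Q \<phi> (idm Q)) (rep K)))"
    unfolding E_def by (subst sum.swap) (simp add: sum_distrib_left)
  also have "\<dots> = (\<Sum>K\<in>sclasses G. ?n * (e K * of_nat (fin.mark Q (snd ` rep K))))"
  proof (intro sum.cong refl)
    fix K
    show "e K * of_nat (\<Sum>\<phi>\<in>mor Q. SS.mark (twisted Q \<phi> (idm Q)) (rep K))
      = ?n * (e K * of_nat (fin.mark Q (snd ` rep K)))"
    proof (cases "e K = 0")
      case False
      show ?thesis unfolding sum_mark_twisted[OF Q RBF_rep(2)[OF e False]] by (simp add: mult_ac)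
    qed simp
  qed
  finally have m: "m = (\<Sum>K\<in>sclasses G. e K * of_nat (fin.mark Q (snd ` rep K)))"
    unfolding sum_distrib_left[symmetric] using n0 by simp
  have "card Q dvd p ^ n" using fin.card_lcos[OF Q] p(2) by (metis dvd_triv_right)
  then obtain i where i: "card Q = p ^ i" using p(1) by (auto simp: divides_primepow_nat)
  have "of_nat p dvd e K * of_nat (card (fin.lcos (snd ` rep K))) - e K * of_nat (fin.mark Q (snd ` rep K))" for K
  proof (cases "e K = 0")
    case False
    obtain k where "card (fin.lcos (snd ` rep K)) = fin.mark Q (snd ` rep K) + p * k"
      using fin.mark_cong_prime[OF fdiag_snd_subgroup[OF RBF_rep(2)[OF e False]] Q p(1) i] by blast
    then show ?thesis by (simp add: algebra_simps)
  qed simp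
  then show ?thesis unfolding m sum_subtractf[symmetric] by (intro dvd_sum) blast
qed

text \<open>The table of marks is triangular. For a class of maximal subgroup order in the support,
  every other class of the support has mark 0 there: a nonzero mark would put the subgroup inside a
  conjugate of one that is no larger, making the classes equal. Only the class's own mark remains,
  and it is nonzero because the base coset is fixed.\<close>

lemma marks_determine:
  fixes a :: "('a \<times> 'a) set set \<Rightarrow> 'r::idom"
  assumes char: "\<And>n. of_nat n = (0::'r) \<Longrightarrow> n = 0" and a: "a \<in> RBF G F"
    and zero: "\<And>Q \<phi>. subgroup Q G \<Longrightarrow> \<phi> \<in> mor Q \<Longrightarrow> E a Q \<phi> (idm Q) = 0"
  shows "a K = 0"
proof (rule ccontr)
  assume "a K \<noteq> 0"
  let ?A = "{K. a K \<noteq> 0}"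
  have sub: "?A \<subseteq> sclasses G" using RBF_rep(1)[OF a] by blast
  have "finite ?A" using sub finite_sclasses by (rule finite_subset)
  moreover have "?A \<noteq> {}" using \<open>a K \<noteq> 0\<close> by blast
  ultimately obtain M where M: "M \<in> ?A" "\<And>N. N \<in> ?A \<Longrightarrow> card (rep N) \<le> card (rep M)"
  proof -
    let ?C = "(\<lambda>K. card (rep K)) ` ?A"
    assume fin: "finite ?A" and ne: "?A \<noteq> {}"
    then have "Max ?C \<in> ?C" by (intro Max_in) auto
    then obtain M where M: "M \<in> ?A" "card (rep M) = Max ?C" by auto
    have "card (rep N) \<le> card (rep M)" if "N \<in> ?A" for N
      unfolding M(2) using fin that by (intro Max_ge) auto
    then show thesis using that M(1) by blast
  qed
  then obtain Q \<phi> where Q: "subgroup Q G" "\<phi> \<in> mor Q" "M = ccl G (twisted Q \<phi> (idm Q))"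
    using RBF_support[OF a, of M] by blast
  let ?T = "twisted Q \<phi> (idm Q)"
  have T: "subgroup ?T (G \<times>\<times> G)" by (rule twisted_subgroup[OF Q(2) mor_id[OF Q(1)]])
  have cardM: "card (rep M) = card ?T" unfolding Q(3) by (rule ccl_mem(3)[OF T rep_ccl[OF T]])
  have mark0: "SS.mark ?T (rep N) = 0" if N: "N \<in> ?A" "N \<noteq> M" for N
  proof (rule ccontr)
    assume ne: "SS.mark ?T (rep N) \<noteq> 0"
    have repN: "subgroup (rep N) (G \<times>\<times> G)" "ccl G (rep N) = N"
      using rep_sclasses N(1) sub by blast+
    have "card {u \<in> carrier (G \<times>\<times> G). \<forall>d\<in>?T.
        inv\<^bsub>G \<times>\<times> G\<^esub> u \<otimes>\<^bsub>G \<times>\<times> G\<^esub> d \<otimes>\<^bsub>G \<times>\<times> G\<^esub> u \<in> rep N} \<noteq> 0"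
      using SS.mark_card[OF repN(1) subgroup.subset[OF T]] ne
        SS.subgroup_card_pos[OF SS.finite_carrier repN(1)] by (metis mult_is_0 not_gr_zero)
    then have "{u \<in> carrier (G \<times>\<times> G). \<forall>d\<in>?T.
        inv\<^bsub>G \<times>\<times> G\<^esub> u \<otimes>\<^bsub>G \<times>\<times> G\<^esub> d \<otimes>\<^bsub>G \<times>\<times> G\<^esub> u \<in> rep N} \<noteq> {}"
      by (metis card.empty)
    then obtain u where u: "u \<in> carrier (G \<times>\<times> G)"
      "\<forall>d\<in>?T. inv\<^bsub>G \<times>\<times> G\<^esub> u \<otimes>\<^bsub>G \<times>\<times> G\<^esub> d \<otimes>\<^bsub>G \<times>\<times> G\<^esub> u \<in> rep N" by blast
    let ?c = "\<lambda>x. u \<otimes>\<^bsub>G \<times>\<times> G\<^esub> x \<otimes>\<^bsub>G \<times>\<times> G\<^esub> inv\<^bsub>G \<times>\<times> G\<^esub> u"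
    have "?T \<subseteq> ?c ` rep N"
      using u SS.conj_mem_iff[OF u(1) subgroup.subset[OF repN(1)]] subgroup.subset[OF T] by blast
    moreover have "card (?c ` rep N) = card (rep N)"
      by (rule card_image[OF SS.inj_on_conj[OF u(1) subgroup.subset[OF repN(1)]]])
    moreover have "finite (?c ` rep N)"
      using SS.subgroup_card_pos(1)[OF SS.finite_carrier repN(1)] by simp
    ultimately have "?T = ?c ` rep N"
      using M(2)[OF N(1)] cardM by (intro card_seteq) auto
    then have "ccl G ?T = N" using ccl_conj[OF repN(1) u(1)] repN(2) by simp
    then show False using N(2) Q(3) by simp
  qed
  have "SS.mark ?T (rep M) = SS.mark ?T ?T" unfolding Q(3) by (rule mark_rep[OF T subgroup.subset[OF T]])
  also have "\<dots> \<noteq> 0"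
  proof -
    have "\<forall>d\<in>?T. SS.transl d ?T = ?T"
      using SS.stab_base[OF T] unfolding finite_action.stab_def[OF SS.coset_action[OF T]] by blast
    then have "?T \<in> {C \<in> SS.lcos ?T. \<forall>d\<in>?T. SS.transl d C = C}" using SS.base_coset[OF T] by simp
    moreover have "finite {C \<in> SS.lcos ?T. \<forall>d\<in>?T. SS.transl d C = C}" using SS.finite_lcos by simp
    ultimately have "card {C \<in> SS.lcos ?T. \<forall>d\<in>?T. SS.transl d C = C} > 0"
      unfolding card_gt_0_iff by blast
    then show ?thesis unfolding SS.mark_def by simp
  qed
  finally have markM: "of_nat (SS.mark ?T (rep M)) \<noteq> (0::'r)"
    using char[of "SS.mark ?T (rep M)"] by argo
  have "E a Q \<phi> (idm Q) = (\<Sum>K\<in>sclasses G. if K = M then a M * of_nat (SS.mark ?T (rep M)) else 0)"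
    unfolding E_def
  proof (intro sum.cong refl)
    fix K
    show "a K * of_nat (SS.mark ?T (rep K)) = (if K = M then a M * of_nat (SS.mark ?T (rep M)) else 0)"
    proof (cases "a K = 0 \<or> K = M")
      case False
      then have "SS.mark ?T (rep K) = 0" by (intro mark0) simp_all
      with False show ?thesis by simp
    next
      case True
      then show ?thesis using M(1) by auto
    qed
  qed
  also have "\<dots> = a M * of_nat (SS.mark ?T (rep M))"
    using M(1) sub finite_sclasses by (subst sum.delta) auto
  finally show False using zero[OF Q(1,2)] M(1) markM by simp
qed

end

theorem theorem4p3:
  fixes G :: "('a, 'b) monoid_scheme"
    and F :: "('a set \<times> ('a \<Rightarrow> 'a) \<times> 'a set) set"
    and p :: nat
    and e :: "('a \<times> 'a) set set \<Rightarrow> 'r::idom"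
  assumes "group G" and "finite (carrier G)"
    and "prime p" and "\<exists>n. card (carrier G) = p ^ n"
    and "fusion_system G F"
    and "of_nat p \<noteq> (0::'r)" and "\<not> (of_nat p dvd (1::'r))"
    and "\<forall>P \<phi> Q q. (P, \<phi>, Q) \<in> F \<and> \<phi> ` P = Q \<and> prime (q::nat) \<and> q dvd fusion_index G F P \<phi> Q
           \<longrightarrow> of_nat q \<noteq> (0::'r) \<and> \<not> (of_nat q dvd (1::'r))"
    and "e \<in> RBF G F"
    and "bmult G e e = e"
    and "\<forall>x \<in> RBF G F. bmult G e x = bmult G x e"
  shows "e = bzero \<or> e = bone G"
proof -
  interpret fusion G F
    using assms(1,2,5) by (simp add: fusion_def biset_def finite_group_def finite_group_axioms_def
        fusion_axioms_def)
  obtain n where n: "card (carrier G) = p ^ n" using assms(4) by blast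
  have char: "k = 0" if "of_nat k = (0::'r)" for k
    by (rule of_nat_eq_0_if_nonunit_prime[OF assms(3,6,7) that])
  note e = assms(9)
  \<comment> \<open>All local factors are congruent modulo \<open>p\<close> to this element, in
    which no \<open>Q\<close> occurs.\<close>
  let ?c = "\<Sum>K\<in>sclasses G. e K * of_nat (card (fin.lcos (snd ` rep K)))"
  have local: "\<exists>m\<in>{0,1}. (\<forall>\<phi>\<in>mor Q. E e Q \<phi> (idm Q) = m * of_nat (J Q \<phi> (idm Q)))
      \<and> of_nat p dvd ?c - m" if Q: "subgroup Q G" for Q
  proof -
    have "(Q, idm Q, Q) \<in> F" by (rule F_incl[OF Q Q order_refl])
    moreover have "idm Q ` Q = Q" by simp
    ultimately have "\<not> of_nat q dvd (1::'r)" if "prime q" "q dvd fusion_index G F Q (idm Q) Q" for q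
      using assms(8) that by blast
    from E_proportional[OF char e assms(10,11) Q this]
    obtain m where m: "m \<in> {0,1}" "\<forall>\<phi>\<in>mor Q. E e Q \<phi> (idm Q) = m * of_nat (J Q \<phi> (idm Q))"
      by blast
    with factor_congruence[OF char e assms(3) n Q m(2)] show ?thesis by blast
  qed
  obtain m0 where m0: "m0 \<in> {0,1}" "of_nat p dvd ?c - m0"
    using local[OF carrier_subgroup] by blast
  have E_e: "E e Q \<phi> (idm Q) = m0 * of_nat (J Q \<phi> (idm Q))"
    if Q: "subgroup Q G" and \<phi>: "\<phi> \<in> mor Q" for Q \<phi>
  proof -
    obtain m where m: "m \<in> {0,1}" "\<forall>\<phi>\<in>mor Q. E e Q \<phi> (idm Q) = m * of_nat (J Q \<phi> (idm Q))"
      "of_nat p dvd ?c - m"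
      using local[OF Q] by blast
    have "of_nat p dvd m - m0" using dvd_diff[OF m0(2) m(3)] by simp
    moreover have "of_nat p dvd m0 - m" using dvd_diff[OF m(3) m0(2)] by simp
    \<comment> \<open>If the two values in {0, 1} differed, one of the two differences would be 1,
      making \<open>p\<close> a unit.\<close>
    ultimately have "m = m0" using m0(1) m(1) assms(7) by auto
    then show ?thesis using m(2) \<phi> by blast
  qed
  \<comment> \<open>The candidate \<open>m0\<close> times the identity is subtracted; all marks of
    the difference vanish, so \<open>marks_determine\<close> applies.\<close>
  define a where "a K = e K - m0 * bone G K" for K
  have a: "a \<in> RBF G F"
    unfolding RBF_def RB_def
  proof (intro CollectI conjI allI impI)
    have b: "bone G \<in> (RBF G F :: (('a \<times> 'a) set set \<Rightarrow> 'r) set)" by (rule bone_RBF)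
    show "a K = 0" if "K \<notin> sclasses G" for K
    proof -
      have "e K = 0" "bone G K = (0::'r)" using that RBF_rep(1)[OF e] RBF_rep(1)[OF b] by blast+
      then show ?thesis by (simp add: a_def)
    qed
    show "\<exists>P \<phi> Q. (Q, \<phi>, P) \<in> F \<and> \<phi> ` Q = P \<and> K = ccl G (Delta P \<phi> Q)" if "a K \<noteq> 0" for K
    proof -
      have "e K \<noteq> 0 \<or> bone G K \<noteq> (0::'r)" using that by (auto simp: a_def)
      then show ?thesis using e b unfolding RBF_def by blast
    qed
  qed
  have "E a Q \<phi> (idm Q) = 0" if Q: "subgroup Q G" and \<phi>: "\<phi> \<in> mor Q" for Q \<phi>
  proof -
    have "E a Q \<phi> (idm Q) = E e Q \<phi> (idm Q) - m0 * E (bone G) Q \<phi> (idm Q)"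
      unfolding E_def a_def sum_distrib_left sum_subtractf[symmetric]
      by (intro sum.cong refl) (simp add: algebra_simps)
    then show ?thesis unfolding E_e[OF Q \<phi>] E_bone[OF \<phi> mor_id[OF Q]] by simp
  qed
  from marks_determine[OF char a this] have "e K = m0 * bone G K" for K
    unfolding a_def by simp
  then show ?thesis using m0(1) by (auto simp: fun_eq_iff bzero_def)
qed

end
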